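(* Let $(\mathcal V,d,\mu)$ be the weighted homogeneous tree of order $q+1$ and let $H^1(\mu)$ be the atomic Hardy space on it, as defined in the context. Let $1<p<p_1\le\infty$ and let $\theta\in(0,1)$ be such that $\frac1p=1-\theta+\frac{\theta}{p_1}$ (with $\theta/\infty=0$). Then $$\big[H^1(\mu),L^{p_1}(\mu)\big]_{\theta,p}=L^p(\mu),$$ where $[\cdot,\cdot]_{\theta,p}$ denotes the real interpolation space given by the $K$-method.
   Context: Weighted tree. Fix an integer $q\ge 2$. $\mathcal V$ is the vertex set of the infinite homogeneous tree of order $q+1$, i.e. the connected acyclic graph in which every vertex has exactly $q+1$ neighbours; $d$ is the graph distance. Fix a doubly-infinite geodesic $g\subset\mathcal V$ (a connected subset in which every element has exactly two neighbours belonging to $g$ and which contains the shortest path between any two of its elements) and a map $N:g\to\mathbb Z$ with $|N(x)-N(y)|=d(x,y)$ for all $x,y\in g$. The level function $\ell:\mathcal V\to\mathbb Z$ is $\ell(x)=N(x')-d(x,x')$, where $x'$ is the unique vertex of $g$ closest to $x$. The measure $\mu$ on $\mathcal V$ is $\int_{\mathcal V}f\,d\mu=\sum_{x\in\mathcal V}f(x)q^{\ell(x)}$. A vertex $x$ lies below a vertex $y$ if $\ell(x)=\ell(y)-d(x,y)$. Calderón–Zygmund sets. An admissible trapezoid is a set $R\subset\mathcal V$ that is either a single vertex $R=\{x_R\}$ (degenerate case; put $h(R)=1$), or of the form $R=\{x\in\mathcal V: x\text{ lies below }x_R,\ h\le \ell(x_R)-\ell(x)<2h\}$ for some $x_R\in\mathcal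 V$ and some integer $h\ge1$ (put $h(R)=h$). The envelope of $R$ is $\tilde R=\{x\in\mathcal V: x\text{ lies below }x_R,\ \tfrac h2\le \ell(x_R)-\ell(x)<4h\}$ in the nondegenerate case, and $\tilde R=R$ in the degenerate case. A Calderón–Zygmund set is the envelope of an admissible trapezoid. Hardy space. A $(1,\infty)$-atom is a function $a:\mathcal V\to\mathbb C$ such that: $a$ is supported in a Calderón–Zygmund set $\tilde R$; $\|a\|_{L^\infty}\le\mu(\tilde R)^{-1}$; and $\int_{\mathcal V}a\,d\mu=0$. $H^1(\mu)=H^{1,\infty}(\mu)$ is the space of all $h\in L^1(\mu)$ of the form $h=\sum_j\lambda_ja_j$ (convergence in $L^1(\mu)$) with $a_j$ $(1,\infty)$-atoms and $\lambda_j\in\mathbb C$, $\sum_j|\lambda_j|<\infty$; $\|h\|_{H^1}$ is the infimum of $\sum_j|\lambda_j|$ over all such decompositions. Real interpolation. For compatible normed spaces $A_0,A_1$, $t>0$ and $a\in A_0+A_1$, put $K(t,a;A_0,A_1)=\inf\{\|a_0\|_{A_0}+t\|a_1\|_{A_1}: a=a_0+a_1,\ a_i\in A_i\}$. For $r\in[1,\infty)$ and $\theta\in(0,1)$, $[A_0,A_1]_{\theta,r}$ is the space of $a\in A_0+A_1$ such that $\|a\|_{\theta,r}=\big(\int_0^\infty[t^{-\theta}K(t,a;A_0,A_1)]^r\frac{dt}{t}\big)^{1/r}$ is finite, with this norm. *)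

theory Defs
  imports
    "HOL-Analysis.Analysis"
    "HOL-Probability.Essential_Supremum"
    "HOL-Library.Function_Algebras"
begin

section \<open>Lebesgue spaces\<close>

text \<open>Elements are functions rather than classes modulo null functions. On the weighted tree
  every vertex has positive mass, so the two points of view agree there.\<close>

definition Lp_space :: "'a measure \<Rightarrow> ereal \<Rightarrow> ('a \<Rightarrow> complex) set" where
  "Lp_space M p = {f \<in> borel_measurable M.
     if p = \<infinity> then \<exists>C::real. AE x in M. norm (f x) \<le> C
     else integrable M (\<lambda>x. norm (f x) powr real_of_ereal p)}"

definition Lp_norm :: "'a measure \<Rightarrow> ereal \<Rightarrow> ('a \<Rightarrow> complex) \<Rightarrow> real" where
  "Lp_norm M p f =
     (if p = \<infinity> then real_of_ereal (esssup M (\<lambda>x. ereal (norm (f x))))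
      else (\<integral>x. norm (f x) powr real_of_ereal p \<partial>M) powr (1 / real_of_ereal p))"


section \<open>Real interpolation by the \<open>K\<close>-method\<close>

text \<open>A normed space is given by its carrier inside a common ambient additive structure
  together with its norm, of which only the values on the carrier matter.\<close>

type_synonym 'a nspace = "'a set \<times> ('a \<Rightarrow> real)"

definition K_functional :: "'a::plus nspace \<Rightarrow> 'a nspace \<Rightarrow> real \<Rightarrow> 'a \<Rightarrow> real" where
  "K_functional A0 A1 t a =
     Inf {snd A0 a0 + t * snd A1 a1 | a0 a1. a0 \<in> fst A0 \<and> a1 \<in> fst A1 \<and> a = a0 + a1}"

definition interp_integral ::
    "'a::plus nspace \<Rightarrow> 'a nspace \<Rightarrow> real \<Rightarrow> real \<Rightarrow> 'a \<Rightarrow> ennreal" where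
  "interp_integral A0 A1 \<theta> r a =
     (\<integral>\<^sup>+t\<in>{0<..}. ennreal ((t powr (-\<theta>) * K_functional A0 A1 t a) powr r / t) \<partial>lborel)"

definition interp_space :: "'a::plus nspace \<Rightarrow> 'a nspace \<Rightarrow> real \<Rightarrow> real \<Rightarrow> 'a set" where
  "interp_space A0 A1 \<theta> r =
     {a. (\<exists>a0\<in>fst A0. \<exists>a1\<in>fst A1. a = a0 + a1) \<and> interp_integral A0 A1 \<theta> r a < \<infinity>}"

definition interp_norm :: "'a::plus nspace \<Rightarrow> 'a nspace \<Rightarrow> real \<Rightarrow> real \<Rightarrow> 'a \<Rightarrow> real" where
  "interp_norm A0 A1 \<theta> r a = enn2real (interp_integral A0 A1 \<theta> r a) powr (1 / r)"


section \<open>Homogeneous trees\<close>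

text \<open>The vertex set of a graph is the whole type \<open>'v\<close>; a path is the list of its vertices.\<close>

definition path_between :: "('v \<Rightarrow> 'v \<Rightarrow> bool) \<Rightarrow> 'v \<Rightarrow> 'v list \<Rightarrow> 'v \<Rightarrow> bool" where
  "path_between adj x xs y \<longleftrightarrow>
     xs \<noteq> [] \<and> successively adj xs \<and> hd xs = x \<and> last xs = y"

definition graph_dist :: "('v \<Rightarrow> 'v \<Rightarrow> bool) \<Rightarrow> 'v \<Rightarrow> 'v \<Rightarrow> nat" where
  "graph_dist adj x y = (LEAST n. \<exists>xs. path_between adj x xs y \<and> length xs = Suc n)"

definition shortest_path :: "('v \<Rightarrow> 'v \<Rightarrow> bool) \<Rightarrow> 'v \<Rightarrow> 'v list \<Rightarrow> 'v \<Rightarrow> bool" where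
  "shortest_path adj x xs y \<longleftrightarrow>
     path_between adj x xs y \<and> length xs = Suc (graph_dist adj x y)"

definition connected_subset :: "('v \<Rightarrow> 'v \<Rightarrow> bool) \<Rightarrow> 'v set \<Rightarrow> bool" where
  "connected_subset adj S \<longleftrightarrow>
     S \<noteq> {} \<and> (\<forall>x\<in>S. \<forall>y\<in>S. \<exists>xs. path_between adj x xs y \<and> set xs \<subseteq> S)"

definition is_cycle :: "('v \<Rightarrow> 'v \<Rightarrow> bool) \<Rightarrow> 'v list \<Rightarrow> bool" where
  "is_cycle adj xs \<longleftrightarrow>
     3 \<le> length xs \<and> distinct xs \<and> successively adj xs \<and> adj (last xs) (hd xs)"

text \<open>Since \<open>q + 1 > 0\<close>, the degree condition also says that neighbourhoods are finite.\<close>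

locale homogeneous_tree =
  fixes q :: nat and adj :: "'v \<Rightarrow> 'v \<Rightarrow> bool"
  assumes q_ge_2: "2 \<le> q"
    and adj_sym: "adj x y \<Longrightarrow> adj y x"
    and adj_irrefl: "\<not> adj x x"
    and connected: "connected_subset adj UNIV"
    and acyclic: "\<not> is_cycle adj xs"
    and degree: "card {y. adj x y} = q + 1"

definition doubly_infinite_geodesic :: "('v \<Rightarrow> 'v \<Rightarrow> bool) \<Rightarrow> 'v set \<Rightarrow> bool" where
  "doubly_infinite_geodesic adj g \<longleftrightarrow>
     connected_subset adj g \<and>
     (\<forall>x\<in>g. card {y \<in> g. adj x y} = 2) \<and>
     (\<forall>x\<in>g. \<forall>y\<in>g. \<forall>xs. shortest_path adj x xs y \<longrightarrow> set xs \<subseteq> g)"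

locale weighted_tree = homogeneous_tree q adj
  for q :: nat and adj :: "'v \<Rightarrow> 'v \<Rightarrow> bool" +
  fixes g :: "'v set" and N :: "'v \<Rightarrow> int"
  assumes geodesic: "doubly_infinite_geodesic adj g"
    and N_isometry: "\<lbrakk>x \<in> g; y \<in> g\<rbrakk> \<Longrightarrow> \<bar>N x - N y\<bar> = int (graph_dist adj x y)"
begin

abbreviation d :: "'v \<Rightarrow> 'v \<Rightarrow> nat" where
  "d \<equiv> graph_dist adj"

definition proj :: "'v \<Rightarrow> 'v" where
  "proj x = (THE x'. x' \<in> g \<and> (\<forall>y\<in>g. d x x' \<le> d x y))"

definition level :: "'v \<Rightarrow> int" where
  "level x = N (proj x) - int (d x (proj x))"

definition \<mu> :: "'v measure" where
  "\<mu> = point_measure UNIV (\<lambda>x. ennreal (real q powi level x))"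

definition below :: "'v \<Rightarrow> 'v \<Rightarrow> bool" where
  "below x y \<longleftrightarrow> level x = level y - int (d x y)"


subsection \<open>Calderon-Zygmund sets and the atomic Hardy space\<close>

definition trapezoid :: "'v \<Rightarrow> int \<Rightarrow> 'v set" where
  "trapezoid x\<^sub>R h = {x. below x x\<^sub>R \<and> h \<le> level x\<^sub>R - level x \<and> level x\<^sub>R - level x < 2 * h}"

text \<open>\<open>trapezoid_envelope R S\<close>: the set \<open>R\<close> is an admissible trapezoid with envelope \<open>S\<close>.\<close>

inductive trapezoid_envelope :: "'v set \<Rightarrow> 'v set \<Rightarrow> bool" where
  degenerate: "trapezoid_envelope {x\<^sub>R} {x\<^sub>R}"
| nondegenerate: "1 \<le> h \<Longrightarrow> trapezoid_envelope (trapezoid x\<^sub>R h)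
    {x. below x x\<^sub>R \<and> real_of_int h / 2 \<le> real_of_int (level x\<^sub>R - level x) \<and>
        level x\<^sub>R - level x < 4 * h}"

definition CZ_set :: "'v set \<Rightarrow> bool" where
  "CZ_set S \<longleftrightarrow> (\<exists>R. trapezoid_envelope R S)"

definition atom :: "('v \<Rightarrow> complex) \<Rightarrow> bool" where
  "atom a \<longleftrightarrow> (\<exists>S. CZ_set S \<and> (\<forall>x. x \<notin> S \<longrightarrow> a x = 0) \<and>
     a \<in> Lp_space \<mu> \<infinity> \<and> Lp_norm \<mu> \<infinity> a \<le> 1 / measure \<mu> S \<and> (\<integral>x. a x \<partial>\<mu>) = 0)"

text \<open>Finite sums are covered by padding with zero coefficients, the zero function being an
  atom.\<close>

definition atomic_decomposition ::
    "('v \<Rightarrow> complex) \<Rightarrow> (nat \<Rightarrow> complex) \<Rightarrow> (nat \<Rightarrow> 'v \<Rightarrow> complex) \<Rightarrow> bool" where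
  "atomic_decomposition h c a \<longleftrightarrow>
     (\<forall>j. atom (a j)) \<and> summable (\<lambda>j. norm (c j)) \<and>
     (\<lambda>n. Lp_norm \<mu> 1 (\<lambda>x. h x - (\<Sum>j<n. c j * a j x))) \<longlonglongrightarrow> 0"

definition H1 :: "('v \<Rightarrow> complex) set" where
  "H1 = {h \<in> Lp_space \<mu> 1. \<exists>c a. atomic_decomposition h c a}"

definition H1_norm :: "('v \<Rightarrow> complex) \<Rightarrow> real" where
  "H1_norm h = Inf {\<Sum>j. norm (c j) | c a. atomic_decomposition h c a}"

end

end

theory Submission
  imports Defs "HOL-Library.Discrete_Functions"
begin

text \<open>
  \<^bold>\<open>From the interpolation space to \<open>L\<^sup>p\<close>.\<close> Atoms have norm at most one in \<open>L\<^sup>1\<close>, so the Hardy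
  space embeds contractively into \<open>L\<^sup>1\<close>. Split \<open>f\<close> almost optimally for the \<open>K\<close>-functional at
  \<open>t = 2\<^sup>j\<close> and apply Markov's inequality to both parts: outside a set of measure
  \<open>2 * t powr \<sigma>\<close>, where \<open>\<sigma> = 1 / (1 - 1 / p\<^sub>1)\<close>, the modulus of \<open>f\<close> is at most
  \<open>4 * K t * t powr - \<sigma>\<close>. Slicing the range of \<open>f\<close> at these thresholds bounds its \<open>L\<^sup>p\<close> norm by
  a discrete form of the interpolation norm (\<open>Lp_le_of_superlevels\<close>, \<open>dyadic_sum_le_interp\<close>).

  \<^bold>\<open>From \<open>L\<^sup>p\<close> to the interpolation space.\<close> The measure is not doubling, but the tree carries a
  filtration of partitions into cells of growing mass such that consecutive cells have
  comparable mass and every cell lies in a Calderon-Zygmund set of comparable mass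
  (\<open>CZ_set_around_grid\<close>). Stopping at the largest cell on which the average of the modulus
  exceeds \<open>l\<close> and replacing \<open>f\<close> there by its average gives the good part of \<open>f\<close> at height \<open>l\<close>.
  It is bounded by a multiple of the minimum of \<open>l\<close> and the maximal function of \<open>f\<close>. The
  difference of the good parts at heights \<open>2 * l\<close> and \<open>l\<close> is bounded by a multiple of \<open>l\<close>, is
  supported where the maximal function exceeds \<open>l\<close>, and has integral zero on every stopping cell
  of height \<open>l\<close>. It is therefore directly a combination of bounded atoms, and summing over
  \<open>l, 2 * l, 4 * l, \<dots>\<close> shows that the Hardy norm of the remaining bad part is at most a multiple
  of the integral of the maximal function over the set where it exceeds \<open>l\<close> (\<open>bad_part_in_H1\<close>).

  Let \<open>X m\<close> be this integral for \<open>l = 2\<^sup>m\<close> and let \<open>Y m\<close> bound the norm of the good part in the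
  other endpoint space. Then \<open>K t\<close> is at most a multiple of \<open>X m + t * Y m\<close> for every \<open>m\<close>. Using
  this at the scale where both terms balance bounds the interpolation integral by the sum of
  \<open>X m powr ((1 - \<theta>) * p) * Y m powr (\<theta> * p)\<close>. By the relation between \<open>p\<close>, \<open>p\<^sub>1\<close> and \<open>\<theta>\<close> and,
  if \<open>p\<^sub>1\<close> is finite, the weighted arithmetic-geometric mean inequality, this sum reduces to
  geometric series and is at most a multiple of the \<open>p\<close>-th power of the \<open>L\<^sup>p\<close> norm of the
  maximal function (\<open>interp_le_Lp\<close>), which the dyadic maximal theorem \<open>strong_type\<close> compares
  with that of \<open>f\<close>.
\<close>

section \<open>Trees\<close>

definition reaches_in :: "('v \<Rightarrow> 'v \<Rightarrow> bool) \<Rightarrow> 'v set \<Rightarrow> 'v \<Rightarrow> 'v \<Rightarrow> bool" where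
  "reaches_in adj S x y \<longleftrightarrow> x \<in> S \<and> y \<in> S \<and> (\<exists>xs. path_between adj x xs y \<and> set xs \<subseteq> S)"

lemma path_between_append:
  assumes "path_between adj x xs y" "path_between adj y ys z"
  shows "path_between adj x (xs @ tl ys) z"
proof (cases "tl ys")
  case Nil
  then have "ys = [y]" using assms(2) by (cases ys) (auto simp: path_between_def)
  then show ?thesis using assms by (auto simp: path_between_def)
next
  case (Cons u us)
  then have "ys = y # u # us" using assms(2) by (cases ys) (auto simp: path_between_def)
  then show ?thesis using assms
    by (auto simp: path_between_def successively_append_iff)
qed

lemma reaches_in_refl: "x \<in> S \<Longrightarrow> reaches_in adj S x x"
  unfolding reaches_in_def path_between_def by (auto intro!: exI[of _ "[x]"])

lemma reaches_in_adj: "\<lbrakk>x \<in> S; y \<in> S; adj x y\<rbrakk> \<Longrightarrow> reaches_in adj S x y"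
  unfolding reaches_in_def path_between_def by (auto intro!: exI[of _ "[x, y]"])

lemma reaches_in_trans:
  assumes "reaches_in adj S x y" "reaches_in adj S y z" shows "reaches_in adj S x z"
proof -
  from assms obtain xs ys where "path_between adj x xs y" "set xs \<subseteq> S"
    "path_between adj y ys z" "set ys \<subseteq> S" unfolding reaches_in_def by blast
  moreover have "set (tl ys) \<subseteq> set ys" by (cases ys) auto
  ultimately show ?thesis using assms path_between_append[of adj x xs y ys z]
    unfolding reaches_in_def by (metis le_sup_iff set_append subset_trans)
qed

lemma reaches_in_mono: "\<lbrakk>reaches_in adj S x y; S \<subseteq> T\<rbrakk> \<Longrightarrow> reaches_in adj T x y"
  unfolding reaches_in_def by blast

lemma shorten_path:
  assumes "path_between adj x (as @ [v] @ bs @ [v] @ cs) y"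
  shows "path_between adj x (as @ [v] @ cs) y"
proof -
  have "successively adj (as @ [v])" "successively adj (v # cs)"
    using assms successively_append_iff[of adj "as @ [v]" "bs @ [v] @ cs"]
      successively_append_iff[of adj "as @ [v] @ bs" "v # cs"] by (auto simp: path_between_def)
  moreover have "hd (as @ [v] @ cs) = x" using assms by (cases as) (auto simp: path_between_def)
  moreover have "last (as @ [v] @ cs) = y" using assms by (cases cs) (auto simp: path_between_def)
  ultimately show ?thesis by (auto simp: path_between_def successively_append_iff)
qed

lemma reaches_in_simple_path:
  assumes "reaches_in adj S x y"
  obtains xs where "path_between adj x xs y" "set xs \<subseteq> S" "distinct xs"
proof -
  let ?P = "\<lambda>xs. path_between adj x xs y \<and> set xs \<subseteq> S"
  from assms obtain xs0 where "?P xs0" by (auto simp: reaches_in_def)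
  then obtain xs where xs: "?P xs" and min: "\<And>ys. ?P ys \<Longrightarrow> length xs \<le> length ys"
    using ex_has_least_nat[of ?P xs0 length] by blast
  have "distinct xs"
  proof (rule ccontr)
    assume "\<not> distinct xs"
    then obtain as v bs cs where d: "xs = as @ [v] @ bs @ [v] @ cs" using not_distinct_decomp by blast
    then have "?P (as @ [v] @ cs)" using xs shorten_path[of adj x as v bs cs y] by auto
    from min[OF this] d show False by simp
  qed
  with xs that show thesis by blast
qed

context homogeneous_tree
begin

abbreviation gdist where "gdist \<equiv> graph_dist adj"

lemma reaches_in_sym: "reaches_in adj S x y \<Longrightarrow> reaches_in adj S y x"
proof -
  have *: "(\<lambda>x y. adj y x) = adj" by (intro ext) (metis adj_sym)
  assume "reaches_in adj S x y"
  then obtain xs where "path_between adj x xs y" "set xs \<subseteq> S" "x \<in> S" "y \<in> S"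
    unfolding reaches_in_def by blast
  then show ?thesis unfolding reaches_in_def path_between_def
    by (intro conjI exI[of _ "rev xs"]) (auto simp only: * hd_rev last_rev successively_rev rev_is_Nil_conv set_rev)
qed

text \<open>Two neighbours of \<open>v\<close> in a connected set avoiding \<open>v\<close> would be joined by a simple path
  which \<open>v\<close> closes up to a cycle.\<close>

lemma unique_neighbour_in_connected:
  assumes "v \<notin> S" "adj v x" "adj v y" "reaches_in adj S x y"
  shows "x = y"
proof (rule ccontr)
  assume ne: "x \<noteq> y"
  obtain xs where xs: "path_between adj x xs y" "set xs \<subseteq> S" "distinct xs"
    using reaches_in_simple_path[OF assms(4)] .
  then obtain us where us: "xs = x # us" by (cases xs) (auto simp: path_between_def)
  with ne xs have "us \<noteq> []" by (auto simp: path_between_def)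
  then have "is_cycle adj (v # xs)"
    using xs us assms unfolding is_cycle_def path_between_def
    by (cases us) (auto intro: adj_sym)
  with acyclic show False by blast
qed

lemma reaches_UNIV: "reaches_in adj UNIV x y"
  using connected unfolding connected_subset_def reaches_in_def by auto

lemma finite_neighbours: "finite {y. adj x y}"
  by (rule card_ge_0_finite) (simp add: degree)

lemma dist_attained: "\<exists>xs. path_between adj x xs y \<and> length xs = Suc (gdist x y)"
proof -
  obtain xs where "path_between adj x xs y" using reaches_UNIV by (auto simp: reaches_in_def)
  then have "path_between adj x xs y \<and> length xs = Suc (length xs - 1)"
    by (auto simp: path_between_def)
  then have "\<exists>n xs. path_between adj x xs y \<and> length xs = Suc n" by blast
  then show ?thesis unfolding graph_dist_def by (rule LeastI_ex)
qed

lemma dist_le: "path_between adj x xs y \<Longrightarrow> length xs = Suc n \<Longrightarrow> gdist x y \<le> n"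
  unfolding graph_dist_def by (rule Least_le) blast

lemma dist_eq_0_iff: "gdist x y = 0 \<longleftrightarrow> x = y"
proof
  assume "gdist x y = 0"
  then obtain xs where "path_between adj x xs y" "length xs = Suc 0" using dist_attained by metis
  then show "x = y" by (cases xs) (auto simp: path_between_def)
next
  assume "x = y"
  then show "gdist x y = 0" using dist_le[of x "[x]" y 0] by (auto simp: path_between_def)
qed

lemma dist_adj_le: "adj x w \<Longrightarrow> gdist x z \<le> Suc (gdist w z)"
proof -
  assume a: "adj x w"
  obtain xs where "path_between adj w xs z" "length xs = Suc (gdist w z)" using dist_attained by metis
  then have "path_between adj x (x # xs) z" "length (x # xs) = Suc (Suc (gdist w z))"
    using a by (cases xs; auto simp: path_between_def)+
  then show ?thesis using dist_le by blast
qed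

lemma dist_SucE:
  assumes "gdist x z = Suc n" obtains w where "adj x w" "gdist w z = n"
proof -
  obtain xs where xs: "path_between adj x xs z" "length xs = Suc (Suc n)"
    using dist_attained assms by metis
  then obtain w us where "xs = x # w # us" by (cases xs; cases "tl xs") (auto simp: path_between_def)
  with xs have a: "adj x w" "path_between adj w (w # us) z" "length (w # us) = Suc n"
    by (auto simp: path_between_def split: if_splits)
  have "gdist w z \<le> n" using dist_le a by blast
  moreover have "Suc n \<le> Suc (gdist w z)" using dist_adj_le[OF a(1), of z] assms by simp
  ultimately show thesis using that a by simp
qed

lemma countable_vertices: "countable (UNIV :: 'v set)"
proof -
  fix o'
  have "finite {x. gdist x o' = n}" for n
  proof (induction n)
    case 0
    then show ?case by (simp add: dist_eq_0_iff)
  next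
    case (Suc n)
    have "{x. gdist x o' = Suc n} \<subseteq> (\<Union>w\<in>{x. gdist x o' = n}. {y. adj w y})"
      by (auto elim!: dist_SucE intro: adj_sym)
    then show ?case using Suc finite_neighbours by (meson finite_UN finite_subset)
  qed
  moreover have "UNIV = (\<Union>n. {x. gdist x o' = n})" by auto
  ultimately show ?thesis by (metis countable_UN countable_finite uncountable_def countableI_type)
qed

end

context weighted_tree
begin

definition height :: "'v \<Rightarrow> nat" where
  "height x = (LEAST n. \<exists>z\<in>g. gdist x z = n)"

lemma g_nonempty: "g \<noteq> {}"
  using geodesic by (auto simp: doubly_infinite_geodesic_def connected_subset_def)

lemma height_attained: "\<exists>z\<in>g. gdist x z = height x"
  unfolding height_def by (rule LeastI_ex) (use g_nonempty in auto)

lemma height_le: "z \<in> g \<Longrightarrow> height x \<le> gdist x z"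
  unfolding height_def by (rule Least_le) auto

lemma height_eq_0_iff: "height x = 0 \<longleftrightarrow> x \<in> g"
  using height_attained[of x] height_le[of x x] dist_eq_0_iff by (metis le_zero_eq)

lemma height_adj_le: "adj x w \<Longrightarrow> height x \<le> Suc (height w)"
  using height_attained[of w] height_le dist_adj_le by (metis le_trans)

lemma height_SucE:
  assumes "height x = Suc n" obtains w where "adj x w" "height w = n"
proof -
  obtain z where z: "z \<in> g" "gdist x z = Suc n" using height_attained[of x] assms by auto
  then obtain w where w: "adj x w" "gdist w z = n" using dist_SucE by blast
  have "height w \<le> n" using height_le[OF z(1), of w] w by simp
  moreover have "n \<le> height w" using height_adj_le[OF w(1)] assms by simp
  ultimately show thesis using that w by simp
qed

lemma reaches_geodesic: "height x \<le> n \<Longrightarrow> \<exists>z\<in>g. reaches_in adj {x. height x \<le> n} x z"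
proof (induction "height x" arbitrary: x)
  case 0
  then show ?case using height_eq_0_iff reaches_in_refl by force
next
  case (Suc k)
  then obtain w where w: "adj x w" "height w = k" using height_SucE by metis
  then obtain z where "z \<in> g" "reaches_in adj {x. height x \<le> n} w z" using Suc by force
  moreover have "reaches_in adj {x. height x \<le> n} x w"
    using w Suc by (intro reaches_in_adj) auto
  ultimately show ?case using reaches_in_trans by meson
qed

lemma height_ball_connected:
  assumes "height x \<le> n" "height y \<le> n" shows "reaches_in adj {x. height x \<le> n} x y"
proof -
  obtain a b where ab: "a \<in> g" "reaches_in adj {x. height x \<le> n} x a"
     "b \<in> g" "reaches_in adj {x. height x \<le> n} y b" using assms reaches_geodesic by metis
  have "reaches_in adj g a b" using ab geodesic
    by (auto simp: doubly_infinite_geodesic_def connected_subset_def reaches_in_def)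
  then have "reaches_in adj {x. height x \<le> n} a b"
    by (elim reaches_in_mono) (auto simp flip: height_eq_0_iff)
  then show ?thesis using ab reaches_in_trans reaches_in_sym by metis
qed

text \<open>Otherwise \<open>w\<close>, together with the points of smaller height, would form a connected set that
  contains two neighbours of \<open>v\<close>.\<close>

lemma adj_height_ne:
  assumes "adj v w" "height v \<noteq> 0" shows "height v \<noteq> height w"
proof
  assume e: "height v = height w"
  obtain n where n: "height v = Suc n" using assms by (cases "height v") auto
  obtain v' w' where v': "adj v v'" "height v' = n" and w': "adj w w'" "height w' = n"
    using height_SucE n e by metis
  have v0: "v \<notin> insert w {x. height x \<le> n}" using n assms(1) adj_irrefl by auto
  have "reaches_in adj (insert w {x. height x \<le> n}) w w'" using w' by (intro reaches_in_adj) auto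
  moreover have "reaches_in adj (insert w {x. height x \<le> n}) w' v'"
    by (rule reaches_in_mono[OF height_ball_connected[of w' n v']]) (use v' w' in auto)
  ultimately have "w = v'"
    using unique_neighbour_in_connected[OF v0 assms(1) v'(1)] reaches_in_trans by meson
  then show False using v' e n by simp
qed

lemma height_down_unique:
  assumes "height v = Suc n" "adj v x" "adj v y" "height x \<le> n" "height y \<le> n"
  shows "x = y"
  by (rule unique_neighbour_in_connected[OF _ assms(2,3) height_ball_connected[OF assms(4,5)]])
    (use assms in auto)

text \<open>Induction on the height: any shortest path from \<open>x\<close> to the geodesic starts with the unique
  neighbour of smaller height.\<close>

lemma closest_unique:
  "\<lbrakk>z \<in> g; z' \<in> g; gdist x z = height x; gdist x z' = height x\<rbrakk> \<Longrightarrow> z = z'"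
proof (induction "height x" arbitrary: x)
  case 0
  then show ?case using dist_eq_0_iff by auto
next
  case (Suc n)
  obtain w where w: "adj x w" "gdist w z = n" using Suc dist_SucE by metis
  obtain w' where w': "adj x w'" "gdist w' z' = n" using Suc dist_SucE by metis
  have le: "height w \<le> n" "height w' \<le> n" using height_le Suc.prems w w' by metis+
  have ge: "height w \<ge> n" using height_adj_le[OF w(1)] Suc by simp
  have "w = w'" using height_down_unique Suc.hyps(2) w w' le by metis
  then show ?case using Suc.hyps(1)[of w] Suc.prems w w' le ge by auto
qed

lemma proj_eqI:
  assumes "z \<in> g" "gdist x z = height x" shows "proj x = z"
  unfolding proj_def
proof (rule the_equality)
  show "z \<in> g \<and> (\<forall>y\<in>g. gdist x z \<le> gdist x y)" using assms height_le by simp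
  fix z' assume z': "z' \<in> g \<and> (\<forall>y\<in>g. gdist x z' \<le> gdist x y)"
  then have "gdist x z' = height x" using assms height_le by (metis le_antisym)
  then show "z' = z" using closest_unique z' assms by blast
qed

lemma level_geodesic: "x \<in> g \<Longrightarrow> level x = N x"
proof -
  assume x: "x \<in> g"
  then have "gdist x x = 0" "height x = 0" by (simp_all add: dist_eq_0_iff height_eq_0_iff)
  then have "proj x = x" using x by (intro proj_eqI) simp_all
  then show ?thesis by (simp add: level_def dist_eq_0_iff)
qed

lemma level_down:
  assumes "adj x w" "height x = Suc (height w)" shows "level x = level w - 1"
proof -
  obtain z where z: "z \<in> g" "gdist w z = height w" using height_attained by blast
  have dx: "gdist x z = height x"
    using dist_adj_le[OF assms(1), of z] height_le[OF z(1), of x] z assms by simp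
  have "proj x = z" "proj w = z" using proj_eqI z dx by auto
  then show ?thesis using z dx assms by (simp add: level_def)
qed

text \<open>Off the geodesic the upper neighbour is the one towards the geodesic. On the geodesic the
  two neighbours in \<open>g\<close> have different values of \<open>N\<close>, because they are distinct points, hence
  exactly one of them lies higher; all remaining neighbours hang off the geodesic.\<close>

lemma ex1_upper_neighbour_and_others:
  "\<exists>y. adj x y \<and> level y = level x + 1 \<and> (\<forall>z. adj x z \<and> z \<noteq> y \<longrightarrow> level z = level x - 1)"
proof (cases "height x")
  case (Suc n)
  then obtain w where w: "adj x w" "height w = n" using height_SucE by metis
  have "level z = level x - 1" if z: "adj x z" "z \<noteq> w" for z
  proof -
    have "height z \<noteq> Suc n" using adj_height_ne[OF z(1)] Suc by simp
    moreover have "\<not> height z \<le> n" using height_down_unique Suc z w by auto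
    moreover have "height z \<le> Suc (Suc n)" using height_adj_le adj_sym z Suc by metis
    ultimately have "height z = Suc (height x)" using Suc by linarith
    then show ?thesis using level_down adj_sym z by blast
  qed
  moreover have "level w = level x + 1" using level_down w Suc by simp
  ultimately show ?thesis using w by blast
next
  case 0
  then have x: "x \<in> g" by (simp add: height_eq_0_iff)
  have "card {y \<in> g. adj x y} = 2" using x geodesic by (auto simp: doubly_infinite_geodesic_def)
  then obtain a b where ab: "{y \<in> g. adj x y} = {a, b}" "a \<noteq> b" by (auto simp: card_2_iff)
  then have ab': "a \<in> g" "b \<in> g" "adj x a" "adj x b" by auto
  have one: "gdist x y = 1" if "adj x y" for y
    using dist_adj_le[OF that, of y] dist_eq_0_iff[of x y] dist_eq_0_iff[of y y] that adj_irrefl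
    by (cases "gdist x y") auto
  have "\<bar>N x - N a\<bar> = 1" "\<bar>N x - N b\<bar> = 1" using N_isometry x ab' one by auto
  moreover have "N a \<noteq> N b" using N_isometry[of a b] ab' ab(2) dist_eq_0_iff[of a b] by auto
  ultimately have "N a = N x + 1 \<and> N b = N x - 1 \<or> N b = N x + 1 \<and> N a = N x - 1" by auto
  moreover have "level z = level x - 1" if "adj x z" "z \<noteq> a" "z \<noteq> b" for z
  proof -
    have "z \<notin> g" using that ab by auto
    then have "height z = Suc (height x)"
      using height_adj_le[of z x] adj_sym that 0 height_eq_0_iff[of z] by fastforce
    then show ?thesis using level_down adj_sym that by blast
  qed
  ultimately have "level a = level x + 1 \<and> level b = level x - 1 \<or>
      level b = level x + 1 \<and> level a = level x - 1"
    and "\<And>z. \<lbrakk>adj x z; z \<noteq> a; z \<noteq> b\<rbrakk> \<Longrightarrow> level z = level x - 1"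
    by (simp_all add: level_geodesic x ab')
  then show ?thesis using ab' by blast
qed

definition parent :: "'v \<Rightarrow> 'v" where
  "parent x = (THE y. adj x y \<and> level y = level x + 1)"

lemma parent:
  "adj x (parent x)" "level (parent x) = level x + 1"
  "\<lbrakk>adj x z; z \<noteq> parent x\<rbrakk> \<Longrightarrow> level z = level x - 1"
proof -
  obtain y where y: "adj x y" "level y = level x + 1"
    "\<And>z. adj x z \<Longrightarrow> z \<noteq> y \<Longrightarrow> level z = level x - 1"
    using ex1_upper_neighbour_and_others[of x] by blast
  have "parent x = y" unfolding parent_def using y by (intro the_equality) force+
  then show "adj x (parent x)" "level (parent x) = level x + 1" using y by simp_all
  show "level z = level x - 1" if "adj x z" "z \<noteq> parent x"
    using y(3) that \<open>parent x = y\<close> by simp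
qed

lemma children_eq: "{y. parent y = x} = {y. adj x y} - {parent x}"
proof -
  have "parent y = x" if "adj x y" "y \<noteq> parent x" for y
    using parent(3)[OF that] parent(3)[of y x] adj_sym[OF that(1)] by fastforce
  moreover have "y \<noteq> parent x" if "parent y = x" for y
    using that parent(2)[of y] parent(2)[of x] by auto
  moreover have "adj x y" if "parent y = x" for y
    using adj_sym[OF parent(1)[of y]] that by simp
  ultimately show ?thesis by blast
qed

lemma card_children: "card {y. parent y = x} = q" "finite {y. parent y = x}"
  using degree[of x] parent(1)[of x] finite_neighbours[of x] by (auto simp: children_eq)

lemma level_parent_funpow: "level ((parent ^^ k) x) = level x + int k"
  by (induction k) (auto simp: parent(2))

lemma dist_parent_funpow: "gdist x ((parent ^^ k) x) \<le> k"
proof (induction k arbitrary: x)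
  case 0
  then show ?case by (simp add: dist_eq_0_iff)
next
  case (Suc k)
  have "gdist x ((parent ^^ k) (parent x)) \<le> Suc k"
    using dist_adj_le[OF parent(1)] Suc[of "parent x"] by (meson Suc_le_mono le_trans)
  then show ?case by (simp add: funpow_swap1)
qed

lemma level_adj_le: "adj x w \<Longrightarrow> level w \<le> level x + 1"
  using parent(2,3)[of x] parent(3)[of x w] by (cases "w = parent x") auto

lemma level_dist_le: "level y \<le> level x + int (gdist x y)"
proof (induction "gdist x y" arbitrary: x)
  case 0
  then show ?case by (simp add: dist_eq_0_iff)
next
  case (Suc n)
  then obtain w where w: "adj x w" "gdist w y = n" using dist_SucE by metis
  then show ?case using Suc level_adj_le[OF w(1)] by force
qed

lemma below_dist: "level y = level x + int (gdist x y) \<Longrightarrow> y = (parent ^^ gdist x y) x"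
proof (induction "gdist x y" arbitrary: x)
  case 0
  then show ?case using dist_eq_0_iff[of x y] by simp
next
  case (Suc n)
  obtain w where w: "adj x w" "gdist w y = n" using dist_SucE Suc by metis
  have "level y \<le> level w + int n" using level_dist_le[of y w] w by simp
  moreover have "level w \<le> level x + 1" using level_adj_le w by blast
  ultimately have l: "level w = level x + 1" using Suc by simp
  then have "w = parent x" using parent(3)[OF w(1)] by fastforce
  moreover have "y = (parent ^^ n) w" using Suc l w by force
  ultimately show ?case using Suc(2) by (metis comp_apply funpow_Suc_right)
qed

text \<open>A path of length \<open>n\<close> gains at most one level per edge, and gains it only when the edge
  leads to the parent. A vertex therefore lies below another exactly if iterating \<open>parent\<close> leads
  there.\<close>

lemma below_iff: "below x y \<longleftrightarrow> level x \<le> level y \<and> (parent ^^ nat (level y - level x)) x = y"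
proof
  assume "below x y"
  then have l: "level y = level x + int (gdist x y)" unfolding below_def by simp
  then show "level x \<le> level y \<and> (parent ^^ nat (level y - level x)) x = y"
    using below_dist[OF l] by simp
next
  assume a: "level x \<le> level y \<and> (parent ^^ nat (level y - level x)) x = y"
  then have "gdist x y \<le> nat (level y - level x)" using dist_parent_funpow by metis
  then show "below x y" unfolding below_def using level_dist_le[of y x] a by linarith
qed

lemma card_descendants:
  "card {y. (parent ^^ k) y = x} = q ^ k \<and> finite {y. (parent ^^ k) y = x}"
proof (induction k arbitrary: x)
  case 0
  then show ?case by simp
next
  case (Suc k)
  have e: "{y. (parent ^^ Suc k) y = x} = (\<Union>z\<in>{z. parent z = x}. {y. (parent ^^ k) y = z})" by auto
  have "card {y. (parent ^^ Suc k) y = x} = (\<Sum>z\<in>{z. parent z = x}. q ^ k)"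
    unfolding e using Suc card_children by (subst card_UN_disjoint) auto
  then show ?case using Suc card_children unfolding e by auto
qed

end

section \<open>Dyadic sums\<close>

abbreviation dyadic_sum :: "(int \<Rightarrow> ennreal) \<Rightarrow> ennreal" where
  "dyadic_sum h \<equiv> integral\<^sup>N (count_space UNIV) h"

abbreviation dyad :: "int \<Rightarrow> real" where
  "dyad m \<equiv> 2 powr real_of_int m"

lemma dyad_le_iff: "0 < a \<Longrightarrow> dyad m \<le> a \<longleftrightarrow> m \<le> \<lfloor>log 2 a\<rfloor>"
  by (simp add: le_floor_iff le_log_iff)

lemma dyadic_sum_below:
  fixes \<delta> a :: real
  assumes "0 < \<delta>" "0 \<le> a"
  shows "dyadic_sum (\<lambda>m. if dyad m \<le> a then ennreal (dyad m powr \<delta>) else 0)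
    \<le> ennreal (a powr \<delta> / (1 - 2 powr - \<delta>))"
proof (cases "a = 0")
  case True
  then show ?thesis by (simp add: not_le)
next
  case False
  with assms have a: "a > 0" by simp
  define M where "M = \<lfloor>log 2 a\<rfloor>"
  let ?r = "2 powr - \<delta>"
  have r: "0 < ?r" "?r < 1" using assms by (auto simp: powr_less_one)
  have bij: "bij_betw (\<lambda>n. M - int n) UNIV {..M}"
    by (rule bij_betwI[where g = "\<lambda>m. nat (M - m)"]) auto
  have "dyadic_sum (\<lambda>m. if dyad m \<le> a then ennreal (dyad m powr \<delta>) else 0)
     = (\<integral>\<^sup>+m. ennreal (dyad m powr \<delta>) * indicator {..M} m \<partial>count_space UNIV)"
    by (intro nn_integral_cong) (auto simp: dyad_le_iff[OF a] M_def indicator_def)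
  also have "\<dots> = (\<integral>\<^sup>+m. ennreal (dyad m powr \<delta>) \<partial>count_space {..M})"
    by (subst (2) nn_integral_count_space_indicator) auto
  also have "\<dots> = (\<integral>\<^sup>+n. ennreal (dyad (M - int n) powr \<delta>) \<partial>count_space UNIV)"
    by (rule nn_integral_bij_count_space[OF bij, symmetric])
  also have "\<dots> = (\<Sum>n. ennreal (dyad M powr \<delta> * ?r ^ n))"
    unfolding nn_integral_count_space_nat
    by (intro suminf_cong arg_cong[where f = ennreal])
       (simp add: powr_powr flip: powr_realpow powr_add, simp add: algebra_simps)
  also have "\<dots> = ennreal (dyad M powr \<delta> * (1 / (1 - ?r)))"
    using r by (intro suminf_ennreal_eq sums_mult geometric_sums) auto
  also have "\<dots> \<le> ennreal (a powr \<delta> / (1 - ?r))"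
  proof -
    have "dyad M \<le> a" using dyad_le_iff[OF a] M_def by simp
    then have "dyad M powr \<delta> \<le> a powr \<delta>" using assms by (intro powr_mono2) auto
    then show ?thesis using r by (intro ennreal_leI) (simp add: divide_right_mono)
  qed
  finally show ?thesis .
qed

lemma dyadic_sum_uminus: "dyadic_sum (\<lambda>m. h (- m)) = dyadic_sum h"
  by (rule nn_integral_bij_count_space) (auto intro!: bij_betwI[where g = uminus])

lemma dyadic_sum_Suc: "dyadic_sum (\<lambda>m. h (m + 1)) = dyadic_sum h"
  by (rule nn_integral_bij_count_space) (auto intro!: bij_betwI[where g = "\<lambda>m. m - 1"])

lemma dyadic_sum_above:
  fixes \<delta> a :: real
  assumes "0 < \<delta>" "0 < a"
  shows "dyadic_sum (\<lambda>m. if a \<le> dyad m then ennreal (dyad m powr - \<delta>) else 0)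
    \<le> ennreal (a powr - \<delta> / (1 - 2 powr - \<delta>))"
proof -
  have "dyadic_sum (\<lambda>m. if a \<le> dyad m then ennreal (dyad m powr - \<delta>) else 0)
     = dyadic_sum (\<lambda>m. if a \<le> dyad (- m) then ennreal (dyad (- m) powr - \<delta>) else 0)"
    by (rule dyadic_sum_uminus[symmetric])
  also have "\<dots> = dyadic_sum (\<lambda>m. if dyad m \<le> inverse a then ennreal (dyad m powr \<delta>) else 0)"
  proof (intro nn_integral_cong if_cong refl)
    fix m
    show "a \<le> dyad (- m) \<longleftrightarrow> dyad m \<le> inverse a"
      using assms by (simp add: powr_minus field_simps)
  qed (simp add: powr_powr)
  also have "\<dots> \<le> ennreal (inverse a powr \<delta> / (1 - 2 powr - \<delta>))"
    using assms by (intro dyadic_sum_below) auto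
  also have "inverse a powr \<delta> = a powr - \<delta>"
    using assms by (simp add: powr_minus inverse_powr)
  finally show ?thesis .
qed

lemma dyadic_sum_swap:
  assumes "\<And>m. h m \<in> borel_measurable M"
  shows "dyadic_sum (\<lambda>m. \<integral>\<^sup>+x. h m x \<partial>M) = (\<integral>\<^sup>+x. dyadic_sum (\<lambda>m. h m x) \<partial>M)"
  by (rule nn_integral_count_space_nn_integral[symmetric]) (use assms in auto)

text
  \<open>Exchanging sum and integral leaves, at each point, a geometric series dominated by its last term.\<close>

lemma dyadic_sum_superlevel_le:
  fixes F :: "'a \<Rightarrow> real"
  assumes [measurable]: "F \<in> borel_measurable M" and F: "\<And>x. 0 \<le> F x" and p: "1 < p"
  shows "dyadic_sum (\<lambda>m. ennreal (dyad m powr (p - 1)) *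
      (\<integral>\<^sup>+x. (if dyad m < F x then ennreal (F x) else 0) \<partial>M))
    \<le> ennreal (1 / (1 - 2 powr (1 - p))) * (\<integral>\<^sup>+x. ennreal (F x powr p) \<partial>M)"
proof -
  let ?C = "1 / (1 - 2 powr (1 - p))"
  have C: "0 \<le> ?C" using p by (simp add: less_imp_le powr_less_one)
  have "dyadic_sum (\<lambda>m. ennreal (dyad m powr (p - 1)) *
      (\<integral>\<^sup>+x. (if dyad m < F x then ennreal (F x) else 0) \<partial>M))
    = dyadic_sum (\<lambda>m. (\<integral>\<^sup>+x. ennreal (dyad m powr (p - 1)) *
       (if dyad m < F x then ennreal (F x) else 0) \<partial>M))"
    by (simp add: nn_integral_cmult)
  also have "\<dots> = (\<integral>\<^sup>+x. dyadic_sum (\<lambda>m. ennreal (dyad m powr (p - 1)) *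
       (if dyad m < F x then ennreal (F x) else 0)) \<partial>M)"
    by (rule dyadic_sum_swap) auto
  also have "\<dots> \<le> (\<integral>\<^sup>+x. ennreal ?C * ennreal (F x powr p) \<partial>M)"
  proof (rule nn_integral_mono)
    fix x
    have "dyadic_sum (\<lambda>m. ennreal (dyad m powr (p - 1)) *
       (if dyad m < F x then ennreal (F x) else 0))
      \<le> dyadic_sum (\<lambda>m. ennreal (F x) * (if dyad m \<le> F x then ennreal (dyad m powr (p - 1)) else 0))"
      by (intro nn_integral_mono) (auto simp: mult.commute)
    also have "\<dots> = ennreal (F x) * dyadic_sum (\<lambda>m. if dyad m \<le> F x then ennreal (dyad m powr (p - 1)) else 0)"
      by (rule nn_integral_cmult) simp
    also have "\<dots> \<le> ennreal (F x) * ennreal (F x powr (p - 1) / (1 - 2 powr - (p - 1)))"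
      using p F by (intro mult_left_mono dyadic_sum_below) auto
    also have "\<dots> = ennreal (F x * F x powr (p - 1) / (1 - 2 powr - (p - 1)))"
      using F by (simp flip: ennreal_mult')
    also have "F x * F x powr (p - 1) / (1 - 2 powr - (p - 1)) = ?C * F x powr p"
      using F[of x] p by (cases "F x = 0") (auto simp: powr_mult_base)
    also have "ennreal \<dots> = ennreal ?C * ennreal (F x powr p)"
      using C by (intro ennreal_mult) auto
    finally show "dyadic_sum (\<lambda>m. ennreal (dyad m powr (p - 1)) *
       (if dyad m < F x then ennreal (F x) else 0)) \<le> ennreal ?C * ennreal (F x powr p)" .
  qed
  also have "\<dots> = ennreal ?C * (\<integral>\<^sup>+x. ennreal (F x powr p) \<partial>M)"
    by (rule nn_integral_cmult) simp
  finally show ?thesis .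
qed

text \<open>At each point the sum splits into a geometric series over the scales below \<open>F x\<close>,
  increasing because \<open>0 < p\<close>, and one over the scales above \<open>F x\<close>, decreasing because \<open>p < r\<close>.\<close>

lemma dyadic_sum_truncation_le:
  fixes F :: "'a \<Rightarrow> real"
  assumes [measurable]: "F \<in> borel_measurable M" and F: "\<And>x. 0 \<le> F x" and p: "0 < p" "p < r"
  shows "dyadic_sum (\<lambda>m. ennreal (dyad m powr (p - r)) * (\<integral>\<^sup>+x. ennreal (min (F x) (dyad m) powr r) \<partial>M))
    \<le> ennreal (1 / (1 - 2 powr - p) + 1 / (1 - 2 powr (p - r))) * (\<integral>\<^sup>+x. ennreal (F x powr p) \<partial>M)"
proof -
  let ?C = "1 / (1 - 2 powr - p)" and ?D = "1 / (1 - 2 powr (p - r))"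
  have C: "0 \<le> ?C" "0 \<le> ?D" using p by (auto simp: less_imp_le powr_less_one)
  have "dyadic_sum (\<lambda>m. ennreal (dyad m powr (p - r)) * (\<integral>\<^sup>+x. ennreal (min (F x) (dyad m) powr r) \<partial>M))
    = dyadic_sum (\<lambda>m. (\<integral>\<^sup>+x. ennreal (dyad m powr (p - r)) * ennreal (min (F x) (dyad m) powr r) \<partial>M))"
    by (simp add: nn_integral_cmult)
  also have "\<dots> = (\<integral>\<^sup>+x. dyadic_sum (\<lambda>m. ennreal (dyad m powr (p - r)) *
       ennreal (min (F x) (dyad m) powr r)) \<partial>M)"
    by (rule dyadic_sum_swap) auto
  also have "\<dots> \<le> (\<integral>\<^sup>+x. ennreal (?C + ?D) * ennreal (F x powr p) \<partial>M)"
  proof (rule nn_integral_mono)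
    fix x
    show "dyadic_sum (\<lambda>m. ennreal (dyad m powr (p - r)) * ennreal (min (F x) (dyad m) powr r))
      \<le> ennreal (?C + ?D) * ennreal (F x powr p)"
    proof (cases "F x = 0")
      case True
      then have "min (F x) (dyad m) = 0" for m by (simp add: min_def)
      then show ?thesis by simp
    next
      case False
      with F[of x] have Fx: "0 < F x" by simp
      have "dyadic_sum (\<lambda>m. ennreal (dyad m powr (p - r)) * ennreal (min (F x) (dyad m) powr r))
        \<le> dyadic_sum (\<lambda>m. (if dyad m \<le> F x then ennreal (dyad m powr p) else 0)
          + ennreal (F x powr r) * (if F x \<le> dyad m then ennreal (dyad m powr - (r - p)) else 0))"
      proof (rule nn_integral_mono)
        fix m :: int
        have "dyad m powr (p - r) * min (F x) (dyad m) powr r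
          \<le> (if dyad m \<le> F x then dyad m powr p else 0)
          + F x powr r * (if F x \<le> dyad m then dyad m powr - (r - p) else 0)"
          by (auto simp: min_def powr_diff field_simps powr_minus)
        then have "ennreal (dyad m powr (p - r) * min (F x) (dyad m) powr r)
          \<le> ennreal ((if dyad m \<le> F x then dyad m powr p else 0)
          + F x powr r * (if F x \<le> dyad m then dyad m powr - (r - p) else 0))"
          by (rule ennreal_leI)
        then show "ennreal (dyad m powr (p - r)) * ennreal (min (F x) (dyad m) powr r)
          \<le> (if dyad m \<le> F x then ennreal (dyad m powr p) else 0)
          + ennreal (F x powr r) * (if F x \<le> dyad m then ennreal (dyad m powr - (r - p)) else 0)"
          by (auto simp: ennreal_mult split: if_splits)
      qed
      also have "\<dots> = dyadic_sum (\<lambda>m. if dyad m \<le> F x then ennreal (dyad m powr p) else 0)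
          + ennreal (F x powr r) * dyadic_sum (\<lambda>m. if F x \<le> dyad m then ennreal (dyad m powr - (r - p)) else 0)"
        by (simp add: nn_integral_add nn_integral_cmult)
      also have "\<dots> \<le> ennreal (F x powr p / (1 - 2 powr - p))
          + ennreal (F x powr r) * ennreal (F x powr - (r - p) / (1 - 2 powr - (r - p)))"
        using p Fx by (intro add_mono mult_left_mono dyadic_sum_below dyadic_sum_above) auto
      also have "\<dots> = ennreal (F x powr p / (1 - 2 powr - p) + F x powr r * F x powr - (r - p) / (1 - 2 powr - (r - p)))"
      proof -
        have "0 \<le> 1 - 2 powr - p" "0 \<le> 1 - 2 powr - (r - p)"
          using p by (auto simp: less_imp_le powr_less_one)
        then show ?thesis by (simp add: ennreal_mult flip: times_divide_eq_right)
      qed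
      also have "F x powr p / (1 - 2 powr - p) + F x powr r * F x powr - (r - p) / (1 - 2 powr - (r - p))
         = (?C + ?D) * F x powr p"
        by (simp add: field_simps flip: powr_add)
      also have "ennreal \<dots> = ennreal (?C + ?D) * ennreal (F x powr p)"
        using C by (intro ennreal_mult) auto
      finally show ?thesis .
    qed
  qed
  also have "\<dots> = ennreal (?C + ?D) * (\<integral>\<^sup>+x. ennreal (F x powr p) \<partial>M)"
    by (rule nn_integral_cmult) simp
  finally show ?thesis .
qed

abbreviation interp_power :: "real \<Rightarrow> real \<Rightarrow> (real \<Rightarrow> real) \<Rightarrow> ennreal" where
  "interp_power \<theta> p K \<equiv> \<integral>\<^sup>+t\<in>{0<..}. ennreal ((t powr - \<theta> * K t) powr p / t) \<partial>lborel"

lemma nn_integral_powr_at_0: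
  assumes "0 < a" "0 \<le> c"
  shows "(\<integral>\<^sup>+t. ennreal (t powr (a - 1)) * indicator {0<..<c} t \<partial>lborel) = ennreal (c powr a / a)"
proof -
  have "((\<lambda>t. t powr (a - 1)) has_integral (c powr (a - 1 + 1) / (a - 1 + 1))) {0..c}"
    using assms by (intro has_integral_powr_from_0) auto
  then have "((\<lambda>t. if t \<in> {0..c} then t powr (a - 1) else 0) has_integral (c powr a / a)) UNIV"
    by (simp only: has_integral_restrict_UNIV) simp
  then have "(\<integral>\<^sup>+t. ennreal (if t \<in> {0..c} then t powr (a - 1) else 0) \<partial>lborel) = ennreal (c powr a / a)"
    by (intro nn_integral_has_integral_lborel) auto
  moreover have "(\<integral>\<^sup>+t. ennreal (t powr (a - 1)) * indicator {0<..<c} t \<partial>lborel)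
     = (\<integral>\<^sup>+t. ennreal (if t \<in> {0..c} then t powr (a - 1) else 0) \<partial>lborel)"
  proof (rule nn_integral_cong_AE)
    have "AE t in lborel. t \<notin> {0, c}" by (intro AE_not_in) (auto intro!: finite_imp_null_set_lborel)
    then show "AE t in lborel. ennreal (t powr (a - 1)) * indicator {0<..<c} t =
        ennreal (if t \<in> {0..c} then t powr (a - 1) else 0)"
      by eventually_elim (auto simp: indicator_def)
  qed
  ultimately show ?thesis by simp
qed

section \<open>Discretising the interpolation norm\<close>

lemma int_crossing:
  fixes P :: "int \<Rightarrow> bool"
  assumes "P a" "\<not> P b" "a \<le> b" shows "\<exists>m. P m \<and> \<not> P (m + 1)"
proof (rule ccontr)
  assume "\<nexists>m. P m \<and> \<not> P (m + 1)"
  then have "P (a + int n)" for n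
    by (induction n) (use assms in \<open>auto simp: add.assoc[symmetric] add.commute[of 1]\<close>)
  from this[of "nat (b - a)"] assms show False by simp
qed

text \<open>For \<open>t\<close> between \<open>X (m + 1) / Y (m + 1)\<close> and \<open>X m / Y m\<close> the term \<open>t * Y (m + 1)\<close> dominates
  \<open>X (m + 1)\<close>, so \<open>K t\<close> is at most a multiple of \<open>t * Y m\<close>. These ranges cover the half-line,
  and on each of them the integral is elementary.\<close>

lemma interp_le_dyadic_sum:
  fixes X Y :: "int \<Rightarrow> real" and K :: "real \<Rightarrow> real"
  assumes X: "antimono X" "\<And>m. 0 \<le> X m"
    and Y: "mono Y" "\<And>m. 0 < Y m" "\<And>m. Y (m + 1) \<le> 2 * Y m"
    and large: "\<And>t. 0 < t \<Longrightarrow> \<exists>m. t < X m / Y m"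
    and small: "\<And>t. 0 < t \<Longrightarrow> \<exists>m. X m / Y m \<le> t"
    and K: "\<And>t. 0 < t \<Longrightarrow> 0 \<le> K t" "\<And>t m. 0 < t \<Longrightarrow> K t \<le> C * (X m + t * Y m)"
    and \<theta>: "0 < \<theta>" "\<theta> < 1" and p: "1 < p" and C: "0 \<le> C"
  shows "interp_power \<theta> p K
    \<le> ennreal ((4 * C) powr p / ((1 - \<theta>) * p)) *
      dyadic_sum (\<lambda>m. ennreal (X m powr ((1 - \<theta>) * p) * Y m powr (\<theta> * p)))"
proof -
  define a where "a = (1 - \<theta>) * p"
  have a: "0 < a" using \<theta> p by (simp add: a_def)
  define T where "T m = X m / Y m" for m
  have T0: "0 \<le> T m" for m using X Y by (simp add: T_def less_imp_le)
  have anti: "T n \<le> T m" if "m \<le> n" for m n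
    unfolding T_def using that X Y monoD[OF Y(1) that] antimonoD[OF X(1) that]
    by (intro frac_le) auto
  let ?h = "\<lambda>m t. ennreal ((4 * C * Y m) powr p * t powr (a - 1)) * indicator {0<..<T m} t"
  have pt: "ennreal ((t powr - \<theta> * K t) powr p / t) * indicator {0<..} t \<le> dyadic_sum (\<lambda>m. ?h m t)" for t
  proof (cases "0 < t")
    case True
    obtain m0 m1 where "t < T m0" "\<not> t < T m1" using large[OF True] small[OF True] by (force simp: T_def not_less)
    moreover from this have "m0 \<le> m1" using anti[of m1 m0] by (cases "m0 \<le> m1") auto
    ultimately obtain m where m: "t < T m" "\<not> t < T (m + 1)"
      using int_crossing[of "\<lambda>m. t < T m"] by blast
    have "X (m + 1) \<le> t * Y (m + 1)" using m(2) Y(2)[of "m + 1"] by (simp add: T_def field_simps)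
    then have "C * (X (m + 1) + t * Y (m + 1)) \<le> C * (2 * (t * Y (m + 1)))"
      using C by (intro mult_left_mono) auto
    then have "K t \<le> C * (2 * (t * Y (m + 1)))"
      using K(2)[OF True, of "m + 1"] by linarith
    also have "\<dots> \<le> C * (2 * (t * (2 * Y m)))"
      using Y(3)[of m] C True by (intro mult_left_mono) auto
    finally have "t powr - \<theta> * K t \<le> (4 * C * Y m) * t powr (1 - \<theta>)"
      using True by (simp add: powr_diff powr_minus field_simps)
    then have "(t powr - \<theta> * K t) powr p \<le> ((4 * C * Y m) * t powr (1 - \<theta>)) powr p"
      using True K(1)[OF True] p by (intro powr_mono2) auto
    also have "\<dots> = (4 * C * Y m) powr p * t powr a"
      using C Y(2)[of m] True by (simp add: powr_mult powr_powr a_def less_imp_le)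
    finally have "(t powr - \<theta> * K t) powr p / t \<le> (4 * C * Y m) powr p * t powr (a - 1)"
      using True by (simp add: powr_diff field_simps)
    then have "ennreal ((t powr - \<theta> * K t) powr p / t) * indicator {0<..} t \<le> ?h m t"
      using m True by (auto simp: indicator_def intro: ennreal_leI)
    also have "\<dots> = (\<integral>\<^sup>+i. ?h i t * indicator {m} i \<partial>count_space UNIV)"
      by simp
    also have "\<dots> \<le> dyadic_sum (\<lambda>m. ?h m t)"
      by (intro nn_integral_mono) (auto simp: indicator_def)
    finally show ?thesis .
  qed simp
  have "interp_power \<theta> p K
      \<le> (\<integral>\<^sup>+t. dyadic_sum (\<lambda>m. ?h m t) \<partial>lborel)"
    by (intro nn_integral_mono pt)
  also have "\<dots> = dyadic_sum (\<lambda>m. \<integral>\<^sup>+t. ?h m t \<partial>lborel)"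
    by (rule dyadic_sum_swap[symmetric]) auto
  also have "\<dots> = dyadic_sum (\<lambda>m. ennreal ((4 * C) powr p / a) *
      ennreal (X m powr ((1 - \<theta>) * p) * Y m powr (\<theta> * p)))"
  proof (rule nn_integral_cong)
    fix m
    have "(\<integral>\<^sup>+t. ?h m t \<partial>lborel) = ennreal ((4 * C * Y m) powr p) *
      (\<integral>\<^sup>+t. ennreal (t powr (a - 1)) * indicator {0<..<T m} t \<partial>lborel)"
      by (simp add: nn_integral_cmult ennreal_mult' mult.assoc)
    also have "\<dots> = ennreal ((4 * C * Y m) powr p * (T m powr a / a))"
      using a by (simp only: nn_integral_powr_at_0[OF a T0] ennreal_mult' powr_ge_zero)
    also have "(4 * C * Y m) powr p * (T m powr a / a) =
       (4 * C) powr p / a * (X m powr ((1 - \<theta>) * p) * Y m powr (\<theta> * p))"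
    proof -
      have "Y m powr p = Y m powr (\<theta> * p) * Y m powr a"
        by (simp add: a_def algebra_simps flip: powr_add)
      then show ?thesis using C X(2)[of m] Y(2)[of m]
        by (simp add: powr_mult powr_divide T_def a_def)
    qed
    finally show "(\<integral>\<^sup>+t. ?h m t \<partial>lborel) = ennreal ((4 * C) powr p / a) *
      ennreal (X m powr ((1 - \<theta>) * p) * Y m powr (\<theta> * p))"
      using a by (subst ennreal_mult'[symmetric]) auto
  qed
  also have "\<dots> = ennreal ((4 * C) powr p / a) *
      dyadic_sum (\<lambda>m. ennreal (X m powr ((1 - \<theta>) * p) * Y m powr (\<theta> * p)))"
    by (rule nn_integral_cmult) simp
  finally show ?thesis by (simp add: a_def)
qed

text \<open>As \<open>K\<close> increases, the integrand on a dyadic interval is bounded below by a multiple of its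
  value at the left end.\<close>

lemma dyadic_sum_le_interp:
  fixes K :: "real \<Rightarrow> real"
  assumes K: "\<And>t. 0 < t \<Longrightarrow> 0 \<le> K t" "\<And>s t. \<lbrakk>0 < s; s \<le> t\<rbrakk> \<Longrightarrow> K s \<le> K t"
    and \<theta>: "0 < \<theta>" "\<theta> < 1" and p: "1 < p"
  shows "dyadic_sum (\<lambda>m. ennreal ((dyad m powr - \<theta> * K (dyad m)) powr p))
    \<le> ennreal (2 powr (\<theta> * p + 1)) *
      interp_power \<theta> p K"
proof -
  define c where "c m = (2 powr - \<theta> * (dyad m powr - \<theta> * K (dyad m))) powr p / (2 * dyad m)" for m
  have c0: "0 \<le> c m" for m by (simp add: c_def)
  let ?h = "\<lambda>m t. ennreal (c m) * indicator {dyad m<..dyad (m + 1)} t"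
  have val: "c m \<le> (t powr - \<theta> * K t) powr p / t" if t: "dyad m < t" "t \<le> dyad (m + 1)" for m t
  proof -
    have t0: "0 < t" using t(1) by (smt (verit) powr_gt_zero)
    have t2: "t \<le> 2 * dyad m" using t(2) by (simp add: powr_add)
    have "2 powr - \<theta> * dyad m powr - \<theta> = (2 * dyad m) powr - \<theta>" by (simp add: powr_mult)
    also have "\<dots> \<le> t powr - \<theta>" using t0 t2 \<theta> by (intro powr_mono2') auto
    finally have "2 powr - \<theta> * dyad m powr - \<theta> * K (dyad m) \<le> t powr - \<theta> * K t"
      using K t by (intro mult_mono) auto
    then show ?thesis unfolding c_def using t0 t2 p K(1)[of "dyad m"]
      by (intro frac_le powr_mono2) (auto simp: mult.assoc)
  qed
  have "dyadic_sum (\<lambda>m. ennreal ((dyad m powr - \<theta> * K (dyad m)) powr p))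
     = dyadic_sum (\<lambda>m. ennreal (2 powr (\<theta> * p + 1)) * (\<integral>\<^sup>+t. ?h m t \<partial>lborel))"
  proof (rule nn_integral_cong)
    fix m
    have "(\<integral>\<^sup>+t. ?h m t \<partial>lborel) = ennreal (c m) * ennreal (dyad (m + 1) - dyad m)"
      by (simp add: nn_integral_cmult)
    also have "\<dots> = ennreal (c m * dyad m)"
      using c0 by (simp add: powr_add flip: ennreal_mult')
    also have "c m * dyad m = 2 powr - (\<theta> * p + 1) * (dyad m powr - \<theta> * K (dyad m)) powr p"
    proof -
      have "c m = (2 powr - \<theta>) powr p * (dyad m powr - \<theta> * K (dyad m)) powr p / (2 * dyad m)"
        using K(1)[of "dyad m"] unfolding c_def by (subst powr_mult) auto
      moreover have "(2 powr - \<theta>) powr p = 2 * 2 powr - (\<theta> * p + 1)"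
        by (simp add: powr_powr powr_diff)
      ultimately show ?thesis by simp
    qed
    finally show "ennreal ((dyad m powr - \<theta> * K (dyad m)) powr p) =
      ennreal (2 powr (\<theta> * p + 1)) * (\<integral>\<^sup>+t. ?h m t \<partial>lborel)"
      by (simp flip: ennreal_mult' mult.assoc powr_add)
  qed
  also have "\<dots> = ennreal (2 powr (\<theta> * p + 1)) * (\<integral>\<^sup>+t. dyadic_sum (\<lambda>m. ?h m t) \<partial>lborel)"
    by (subst nn_integral_cmult) (auto simp: dyadic_sum_swap)
  also have "\<dots> \<le> ennreal (2 powr (\<theta> * p + 1)) *
      interp_power \<theta> p K"
  proof (intro mult_left_mono nn_integral_mono)
    fix t :: real
    show "dyadic_sum (\<lambda>m. ?h m t) \<le> ennreal ((t powr - \<theta> * K t) powr p / t) * indicator {0<..} t"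
    proof (cases "0 < t")
      case True
      define n where "n = \<lceil>log 2 t\<rceil> - 1"
      have iff: "t \<in> {dyad m<..dyad (m + 1)} \<longleftrightarrow> m = n" for m
      proof -
        have "t \<in> {dyad m<..dyad (m + 1)} \<longleftrightarrow> real_of_int m < log 2 t \<and> log 2 t \<le> real_of_int (m + 1)"
          using True by (simp add: less_log_iff log_le_iff)
        also have "\<dots> \<longleftrightarrow> m = n" unfolding n_def by linarith
        finally show ?thesis .
      qed
      have "dyadic_sum (\<lambda>m. ?h m t) = (\<integral>\<^sup>+m. ennreal (c m) * indicator {n} m \<partial>count_space UNIV)"
        by (intro nn_integral_cong) (simp only: indicator_def iff singleton_iff)
      also have "\<dots> = ennreal (c n)" by simp
      finally show ?thesis using True val[of n t] iff[of n] by (auto intro: ennreal_leI)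
    next
      case False
      then have "t \<notin> {dyad m<..dyad (m + 1)}" for m by (smt (verit) greaterThanAtMost_iff powr_gt_zero)
      then show ?thesis by simp
    qed
  qed simp
  finally show ?thesis .
qed

section \<open>Weighted counting measures\<close>

locale weighted_points =
  fixes w :: "'v \<Rightarrow> real"
  assumes w_pos: "0 < w x"
begin

definition \<nu> :: "'v measure" where
  "\<nu> = point_measure UNIV (\<lambda>x. ennreal (w x))"

abbreviation power_integral :: "real \<Rightarrow> ('v \<Rightarrow> real) \<Rightarrow> ennreal" where
  "power_integral r h \<equiv> \<integral>\<^sup>+x. ennreal (h x powr r) \<partial>\<nu>"

abbreviation norm_power_integral :: "real \<Rightarrow> ('v \<Rightarrow> complex) \<Rightarrow> ennreal" where
  "norm_power_integral r h \<equiv> \<integral>\<^sup>+x. ennreal (norm (h x) powr r) \<partial>\<nu>"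

abbreviation norm_integral :: "('v \<Rightarrow> complex) \<Rightarrow> ennreal" where
  "norm_integral h \<equiv> \<integral>\<^sup>+x. ennreal (norm (h x)) \<partial>\<nu>"

definition mass :: "'v set \<Rightarrow> real" where
  "mass S = (\<Sum>x\<in>S. w x)"

lemma space_\<nu> [simp]: "space \<nu> = UNIV"
  by (simp add: \<nu>_def space_point_measure)

lemma sets_\<nu> [simp]: "sets \<nu> = UNIV"
  by (simp add: \<nu>_def sets_point_measure)

lemma measurable_\<nu> [measurable, simp]: "h \<in> measurable \<nu> borel"
  by (simp add: measurable_def)

lemma nn_integral_\<nu>: "(\<integral>\<^sup>+x. h x \<partial>\<nu>) = (\<integral>\<^sup>+x. ennreal (w x) * h x \<partial>count_space UNIV)"
  unfolding \<nu>_def point_measure_def by (subst nn_integral_density) auto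

lemma AE_\<nu>: "(AE x in \<nu>. P x) \<longleftrightarrow> (\<forall>x. P x)"
  unfolding \<nu>_def point_measure_def using w_pos
  by (subst AE_density) (auto simp: AE_count_space)

lemma emeasure_\<nu>_finite: "finite S \<Longrightarrow> emeasure \<nu> S = ennreal (mass S)"
  unfolding \<nu>_def mass_def using w_pos
  by (subst emeasure_point_measure_finite2) (auto simp: sum_ennreal less_imp_le)

lemma measure_\<nu>_finite: "finite S \<Longrightarrow> measure \<nu> S = mass S"
  using w_pos by (simp add: measure_def emeasure_\<nu>_finite) (simp add: mass_def sum_nonneg less_imp_le)

lemma le_nn_integral_\<nu>: "ennreal (w x) * h x \<le> (\<integral>\<^sup>+x. h x \<partial>\<nu>)"
proof -
  have "ennreal (w x) * h x = (\<integral>\<^sup>+y. ennreal (w y) * h y * indicator {x} y \<partial>count_space UNIV)"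
    by simp
  also have "\<dots> \<le> (\<integral>\<^sup>+y. ennreal (w y) * h y \<partial>count_space UNIV)"
    by (intro nn_integral_mono) (auto simp: indicator_def)
  finally show ?thesis by (simp add: nn_integral_\<nu>)
qed

lemma integral_\<nu>_finite_support:
  fixes h :: "'v \<Rightarrow> 'b::{banach, second_countable_topology}"
  assumes "finite S" "\<And>x. x \<notin> S \<Longrightarrow> h x = 0"
  shows "(\<integral>x. h x \<partial>\<nu>) = (\<Sum>x\<in>S. w x *\<^sub>R h x)"
proof -
  have fin: "finite {x. h x \<noteq> 0}" using assms by (metis (mono_tags, lifting) finite_subset mem_Collect_eq subsetI)
  have "(\<integral>x. h x \<partial>\<nu>) = (\<integral>x. w x *\<^sub>R h x \<partial>count_space UNIV)"
    unfolding \<nu>_def point_measure_def using w_pos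
    by (subst integral_density) (auto simp: less_imp_le AE_count_space)
  also have "\<dots> = (\<Sum>x | x \<in> UNIV \<and> w x *\<^sub>R h x \<noteq> 0. w x *\<^sub>R h x)"
    by (rule lebesgue_integral_count_space_finite_support) (use fin in \<open>auto elim: finite_subset[rotated]\<close>)
  also have "\<dots> = (\<Sum>x\<in>S. w x *\<^sub>R h x)"
    using assms by (intro sum.mono_neutral_left) auto
  finally show ?thesis .
qed

lemma mass_nonneg: "0 \<le> mass S"
  using w_pos by (simp add: mass_def sum_nonneg less_imp_le)

lemma mass_pos: "\<lbrakk>finite S; x \<in> S\<rbrakk> \<Longrightarrow> 0 < mass S"
  unfolding mass_def using w_pos by (meson sum_pos2 less_imp_le)

definition avg :: "'v set \<Rightarrow> ('v \<Rightarrow> 'b::real_vector) \<Rightarrow> 'b" where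
  "avg S h = (1 / mass S) *\<^sub>R (\<Sum>y\<in>S. w y *\<^sub>R h y)"

lemma avg_mono:
  fixes h h' :: "'v \<Rightarrow> real"
  assumes "\<And>y. y \<in> S \<Longrightarrow> h y \<le> h' y" shows "avg S h \<le> avg S h'"
  unfolding avg_def using assms w_pos mass_nonneg
  by (auto intro!: divide_right_mono sum_mono mult_left_mono simp: less_imp_le)

lemma avg_add_const:
  fixes h :: "'v \<Rightarrow> real"
  assumes "finite S" "S \<noteq> {}" shows "avg S (\<lambda>y. h y + c) = avg S h + c"
proof -
  have "0 < mass S" using assms mass_pos by blast
  then show ?thesis
    by (simp add: avg_def distrib_left sum.distrib add_divide_distrib flip: sum_distrib_right mass_def)
qed

lemma norm_avg_le: "norm (avg S h) \<le> avg S (\<lambda>y. norm (h y))"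
  unfolding avg_def using w_pos mass_nonneg
  by (auto intro!: divide_right_mono sum_norm_le simp: less_imp_le)

text \<open>Averaging over the blocks of a partition does not change integrals. Swapping the two
  summations proves this without enumerating the blocks, because \<open>z \<in> S y\<close> is symmetric.\<close>

lemma sum_avg_blocks:
  fixes h :: "'v \<Rightarrow> 'b::real_vector"
  assumes A: "finite A"
    and S: "\<And>y. y \<in> A \<Longrightarrow> y \<in> S y" "\<And>y. y \<in> A \<Longrightarrow> S y \<subseteq> A"
      "\<And>y z. \<lbrakk>y \<in> A; z \<in> S y\<rbrakk> \<Longrightarrow> S z = S y"
  shows "(\<Sum>y\<in>A. w y *\<^sub>R avg (S y) h) = (\<Sum>y\<in>A. w y *\<^sub>R h y)"
proof -
  have sym: "z \<in> S y \<longleftrightarrow> y \<in> S z" if "y \<in> A" "z \<in> A" for y z using S that by blast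
  have fin: "finite (S y)" if "y \<in> A" for y using finite_subset[OF S(2)[OF that] A] .
  let ?k = "\<lambda>y z. (w y * w z / mass (S z)) *\<^sub>R h z"
  have "(\<Sum>y\<in>A. w y *\<^sub>R avg (S y) h) = (\<Sum>y\<in>A. \<Sum>z\<in>{z\<in>A. z \<in> S y}. ?k y z)"
  proof (rule sum.cong)
    fix y assume y: "y \<in> A"
    then have "{z\<in>A. z \<in> S y} = S y" using S by blast
    then show "w y *\<^sub>R avg (S y) h = (\<Sum>z\<in>{z\<in>A. z \<in> S y}. ?k y z)"
      using S(3)[OF y] by (auto simp: avg_def scaleR_sum_right intro!: sum.cong)
  qed simp
  also have "\<dots> = (\<Sum>z\<in>A. \<Sum>y\<in>{y\<in>A. z \<in> S y}. ?k y z)"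
    by (rule sum.swap_restrict) (use A in auto)
  also have "\<dots> = (\<Sum>z\<in>A. w z *\<^sub>R h z)"
  proof (rule sum.cong)
    fix z assume z: "z \<in> A"
    then have "{y\<in>A. z \<in> S y} = S z" using S(2)[OF z] sym[OF _ z] by auto
    then have "(\<Sum>y\<in>{y\<in>A. z \<in> S y}. ?k y z) = (\<Sum>y\<in>S z. w y * w z / mass (S z)) *\<^sub>R h z"
      by (simp add: scaleR_sum_left)
    also have "(\<Sum>y\<in>S z. w y * w z / mass (S z)) = mass (S z) * w z / mass (S z)"
      by (simp add: mass_def sum_distrib_right sum_divide_distrib)
    also have "\<dots> = w z" using mass_pos[OF fin[OF z] S(1)[OF z]] by simp
    finally show "(\<Sum>y\<in>{y\<in>A. z \<in> S y}. ?k y z) = w z *\<^sub>R h z" .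
  qed simp
  finally show ?thesis .
qed

lemma nn_integral_avg_blocks:
  fixes h :: "'v \<Rightarrow> real"
  assumes h: "\<And>x. 0 \<le> h x"
    and S: "\<And>y. y \<in> A \<Longrightarrow> y \<in> S y" "\<And>y. y \<in> A \<Longrightarrow> S y \<subseteq> A"
      "\<And>y z. \<lbrakk>y \<in> A; z \<in> S y\<rbrakk> \<Longrightarrow> S z = S y" "\<And>y. y \<in> A \<Longrightarrow> finite (S y)"
  shows "(\<integral>\<^sup>+y. ennreal (avg (S y) h) * indicator A y \<partial>\<nu>) = (\<integral>\<^sup>+y. ennreal (h y) * indicator A y \<partial>\<nu>)"
proof -
  have sym: "z \<in> S y \<longleftrightarrow> y \<in> S z" if "y \<in> A" "z \<in> A" for y z using S that by blast
  define k where "k = (\<lambda>(y, z). if y \<in> A \<and> z \<in> A \<and> z \<in> S y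
      then ennreal (w y * w z / mass (S y) * h z) else 0)"
  have finsum: "(\<integral>\<^sup>+z. (if z \<in> B then ennreal (e z) else 0) \<partial>count_space UNIV) = ennreal (\<Sum>z\<in>B. e z)"
    if "finite B" "\<And>z. 0 \<le> e z" for B and e :: "'v \<Rightarrow> real"
  proof -
    have "(\<integral>\<^sup>+z. (if z \<in> B then ennreal (e z) else 0) \<partial>count_space UNIV)
       = (\<integral>\<^sup>+z. ennreal (e z) \<partial>count_space B)"
      by (subst nn_integral_count_space_indicator) (auto intro!: nn_integral_cong simp: indicator_def)
    then show ?thesis using that by (simp add: nn_integral_count_space_finite sum_ennreal)
  qed
  have nn: "0 \<le> w y * w z / mass (S y) * h z" for y z
    using w_pos h mass_nonneg by (simp add: less_imp_le)
  have "(\<integral>\<^sup>+y. ennreal (avg (S y) h) * indicator A y \<partial>\<nu>)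
     = (\<integral>\<^sup>+y. \<integral>\<^sup>+z. k (y, z) \<partial>count_space UNIV \<partial>count_space UNIV)"
    unfolding nn_integral_\<nu>
  proof (rule nn_integral_cong)
    fix y
    show "ennreal (w y) * (ennreal (avg (S y) h) * indicator A y) = (\<integral>\<^sup>+z. k (y, z) \<partial>count_space UNIV)"
    proof (cases "y \<in> A")
      case True
      have "(\<integral>\<^sup>+z. k (y, z) \<partial>count_space UNIV)
         = (\<integral>\<^sup>+z. (if z \<in> S y then ennreal (w y * w z / mass (S y) * h z) else 0) \<partial>count_space UNIV)"
        using True S(2)[OF True] by (intro nn_integral_cong) (auto simp: k_def)
      also have "\<dots> = ennreal (\<Sum>z\<in>S y. w y * w z / mass (S y) * h z)"
        using S(4)[OF True] nn by (rule finsum)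
      also have "(\<Sum>z\<in>S y. w y * w z / mass (S y) * h z) = w y * avg (S y) h"
        by (simp add: avg_def sum_distrib_left sum_divide_distrib mult.assoc)
      finally show ?thesis using True w_pos[of y] by (simp add: ennreal_mult' less_imp_le)
    qed (simp add: k_def)
  qed
  also have "\<dots> = (\<integral>\<^sup>+z. \<integral>\<^sup>+y. k (y, z) \<partial>count_space UNIV \<partial>count_space UNIV)"
    by (simp only: nn_integral_fst_count_space nn_integral_snd_count_space)
  also have "\<dots> = (\<integral>\<^sup>+z. ennreal (h z) * indicator A z \<partial>\<nu>)"
    unfolding nn_integral_\<nu>
  proof (rule nn_integral_cong)
    fix z
    show "(\<integral>\<^sup>+y. k (y, z) \<partial>count_space UNIV) = ennreal (w z) * (ennreal (h z) * indicator A z)"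
    proof (cases "z \<in> A")
      case True
      have "(\<integral>\<^sup>+y. k (y, z) \<partial>count_space UNIV)
         = (\<integral>\<^sup>+y. (if y \<in> S z then ennreal (w y * w z / mass (S z) * h z) else 0) \<partial>count_space UNIV)"
      proof (intro nn_integral_cong)
        fix y
        show "k (y, z) = (if y \<in> S z then ennreal (w y * w z / mass (S z) * h z) else 0)"
          using True S(2)[OF True] sym[of y z] S(3)[of y z] by (auto simp: k_def)
      qed
      also have "\<dots> = ennreal (\<Sum>y\<in>S z. w y * w z / mass (S z) * h z)"
        using S(4)[OF True] w_pos h mass_nonneg by (intro finsum) (auto simp: less_imp_le)
      also have "(\<Sum>y\<in>S z. w y * w z / mass (S z) * h z) = mass (S z) * w z / mass (S z) * h z"
        by (simp add: mass_def sum_distrib_right sum_divide_distrib)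
      also have "\<dots> = w z * h z" using mass_pos[OF S(4)[OF True] S(1)[OF True]] by simp
      finally show ?thesis using True w_pos[of z] by (simp add: ennreal_mult' less_imp_le)
    qed (simp add: k_def)
  qed
  finally show ?thesis .
qed

end

section \<open>Stopping-time decomposition along a regular filtration\<close>

locale regular_filtration = weighted_points w
  for w :: "'v \<Rightarrow> real" +
  fixes cell :: "nat \<Rightarrow> 'v \<Rightarrow> 'v set" and D :: real
  assumes cell_0: "cell 0 x = {x}"
    and cell_self: "x \<in> cell j x"
    and cell_eq: "y \<in> cell j x \<Longrightarrow> cell j y = cell j x"
    and cell_mono: "cell j x \<subseteq> cell (Suc j) x"
    and finite_cell: "finite (cell j x)"
    and cell_regular: "mass (cell (Suc j) x) \<le> D * mass (cell j x)"
    and cell_exhausts: "filterlim (\<lambda>j. mass (cell j x)) at_top sequentially"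
begin

lemma mass_cell_pos: "0 < mass (cell j x)"
  using mass_pos finite_cell cell_self by blast

lemma cell_mono_le: "i \<le> j \<Longrightarrow> cell i x \<subseteq> cell j x"
  by (rule lift_Suc_mono_le[of "\<lambda>j. cell j x"]) (use cell_mono in auto)

lemma D_ge_1: "1 \<le> D"
proof -
  fix x :: 'v
  have "mass (cell 0 x) \<le> mass (cell 1 x)"
    unfolding mass_def by (rule sum_mono2) (use finite_cell cell_mono w_pos in \<open>auto simp: less_imp_le\<close>)
  then have "mass (cell 0 x) \<le> D * mass (cell 0 x)" using cell_regular[of 0 x] by simp
  then show ?thesis using mass_cell_pos[of 0 x] by simp
qed

text \<open>If the averages die out along growing cells, then every point at which some average
  exceeds \<open>l\<close> has a largest cell with this property, its stopping cell at height \<open>l\<close>.\<close>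

definition vanishing :: "('v \<Rightarrow> complex) \<Rightarrow> bool" where
  "vanishing f \<longleftrightarrow> (\<forall>x. (\<lambda>j. avg (cell j x) (\<lambda>y. norm (f y))) \<longlonglongrightarrow> 0)"

definition maximal :: "('v \<Rightarrow> complex) \<Rightarrow> 'v \<Rightarrow> real" where
  "maximal f x = (SUP j. avg (cell j x) (\<lambda>y. norm (f y)))"

definition superlevel :: "('v \<Rightarrow> complex) \<Rightarrow> real \<Rightarrow> 'v set" where
  "superlevel f l = {x. \<exists>j. l < avg (cell j x) (\<lambda>y. norm (f y))}"

definition stop :: "('v \<Rightarrow> complex) \<Rightarrow> real \<Rightarrow> 'v \<Rightarrow> 'v set" where
  "stop f l x = cell (GREATEST j. l < avg (cell j x) (\<lambda>y. norm (f y))) x"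

definition good :: "('v \<Rightarrow> complex) \<Rightarrow> real \<Rightarrow> 'v \<Rightarrow> complex" where
  "good f l x = (if x \<in> superlevel f l then avg (stop f l x) f else f x)"

text \<open>The pointwise inequality \<open>a \<le> e + e powr (1 - p) * a powr p\<close> takes the place of Hoelder's
  inequality: its second term, averaged over a cell, is at most a constant divided by the mass.\<close>

lemma vanishing_if_Lp:
  assumes p: "1 < p" and fin: "norm_power_integral p f < \<infinity>"
  shows "vanishing f"
  unfolding vanishing_def
proof (intro allI)
  fix x
  define I where "I = enn2real (norm_power_integral p f)"
  have I: "(\<Sum>y\<in>cell j x. w y * norm (f y) powr p) \<le> I" for j
  proof -
    have "ennreal (\<Sum>y\<in>cell j x. w y * norm (f y) powr p)
       = (\<integral>\<^sup>+y. ennreal (w y * norm (f y) powr p) \<partial>count_space (cell j x))"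
      using finite_cell w_pos by (simp add: nn_integral_count_space_finite sum_ennreal less_imp_le)
    also have "\<dots> \<le> (\<integral>\<^sup>+y. ennreal (w y * norm (f y) powr p) \<partial>count_space UNIV)"
      by (subst nn_integral_count_space_indicator) (auto intro!: nn_integral_mono simp: indicator_def)
    also have "\<dots> = norm_power_integral p f"
      using w_pos by (simp add: nn_integral_\<nu> ennreal_mult' less_imp_le)
    also have "\<dots> = ennreal I" using fin by (simp add: I_def)
    finally show ?thesis by (subst (asm) ennreal_le_iff) (simp_all add: I_def)
  qed
  show "(\<lambda>j. avg (cell j x) (\<lambda>y. norm (f y))) \<longlonglongrightarrow> 0"
  proof (rule LIMSEQ_I)
    fix r :: real assume r: "0 < r"
    define e where "e = r / 2"
    have e: "0 < e" using r by (simp add: e_def)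
    have pt: "a \<le> e + e powr (1 - p) * a powr p" if "0 \<le> a" for a
    proof (cases "a \<le> e")
      case False
      then have "a = e powr (1 - p) * (e powr (p - 1) * a)" using e by (simp flip: powr_add mult.assoc)
      also have "\<dots> \<le> e powr (1 - p) * (a powr (p - 1) * a)"
        using False e p that by (intro mult_left_mono mult_right_mono powr_mono2) auto
      also have "\<dots> = e powr (1 - p) * a powr p" using False e by (simp add: powr_mult_base mult.commute)
      finally show ?thesis using e by simp
    qed (simp add: add_increasing2)
    have bound: "avg (cell j x) (\<lambda>y. norm (f y)) \<le> e + e powr (1 - p) * I / mass (cell j x)" for j
    proof -
      have "avg (cell j x) (\<lambda>y. norm (f y)) \<le> avg (cell j x) (\<lambda>y. e powr (1 - p) * norm (f y) powr p + e)"
        using pt by (intro avg_mono) (simp add: add.commute)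
      also have "\<dots> = avg (cell j x) (\<lambda>y. e powr (1 - p) * norm (f y) powr p) + e"
        using finite_cell[of j x] cell_self[of x j] by (intro avg_add_const) auto
      also have "avg (cell j x) (\<lambda>y. e powr (1 - p) * norm (f y) powr p)
         = e powr (1 - p) * (\<Sum>y\<in>cell j x. w y * norm (f y) powr p) / mass (cell j x)"
        by (simp add: avg_def sum_distrib_left sum_divide_distrib mult.left_commute)
      also have "\<dots> \<le> e powr (1 - p) * I / mass (cell j x)"
        using I mass_nonneg by (intro divide_right_mono mult_left_mono) auto
      finally show ?thesis by simp
    qed
    have "(\<lambda>j. e powr (1 - p) * I / mass (cell j x)) \<longlonglongrightarrow> 0"
      by (rule real_tendsto_divide_at_top[OF tendsto_const cell_exhausts])
    then have "eventually (\<lambda>j. e powr (1 - p) * I / mass (cell j x) < e) sequentially"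
      using e by (intro order_tendstoD) auto
    then obtain n where n: "\<And>j. n \<le> j \<Longrightarrow> e powr (1 - p) * I / mass (cell j x) < e"
      by (auto simp: eventually_sequentially)
    have "norm (avg (cell j x) (\<lambda>y. norm (f y)) - 0) < r" if "n \<le> j" for j
    proof -
      have "0 \<le> avg (cell j x) (\<lambda>y. norm (f y))"
        using w_pos mass_nonneg
          by (auto simp: avg_def less_imp_le intro!: sum_nonneg divide_nonneg_nonneg)
      moreover have "avg (cell j x) (\<lambda>y. norm (f y)) < r"
        using bound[of j] n[OF that] e_def by linarith
      ultimately show ?thesis by simp
    qed
    then show "\<exists>n. \<forall>j\<ge>n. norm (avg (cell j x) (\<lambda>y. norm (f y)) - 0) < r" by blast
  qed
qed

context
  fixes f :: "'v \<Rightarrow> complex"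
  assumes van: "vanishing f"
begin

abbreviation mean :: "nat \<Rightarrow> 'v \<Rightarrow> real" where
  "mean j x \<equiv> avg (cell j x) (\<lambda>y. norm (f y))"

lemma mean_bdd: "bdd_above (range (\<lambda>j. mean j x))"
proof -
  have "convergent (\<lambda>j. mean j x)" using van by (auto simp: vanishing_def convergent_def)
  then have "Bseq (\<lambda>j. mean j x)" by (rule convergent_imp_Bseq)
  then show ?thesis by (rule Bseq_bdd_above)
qed

lemma mean_le_maximal: "mean j x \<le> maximal f x"
  unfolding maximal_def by (rule cSUP_upper[OF _ mean_bdd]) simp

lemma norm_le_maximal: "norm (f x) \<le> maximal f x"
proof -
  have "mean 0 x = norm (f x)" using w_pos[of x] by (simp add: avg_def cell_0 mass_def)
  then show ?thesis using mean_le_maximal[of 0 x] by simp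
qed

lemma maximal_nonneg: "0 \<le> maximal f x"
  using norm_le_maximal[of x] norm_ge_zero order_trans by blast

lemma superlevel_eq: "superlevel f l = {x. l < maximal f x}"
  unfolding superlevel_def maximal_def using mean_bdd by (auto simp: less_cSUP_iff)

lemma stop_index:
  assumes l: "0 < l" and x: "x \<in> superlevel f l"
  shows "\<exists>k. stop f l x = cell k x \<and> l < mean k x \<and> (\<forall>j. l < mean j x \<longrightarrow> j \<le> k)"
proof -
  have "(\<lambda>j. mean j x) \<longlonglongrightarrow> 0" using van by (simp add: vanishing_def)
  then have "eventually (\<lambda>j. mean j x < l) sequentially" using l by (intro order_tendstoD)
  then obtain b where b: "\<And>j. b \<le> j \<Longrightarrow> mean j x < l" by (auto simp: eventually_sequentially)
  have b': "\<And>j. l < mean j x \<Longrightarrow> j \<le> b" using b by (meson not_le less_imp_le order_less_asym nat_le_linear)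
  obtain i where i: "l < mean i x" using x by (auto simp: superlevel_def)
  show ?thesis
  proof (intro exI conjI allI impI)
    show "stop f l x = cell (GREATEST j. l < mean j x) x" by (simp add: stop_def)
    show "l < mean (GREATEST j. l < mean j x) x" using GreatestI_nat[of "\<lambda>j. l < mean j x"] i b' by blast
    show "l < mean j x \<Longrightarrow> j \<le> (GREATEST j. l < mean j x)" for j
      using Greatest_le_nat[of "\<lambda>j. l < mean j x"] b' by blast
  qed
qed

lemma stop_self: "x \<in> stop f l x"
  by (simp add: stop_def cell_self)

lemma finite_stop: "finite (stop f l x)"
  by (simp add: stop_def finite_cell)

text \<open>From the stopping index of \<open>x\<close> on, the cells of \<open>x\<close> and of any \<open>y\<close> in the stopping cell
  coincide, so both points stop at the same index.\<close>

lemma stop_block: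
  assumes l: "0 < l" and x: "x \<in> superlevel f l" and y: "y \<in> stop f l x"
  shows "y \<in> superlevel f l" "stop f l y = stop f l x"
proof -
  obtain k where k: "stop f l x = cell k x" "l < mean k x" "\<forall>j. l < mean j x \<longrightarrow> j \<le> k"
    using stop_index[OF l x] by blast
  have e: "cell j y = cell j x" if "k \<le> j" for j
    using cell_eq cell_mono_le[OF that] y k(1) by blast
  have ky: "l < mean k y" "\<And>j. l < mean j y \<Longrightarrow> j \<le> k"
    using k(2,3) e nat_le_linear by (force, metis)
  then show "y \<in> superlevel f l" by (auto simp: superlevel_def)
  have "(GREATEST j. l < mean j y) = k" using ky by (intro Greatest_equality) auto
  then show "stop f l y = stop f l x" using e k by (simp add: stop_def)
qed

lemma superlevel_antimono: "l \<le> l' \<Longrightarrow> superlevel f l' \<subseteq> superlevel f l"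
  by (auto simp: superlevel_def intro: le_less_trans)

lemma stop_antimono:
  assumes l: "0 < l" "l \<le> l'" and x: "x \<in> superlevel f l'"
  shows "stop f l' x \<subseteq> stop f l x"
proof -
  have "0 < l'" using l by simp
  obtain k' where k': "stop f l' x = cell k' x" "l' < mean k' x" "\<forall>j. l' < mean j x \<longrightarrow> j \<le> k'"
    using stop_index[OF \<open>0 < l'\<close> x] by blast
  have "x \<in> superlevel f l" using x superlevel_antimono[OF l(2)] by blast
  then obtain k where k: "stop f l x = cell k x" "l < mean k x" "\<forall>j. l < mean j x \<longrightarrow> j \<le> k"
    using stop_index[OF l(1)] by blast
  have "k' \<le> k" using k(3)[rule_format, of k'] k'(2) l by simp
  then show ?thesis using k(1) k'(1) cell_mono_le by simp
qed

lemma less_avg_stop: "\<lbrakk>0 < l; x \<in> superlevel f l\<rbrakk> \<Longrightarrow> l < avg (stop f l x) (\<lambda>y. norm (f y))"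
  using stop_index[of l x] by auto

text \<open>The next larger cell has average at most \<open>l\<close>, and its mass is at most \<open>D\<close> times larger.\<close>

lemma avg_stop_le:
  assumes l: "0 < l" and x: "x \<in> superlevel f l"
  shows "avg (stop f l x) (\<lambda>y. norm (f y)) \<le> D * l"
proof -
  obtain k where k: "stop f l x = cell k x" "l < mean k x" "\<forall>j. l < mean j x \<longrightarrow> j \<le> k"
    using stop_index[OF l x] by blast
  let ?s = "\<lambda>k. \<Sum>y\<in>cell k x. w y * norm (f y)"
  have le: "mean (Suc k) x \<le> l" using k(3)[rule_format, of "Suc k"] by force
  have "?s k \<le> ?s (Suc k)"
    by (rule sum_mono2) (use finite_cell cell_mono w_pos in \<open>auto simp: less_imp_le\<close>)
  also have "\<dots> = mean (Suc k) x * mass (cell (Suc k) x)"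
    using mass_cell_pos[of "Suc k" x] by (simp add: avg_def)
  also have "\<dots> \<le> l * (D * mass (cell k x))"
    using le l cell_regular mass_nonneg by (intro mult_mono) auto
  finally show ?thesis using mass_cell_pos[of k x] k(1) by (simp add: avg_def field_simps)
qed

lemma norm_good_le:
  assumes l: "0 < l" shows "norm (good f l x) \<le> D * min (maximal f x) l"
proof (cases "x \<in> superlevel f l")
  case True
  then have "norm (good f l x) \<le> avg (stop f l x) (\<lambda>y. norm (f y))"
    using norm_avg_le by (simp add: good_def)
  also have "\<dots> \<le> D * l" using avg_stop_le[OF l True] .
  finally show ?thesis using True by (simp add: superlevel_eq min_def)
next
  case False
  then have "norm (good f l x) \<le> min (maximal f x) l"
    using norm_le_maximal[of x] by (simp add: good_def superlevel_eq)
  also have "\<dots> \<le> D * min (maximal f x) l"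
    using D_ge_1 maximal_nonneg[of x] l mult_right_mono[of 1 D "min (maximal f x) l"] by simp
  finally show ?thesis .
qed

text \<open>Stopping cells at the larger height \<open>l'\<close> that meet a stopping cell at height \<open>l\<close> are
  contained in it, and replacing \<open>f\<close> by its averages over them does not change the integral.\<close>

lemma sum_good_stop:
  assumes l: "0 < l" "l \<le> l'" and x: "x \<in> superlevel f l"
  shows "(\<Sum>y\<in>stop f l x. w y *\<^sub>R good f l' y) = (\<Sum>y\<in>stop f l x. w y *\<^sub>R f y)"
proof -
  have l': "0 < l'" using l by simp
  let ?A = "stop f l x \<inter> superlevel f l'" and ?B = "stop f l x - superlevel f l'"
  have "(\<Sum>y\<in>?A. w y *\<^sub>R good f l' y) = (\<Sum>y\<in>?A. w y *\<^sub>R avg (stop f l' y) f)"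
    by (intro sum.cong) (auto simp: good_def)
  also have "\<dots> = (\<Sum>y\<in>?A. w y *\<^sub>R f y)"
  proof (rule sum_avg_blocks)
    show "finite ?A" using finite_stop by simp
    show "y \<in> stop f l' y" for y by (rule stop_self)
    show "stop f l' y \<subseteq> ?A" if y: "y \<in> ?A" for y
    proof -
      have "stop f l' y \<subseteq> stop f l y" using stop_antimono[OF l] y by blast
      also have "stop f l y = stop f l x" using stop_block(2)[OF l(1) x] y by blast
      finally show ?thesis using stop_block(1)[OF l'] y by blast
    qed
    show "stop f l' z = stop f l' y" if "y \<in> ?A" "z \<in> stop f l' y" for y z
      using stop_block(2)[OF l'] that by blast
  qed
  finally have A: "(\<Sum>y\<in>?A. w y *\<^sub>R good f l' y) = (\<Sum>y\<in>?A. w y *\<^sub>R f y)" .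
  have B: "(\<Sum>y\<in>?B. w y *\<^sub>R good f l' y) = (\<Sum>y\<in>?B. w y *\<^sub>R f y)"
    by (intro sum.cong) (auto simp: good_def)
  have "stop f l x = ?A \<union> ?B" by blast
  then have split: "(\<Sum>y\<in>stop f l x. h y) = (\<Sum>y\<in>?A. h y) + (\<Sum>y\<in>?B. h y)" for h :: "'v \<Rightarrow> complex"
    using finite_stop[of l x] by (metis Int_Diff_Un Int_Diff_disjoint finite_Diff finite_Int sum.union_disjoint)
  show ?thesis by (simp only: split A B)
qed

text \<open>Discarding the values of \<open>norm (f x)\<close> below \<open>l / 2\<close> lowers an average by at most \<open>l / 2\<close>,
  so the large values alone still have average above \<open>l / 2\<close> on each stopping cell. A bound by
  the large values only is what makes the sum over all dyadic heights converge in the strong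
  type inequality.\<close>

lemma weak_type:
  assumes l: "0 < l"
  shows "emeasure \<nu> (superlevel f l)
    \<le> ennreal (2 / l) * (\<integral>\<^sup>+x. (if l / 2 < norm (f x) then ennreal (norm (f x)) else 0) \<partial>\<nu>)"
proof -
  let ?O = "superlevel f l"
  define h where "h x = (if l / 2 < norm (f x) then norm (f x) else 0)" for x
  have h0: "0 \<le> h x" for x by (simp add: h_def)
  have big: "l / 2 \<le> avg (stop f l x) h" if x: "x \<in> ?O" for x
  proof -
    have "l < avg (stop f l x) (\<lambda>y. norm (f y))" using less_avg_stop[OF l x] .
    also have "\<dots> \<le> avg (stop f l x) (\<lambda>y. h y + l / 2)"
      using l by (intro avg_mono) (auto simp: h_def)
    also have "\<dots> = avg (stop f l x) h + l / 2"
      using finite_stop[of l x] stop_self[of x l] by (intro avg_add_const) auto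
    finally show ?thesis by simp
  qed
  have "emeasure \<nu> ?O = (\<integral>\<^sup>+x. indicator ?O x \<partial>\<nu>)" by simp
  also have "\<dots> \<le> (\<integral>\<^sup>+x. ennreal (2 / l) * (ennreal (avg (stop f l x) h) * indicator ?O x) \<partial>\<nu>)"
  proof (rule nn_integral_mono)
    fix x
    have "1 \<le> 2 / l * avg (stop f l x) h" if "x \<in> ?O" using big[OF that] l by (simp add: field_simps)
    then have "ennreal 1 \<le> ennreal (2 / l * avg (stop f l x) h)" if "x \<in> ?O"
      using that by (intro ennreal_leI) auto
    then show "indicator ?O x \<le> ennreal (2 / l) * (ennreal (avg (stop f l x) h) * indicator ?O x)"
      using l by (auto simp: indicator_def simp flip: ennreal_mult')
  qed
  also have "\<dots> = ennreal (2 / l) * (\<integral>\<^sup>+x. ennreal (avg (stop f l x) h) * indicator ?O x \<partial>\<nu>)"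
    by (rule nn_integral_cmult) simp
  also have "(\<integral>\<^sup>+x. ennreal (avg (stop f l x) h) * indicator ?O x \<partial>\<nu>)
     = (\<integral>\<^sup>+x. ennreal (h x) * indicator ?O x \<partial>\<nu>)"
  proof (rule nn_integral_avg_blocks)
    show "stop f l y \<subseteq> ?O" if "y \<in> ?O" for y using stop_block(1)[OF l that] by blast
    show "stop f l z = stop f l y" if "y \<in> ?O" "z \<in> stop f l y" for y z
      using stop_block(2)[OF l that] .
  qed (rule h0 stop_self finite_stop)+
  also have "\<dots> \<le> (\<integral>\<^sup>+x. (if l / 2 < norm (f x) then ennreal (norm (f x)) else 0) \<partial>\<nu>)"
    by (intro nn_integral_mono) (auto simp: h_def indicator_def)
  finally show ?thesis by (simp add: mult_left_mono)
qed

lemma strong_type: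
  assumes p: "1 < p"
  shows "power_integral p (maximal f)
    \<le> ennreal (4 powr p / (1 - 2 powr (1 - p))) * norm_power_integral p f"
proof -
  define J where "J m = (\<integral>\<^sup>+x. (if dyad m < norm (f x) then ennreal (norm (f x)) else 0) \<partial>\<nu>)" for m
  have "power_integral p (maximal f)
     \<le> (\<integral>\<^sup>+x. dyadic_sum (\<lambda>m. ennreal (dyad (m + 1) powr p) * indicator (superlevel f (dyad m)) x) \<partial>\<nu>)"
  proof (rule nn_integral_mono)
    fix x
    show "ennreal (maximal f x powr p)
       \<le> dyadic_sum (\<lambda>m. ennreal (dyad (m + 1) powr p) * indicator (superlevel f (dyad m)) x)"
    proof (cases "maximal f x = 0")
      case False
      with maximal_nonneg[of x] have pos: "0 < maximal f x" by simp
      define n where "n = \<lceil>log 2 (maximal f x)\<rceil> - 1"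
      have "real_of_int n < log 2 (maximal f x)" "log 2 (maximal f x) \<le> real_of_int (n + 1)"
        unfolding n_def by linarith+
      then have n: "dyad n < maximal f x" "maximal f x \<le> dyad (n + 1)"
        using pos by (simp_all add: less_log_iff log_le_iff)
      have "ennreal (maximal f x powr p) \<le> ennreal (dyad (n + 1) powr p) * indicator (superlevel f (dyad n)) x"
        using n pos p by (auto simp: superlevel_eq simp del: powr_powr intro!: ennreal_leI powr_mono2)
      also have "\<dots> = (\<integral>\<^sup>+m. ennreal (dyad (m + 1) powr p) * indicator (superlevel f (dyad m)) x
          * indicator {n} m \<partial>count_space UNIV)" by simp
      also have "\<dots> \<le> dyadic_sum (\<lambda>m. ennreal (dyad (m + 1) powr p) * indicator (superlevel f (dyad m)) x)"
        by (intro nn_integral_mono) (auto simp: indicator_def)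
      finally show ?thesis .
    qed simp
  qed
  also have "\<dots> = dyadic_sum (\<lambda>m. ennreal (dyad (m + 1) powr p) * emeasure \<nu> (superlevel f (dyad m)))"
    by (subst dyadic_sum_swap[symmetric]) (auto simp: nn_integral_cmult_indicator simp del: powr_powr)
  also have "\<dots> \<le> dyadic_sum (\<lambda>m. ennreal (4 powr p) * (ennreal (dyad (m - 1) powr (p - 1)) * J (m - 1)))"
  proof (rule nn_integral_mono)
    fix m
    have "ennreal (dyad (m + 1) powr p) * emeasure \<nu> (superlevel f (dyad m))
       \<le> ennreal (dyad (m + 1) powr p) * (ennreal (2 / dyad m) * J (m - 1))"
      using weak_type[of "dyad m"] by (intro mult_left_mono) (auto simp: J_def powr_diff)
    also have "\<dots> = ennreal (dyad (m + 1) powr p * (2 / dyad m)) * J (m - 1)"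
      by (subst ennreal_mult) (auto simp: mult.assoc)
    also have "dyad (m + 1) powr p * (2 / dyad m) = 4 powr p * dyad (m - 1) powr (p - 1)"
    proof -
      have e: "dyad (m + 1) = 4 * dyad (m - 1)" "dyad m = 2 * dyad (m - 1)"
        by (simp_all add: powr_add powr_diff)
      have "dyad (m - 1) powr p = dyad (m - 1) powr (p - 1) * dyad (m - 1)"
        using powr_add[of "dyad (m - 1)" "p - 1" 1] by simp
      then show ?thesis unfolding e by (simp add: powr_mult del: powr_powr)
    qed
    finally show "ennreal (dyad (m + 1) powr p) * emeasure \<nu> (superlevel f (dyad m))
      \<le> ennreal (4 powr p) * (ennreal (dyad (m - 1) powr (p - 1)) * J (m - 1))"
      by (simp add: ennreal_mult' mult.assoc del: powr_powr)
  qed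
  also have "\<dots> = ennreal (4 powr p) * dyadic_sum (\<lambda>m. ennreal (dyad (m - 1) powr (p - 1)) * J (m - 1))"
    by (rule nn_integral_cmult) simp
  also have "dyadic_sum (\<lambda>m. ennreal (dyad (m - 1) powr (p - 1)) * J (m - 1))
     = dyadic_sum (\<lambda>m. ennreal (dyad m powr (p - 1)) * J m)"
    using dyadic_sum_Suc[of "\<lambda>m. ennreal (dyad (m - 1) powr (p - 1)) * J (m - 1)"] by simp
  also have "\<dots> \<le> ennreal (1 / (1 - 2 powr (1 - p))) * norm_power_integral p f"
    unfolding J_def using p by (intro dyadic_sum_superlevel_le) auto
  finally show ?thesis
    using p by (simp add: mult_left_mono mult.assoc[symmetric] flip: ennreal_mult')
qed

text \<open>Consecutive good parts differ by a function that lives on the stopping cells of the lower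
  height and has integral zero on each of them: up to scaling, a sum of bounded atoms. The
  layers telescope to \<open>f - good f l\<close>.\<close>

definition layer :: "real \<Rightarrow> nat \<Rightarrow> 'v \<Rightarrow> complex" where
  "layer l m x = good f (l * 2 ^ Suc m) x - good f (l * 2 ^ m) x"

lemma layer_eq_0:
  assumes "0 < l" "x \<notin> superlevel f (l * 2 ^ m)" shows "layer l m x = 0"
proof -
  have "l * 2 ^ m \<le> l * 2 ^ Suc m" using assms by simp
  then have "x \<notin> superlevel f (l * 2 ^ Suc m)" using superlevel_antimono assms by blast
  then show ?thesis using assms by (simp add: layer_def good_def)
qed

lemma norm_layer_le:
  assumes "0 < l" shows "norm (layer l m x) \<le> 3 * D * (l * 2 ^ m)"
proof -
  have "norm (good f h x) \<le> D * h" if "0 < h" for h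
    using norm_good_le[OF that, of x] D_ge_1 mult_left_mono[of "min (maximal f x) h" h D] by linarith
  from this[of "l * 2 ^ m"] this[of "l * 2 ^ Suc m"]
  have "norm (good f (l * 2 ^ Suc m) x) + norm (good f (l * 2 ^ m) x) \<le> 3 * D * (l * 2 ^ m)"
    using assms by simp
  then show ?thesis unfolding layer_def using norm_triangle_ineq4 order_trans by blast
qed

lemma sum_layer_stop:
  assumes "0 < l" "x \<in> superlevel f (l * 2 ^ m)"
  shows "(\<Sum>y\<in>stop f (l * 2 ^ m) x. w y *\<^sub>R layer l m y) = 0"
  using sum_good_stop[of "l * 2 ^ m" "l * 2 ^ Suc m" x] sum_good_stop[of "l * 2 ^ m" "l * 2 ^ m" x] assms
  by (simp add: layer_def scaleR_diff_right sum_subtractf)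

lemma finite_superlevels:
  assumes "0 < l" shows "finite {m::nat. x \<in> superlevel f (l * 2 ^ m)}"
proof -
  obtain n where n: "maximal f x / l < 2 ^ n" using real_arch_pow[of 2] by auto
  have "m < n" if "x \<in> superlevel f (l * 2 ^ m)" for m
  proof -
    have "maximal f x < l * 2 ^ n" using n assms by (simp add: field_simps)
    then have "l * 2 ^ m < l * 2 ^ n" using that by (simp add: superlevel_eq)
    then have "(2::real) ^ m < 2 ^ n" using assms by simp
    then show ?thesis by simp
  qed
  then show ?thesis by (auto intro: finite_subset[of _ "{..<n}"])
qed

lemma sum_layers:
  assumes l: "0 < l"
  shows "(\<Sum>m | x \<in> superlevel f (l * 2 ^ m). layer l m x) = f x - good f l x"
proof -
  obtain n where n: "{m. x \<in> superlevel f (l * 2 ^ m)} \<subseteq> {..<n}"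
    using finite_superlevels[OF l] finite_nat_iff_bounded by blast
  have "(\<Sum>m | x \<in> superlevel f (l * 2 ^ m). layer l m x) = (\<Sum>m<n. layer l m x)"
    using n layer_eq_0[OF l] by (intro sum.mono_neutral_left) auto
  also have "\<dots> = good f (l * 2 ^ n) x - good f (l * 2 ^ 0) x"
    unfolding layer_def by (rule sum_lessThan_telescope)
  also have "good f (l * 2 ^ n) x = f x" using n by (auto simp: good_def)
  finally show ?thesis by simp
qed

text \<open>The heights \<open>l * 2 ^ m\<close> below \<open>maximal f x\<close> add up to at most twice the largest of them.\<close>

lemma superlevels_weighted_measure_le:
  assumes l: "0 < l"
  shows "(\<Sum>m. ennreal (l * 2 ^ m) * emeasure \<nu> (superlevel f (l * 2 ^ m)))
    \<le> 2 * (\<integral>\<^sup>+x. (if l < maximal f x then ennreal (maximal f x) else 0) \<partial>\<nu>)"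
proof -
  have "(\<Sum>m. ennreal (l * 2 ^ m) * emeasure \<nu> (superlevel f (l * 2 ^ m)))
     = (\<Sum>m. \<integral>\<^sup>+x. ennreal (l * 2 ^ m) * indicator (superlevel f (l * 2 ^ m)) x \<partial>\<nu>)"
    by (simp add: nn_integral_cmult_indicator)
  also have "\<dots> = (\<integral>\<^sup>+x. (\<Sum>m. ennreal (l * 2 ^ m) * indicator (superlevel f (l * 2 ^ m)) x) \<partial>\<nu>)"
    by (rule nn_integral_suminf[symmetric]) simp
  also have "\<dots> \<le> (\<integral>\<^sup>+x. 2 * (if l < maximal f x then ennreal (maximal f x) else 0) \<partial>\<nu>)"
  proof (rule nn_integral_mono)
    fix x
    let ?A = "{m. x \<in> superlevel f (l * 2 ^ m)}"
    have "(\<Sum>m. ennreal (l * 2 ^ m) * indicator (superlevel f (l * 2 ^ m)) x)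
       = (\<Sum>m\<in>?A. ennreal (l * 2 ^ m) * indicator (superlevel f (l * 2 ^ m)) x)"
      using finite_superlevels[OF l] by (rule suminf_finite) (auto simp: indicator_def)
    also have "\<dots> = ennreal (\<Sum>m\<in>?A. l * 2 ^ m)"
      using l by (subst sum_ennreal[symmetric]) (auto simp: indicator_def)
    also have "\<dots> \<le> 2 * (if l < maximal f x then ennreal (maximal f x) else 0)"
    proof (cases "?A = {}")
      case False
      define M where "M = Max ?A"
      have M: "M \<in> ?A" "?A \<subseteq> {..M}"
        using Max_in[OF finite_superlevels[OF l] False] Max_ge[OF finite_superlevels[OF l]]
        unfolding M_def by blast+
      have "(\<Sum>m\<in>?A. l * 2 ^ m) \<le> (\<Sum>m\<le>M. l * 2 ^ m)" using M l by (intro sum_mono2) auto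
      also have "\<dots> = l * (2 ^ Suc M - 1)"
        using sum_gp_basic[of "2::real" M] by (simp flip: sum_distrib_left) 
      also have "\<dots> \<le> 2 * (l * 2 ^ M)" using l by (simp add: algebra_simps)
      also have "\<dots> \<le> 2 * maximal f x" using M(1) by (simp add: superlevel_eq)
      finally have le: "(\<Sum>m\<in>?A. l * 2 ^ m) \<le> 2 * maximal f x" .
      have "l * 1 \<le> l * 2 ^ M" using l by (intro mult_left_mono) auto
      then have "l < maximal f x" using M(1) by (simp add: superlevel_eq)
      then show ?thesis using ennreal_leI[OF le] maximal_nonneg[of x] by (simp add: ennreal_mult)
    qed (simp del: power_Suc)
    finally show "(\<Sum>m. ennreal (l * 2 ^ m) * indicator (superlevel f (l * 2 ^ m)) x)
       \<le> 2 * (if l < maximal f x then ennreal (maximal f x) else 0)" .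
  qed
  also have "\<dots> = 2 * (\<integral>\<^sup>+x. (if l < maximal f x then ennreal (maximal f x) else 0) \<partial>\<nu>)"
    by (rule nn_integral_cmult) simp
  finally show ?thesis .
qed

end

end

section \<open>A regular filtration of the weighted tree\<close>

context weighted_tree
begin

lemma q_pos: "0 < real q"
  using q_ge_2 by simp

sublocale weighted_points "\<lambda>x. real q powi level x"
  by unfold_locales (rule zero_less_power_int[OF q_pos])

lemma \<mu>_eq_\<nu>: "\<mu> = \<nu>"
  by (simp add: \<mu>_def \<nu>_def)

text \<open>The descendants of \<open>z\<close> at depth \<open>a\<close> to \<open>b - 1\<close>. Both the cells of the filtration and the
  nondegenerate Calderon-Zygmund sets have this shape.\<close>

definition band :: "'v \<Rightarrow> nat \<Rightarrow> nat \<Rightarrow> 'v set" where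
  "band z a b = {y. \<exists>i. a \<le> i \<and> i < b \<and> (parent ^^ i) y = z}"

lemma band_mono: "\<lbrakk>a' \<le> a; b \<le> b'\<rbrakk> \<Longrightarrow> band z a b \<subseteq> band z a' b'"
  unfolding band_def by (auto intro: order_trans less_le_trans)

lemma finite_band: "finite (band z a b)"
proof -
  have "band z a b \<subseteq> (\<Union>i<b. {y. (parent ^^ i) y = z})" by (auto simp: band_def)
  then show ?thesis using card_descendants by (meson finite_UN finite_lessThan finite_subset)
qed

text \<open>Each generation below \<open>z\<close> has the mass of \<open>z\<close>: there are \<open>q ^ i\<close> descendants of weight
  \<open>q powi (level z - i)\<close>.\<close>

lemma mass_band: "mass (band z a b) = real (b - a) * real q powi level z"
proof -
  let ?G = "\<lambda>i. {y. (parent ^^ i) y = z}"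
  have lev: "level y = level z - int i" if "y \<in> ?G i" for y i
    using that level_parent_funpow[of i y] by auto
  have "band z a b = (\<Union>i\<in>{a..<b}. ?G i)" by (auto simp: band_def)
  then have "mass (band z a b) = (\<Sum>i\<in>{a..<b}. \<Sum>y\<in>?G i. real q powi level y)"
    unfolding mass_def
  proof (simp only:, intro sum.UNION_disjoint ballI impI)
    show "?G i \<inter> ?G j = {}" if "i \<noteq> j" for i j
    proof (rule ccontr)
      assume "?G i \<inter> ?G j \<noteq> {}"
      then obtain y where "y \<in> ?G i" "y \<in> ?G j" by blast
      from lev[OF this(1)] lev[OF this(2)] that show False by simp
    qed
  qed (use card_descendants in auto)
  also have "\<dots> = (\<Sum>i\<in>{a..<b}. real q powi level z)"
  proof (rule sum.cong[OF refl])
    fix i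
    have "(\<Sum>y\<in>?G i. real q powi level y) = (\<Sum>y\<in>?G i. real q powi (level z - int i))"
      by (rule sum.cong) (use lev in auto)
    also have "\<dots> = real q ^ i * real q powi (level z - int i)"
      using card_descendants[of i z] by simp
    also have "\<dots> = real q powi level z"
      using q_pos by (simp add: power_int_diff)
    finally show "(\<Sum>y\<in>?G i. real q powi level y) = real q powi level z" .
  qed
  finally show ?thesis by simp
qed

text \<open>The levels are cut into dyadic intervals of length \<open>2 ^ k\<close>; \<open>base k x\<close> is the lower end of
  the one containing \<open>level x\<close>.\<close>

definition base :: "nat \<Rightarrow> 'v \<Rightarrow> int" where
  "base k x = 2 ^ k * (level x div 2 ^ k)"

lemma base_le: "base k x \<le> level x"
  by (simp add: base_def minus_mod_eq_mult_div[symmetric])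

lemma level_less_base: "level x < base k x + 2 ^ k"
proof -
  have "level x mod 2 ^ k < 2 ^ k" by simp
  then show ?thesis using mult_div_mod_eq[of "2 ^ k" "level x"] unfolding base_def by linarith
qed

lemma base_eq_iff: "base k y = base k x \<longleftrightarrow> base k x \<le> level y \<and> level y < base k x + 2 ^ k"
proof
  assume "base k y = base k x"
  then show "base k x \<le> level y \<and> level y < base k x + 2 ^ k"
    using base_le[of k y] level_less_base[of y k] by simp
next
  assume "base k x \<le> level y \<and> level y < base k x + 2 ^ k"
  then have "level y div 2 ^ k = level x div 2 ^ k"
    by (intro int_div_pos_eq[of _ _ _ "level y - base k x"]) (auto simp: base_def)
  then show "base k y = base k x" by (simp add: base_def)
qed

lemma div_two_power_Suc: "(a::int) div 2 ^ Suc k = a div 2 ^ k div 2"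
  by (metis power_Suc2 zdiv_zmult2_eq zero_le_numeral)

lemma base_Suc: "base (Suc k) x \<le> base k x" "base k x \<le> base (Suc k) x + 2 ^ k"
proof -
  define a where "a = level x div 2 ^ k"
  have e: "level x div 2 ^ Suc k = a div 2"
    unfolding a_def by (rule div_two_power_Suc)
  have "2 * (a div 2) \<le> a" "a \<le> 2 * (a div 2) + 1" by presburger+
  then have "2 ^ k * (2 * (a div 2)) \<le> 2 ^ k * a" "2 ^ k * a \<le> 2 ^ k * (2 * (a div 2) + 1)"
    by (intro mult_left_mono; simp)+
  then show "base (Suc k) x \<le> base k x" "base k x \<le> base (Suc k) x + 2 ^ k"
    unfolding base_def e a_def[symmetric] by (simp_all add: algebra_simps)
qed

lemma base_Suc_cong: "base k y = base k x \<Longrightarrow> base (Suc k) y = base (Suc k) x"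
  by (simp add: base_def div_two_power_Suc del: power_Suc)

definition ancestor :: "int \<Rightarrow> 'v \<Rightarrow> 'v" where
  "ancestor a x = (parent ^^ nat (a - level x)) x"

lemma level_ancestor: "level x \<le> a \<Longrightarrow> level (ancestor a x) = a"
  by (simp add: ancestor_def level_parent_funpow)

lemma ancestor_mono:
  assumes "level x \<le> a" "level y \<le> a" "a \<le> b" "ancestor a y = ancestor a x"
  shows "ancestor b y = ancestor b x"
proof -
  have "ancestor b z = (parent ^^ nat (b - a)) (ancestor a z)" if "level z \<le> a" for z
  proof -
    have "nat (b - level z) = nat (b - a) + nat (a - level z)" using that assms by simp
    then show ?thesis by (simp add: ancestor_def funpow_add)
  qed
  then show ?thesis using assms by simp
qed

text \<open>With \<open>L = 2 ^ k\<close>, a cell of stage \<open>k\<close> consists of the points of one dyadic level interval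
  of length \<open>L\<close> that have a common ancestor on the level \<open>apex_level n x\<close>. While \<open>n\<close> runs from
  \<open>L\<close> to \<open>2 * L - 1\<close>, this level climbs from \<open>base k x + 2 * L\<close> towards
  \<open>base (Suc k) x + 4 * L\<close>, which is where the next stage, with intervals of length \<open>2 * L\<close>,
  starts. The width of a cell thus stays comparable with its distance from the apex, as for
  trapezoids.\<close>

definition apex_level :: "nat \<Rightarrow> 'v \<Rightarrow> int" where
  "apex_level n x = (let k = floor_log n in
     min (base k x + 2 * int n) (base (Suc k) x + 4 * 2 ^ k))"

definition grid :: "nat \<Rightarrow> 'v \<Rightarrow> 'v set" where
  "grid n x = (if n = 0 then {x} else
     {y. base (floor_log n) y = base (floor_log n) x \<and>
         ancestor (apex_level n x) y = ancestor (apex_level n x) x})"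

lemma apex_level_bounds:
  assumes "0 < n"
  shows "base (floor_log n) x + 2 * 2 ^ floor_log n \<le> apex_level n x"
    "apex_level n x \<le> base (floor_log n) x + 4 * 2 ^ floor_log n"
proof -
  have "int (2 ^ floor_log n) \<le> int n" using floor_log_exp2_le[OF assms] by (simp only: of_nat_le_iff)
  then show "base (floor_log n) x + 2 * 2 ^ floor_log n \<le> apex_level n x"
    "apex_level n x \<le> base (floor_log n) x + 4 * 2 ^ floor_log n"
    using base_Suc[of "floor_log n" x] unfolding apex_level_def Let_def by auto
qed

lemma level_less_apex: "0 < n \<Longrightarrow> level x < apex_level n x"
  using apex_level_bounds(1)[of n x] level_less_base[of x "floor_log n"]
    zero_less_power[of "2::int" "floor_log n"] by linarith

lemma apex_level_cong:
  "base (floor_log n) y = base (floor_log n) x \<Longrightarrow> apex_level n y = apex_level n x"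
  using base_Suc_cong[of "floor_log n" y x] by (simp add: apex_level_def Let_def)

lemma floor_log_Suc_cases:
  assumes "0 < n"
  shows "floor_log (Suc n) = floor_log n \<or>
    floor_log (Suc n) = Suc (floor_log n) \<and> Suc n = 2 * 2 ^ floor_log n"
proof (cases "Suc n < 2 * 2 ^ floor_log n")
  case True
  then show ?thesis using floor_log_exp2_le[OF assms] floor_log_eqI[of "Suc n" "floor_log n"] by auto
next
  case False
  then have "Suc n = 2 ^ Suc (floor_log n)" using floor_log_exp2_gt[of n] by simp
  then show ?thesis by (metis floor_log_power power_Suc)
qed

text
  \<open>Raising the apex by at most two levels at a time keeps the filtration regular. The minimum lets the upper half of a dyadic interval wait for the lower half, so that both reach the apex level of the doubled interval when they merge.\<close>

lemma apex_level_Suc: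
  assumes n: "0 < n"
  shows "apex_level n x \<le> apex_level (Suc n) x" "apex_level (Suc n) x \<le> apex_level n x + 2"
proof -
  define k where "k = floor_log n"
  have "apex_level n x \<le> apex_level (Suc n) x \<and> apex_level (Suc n) x \<le> apex_level n x + 2"
    using floor_log_Suc_cases[OF n]
  proof (elim disjE conjE)
    assume "floor_log (Suc n) = floor_log n"
    then show ?thesis by (auto simp: apex_level_def Let_def)
  next
    assume a: "floor_log (Suc n) = Suc (floor_log n)" "Suc n = 2 * 2 ^ floor_log n"
    have i: "int n = 2 * 2 ^ k - 1" "int (Suc n) = 2 * 2 ^ k"
      using a(2) unfolding k_def by (metis add_diff_cancel_right' of_nat_1 of_nat_Suc of_nat_mult of_nat_numeral of_nat_power add.commute)+
    have "apex_level n x = min (base k x + 2 * int n) (base (Suc k) x + 4 * 2 ^ k)"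
      "apex_level (Suc n) x = min (base (Suc k) x + 2 * int (Suc n)) (base (Suc (Suc k)) x + 8 * 2 ^ k)"
      using a(1) by (simp_all add: apex_level_def Let_def k_def)
    then show ?thesis
      using base_Suc[of k x] base_Suc[of "Suc k" x] i by auto
  qed
  then show "apex_level n x \<le> apex_level (Suc n) x" "apex_level (Suc n) x \<le> apex_level n x + 2" by auto
qed

lemma grid_eq_band:
  fixes x :: 'v
  assumes n: "0 < n"
  defines "k \<equiv> floor_log n" and "A \<equiv> apex_level n x"
  shows "grid n x = band (ancestor A x) (nat (A - base k x - 2 ^ k + 1)) (nat (A - base k x + 1))"
proof -
  have A: "base k x + 2 * 2 ^ k \<le> A" using apex_level_bounds(1)[OF n] by (simp add: A_def k_def)
  have lz: "level (ancestor A x) = A"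
    using level_less_apex[OF n, of x] by (intro level_ancestor) (simp add: A_def)
  have "y \<in> grid n x \<longleftrightarrow> y \<in> band (ancestor A x) (nat (A - base k x - 2 ^ k + 1)) (nat (A - base k x + 1))" for y
  proof
    assume "y \<in> grid n x"
    then have y: "base k y = base k x" "ancestor A y = ancestor A x"
      using n by (auto simp: grid_def k_def A_def)
    then have "base k x \<le> level y" "level y < base k x + 2 ^ k" by (simp_all add: base_eq_iff)
    then show "y \<in> band (ancestor A x) (nat (A - base k x - 2 ^ k + 1)) (nat (A - base k x + 1))"
      using y(2) A unfolding band_def
      by (intro CollectI exI[of _ "nat (A - level y)"]) (auto simp: ancestor_def[of A y])
  next
    assume "y \<in> band (ancestor A x) (nat (A - base k x - 2 ^ k + 1)) (nat (A - base k x + 1))"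
    then obtain i where i: "nat (A - base k x - 2 ^ k + 1) \<le> i" "i < nat (A - base k x + 1)"
      "(parent ^^ i) y = ancestor A x" by (auto simp: band_def)
    have l: "level y = A - int i" using level_parent_funpow[of i y] i(3) lz by simp
    have "base k y = base k x" using i(1,2) l A by (auto simp: base_eq_iff)
    moreover have "ancestor A y = ancestor A x" using l i(3) by (simp add: ancestor_def[of A y])
    ultimately show "y \<in> grid n x" using n by (simp add: grid_def k_def A_def)
  qed
  then show ?thesis by blast
qed

lemma mass_grid:
  assumes n: "0 < n"
  shows "mass (grid n x) = 2 ^ floor_log n * real q powi apex_level n x"
proof -
  let ?k = "floor_log n" and ?A = "apex_level n x"
  have "nat (?A - base ?k x + 1) - nat (?A - base ?k x - 2 ^ ?k + 1) = 2 ^ ?k"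
  proof -
    have "nat (?A - base ?k x + 1) = nat (?A - base ?k x - 2 ^ ?k + 1) + nat (2 ^ ?k)"
      using apex_level_bounds(1)[OF n, of x] zero_less_power[of "2::int" ?k]
      by (subst nat_add_distrib[symmetric]) (linarith | simp)+
    then show ?thesis by (simp add: nat_power_eq)
  qed
  moreover have "level (ancestor ?A x) = ?A"
    using level_less_apex[OF n, of x] by (intro level_ancestor) simp
  ultimately show ?thesis unfolding grid_eq_band[OF n] mass_band by simp
qed

text \<open>A cell of stage \<open>k\<close> has depth between \<open>2 ^ k\<close> and \<open>4 * 2 ^ k\<close> below its apex, so the
  envelope with the same apex and parameter \<open>2 * 2 ^ k\<close>, which reaches from depth \<open>2 ^ k\<close> to
  \<open>8 * 2 ^ k\<close>, contains it. The envelope consists of \<open>7 * 2 ^ k\<close> generations, the cell of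
  \<open>2 ^ k\<close>.\<close>

lemma CZ_set_around_grid:
  obtains S where "CZ_set S" "finite S" "grid n x \<subseteq> S" "mass S \<le> 7 * mass (grid n x)"
proof (cases "n = 0")
  case True
  have "CZ_set {x}" unfolding CZ_set_def by (blast intro: trapezoid_envelope.intros)
  then show thesis using that[of "{x}"] True mass_nonneg[of "{x}"] by (simp add: grid_def)
next
  case False
  then have n: "0 < n" by simp
  define k where "k = floor_log n"
  define A where "A = apex_level n x"
  define z where "z = ancestor A x"
  have lz: "level z = A"
    using level_less_apex[OF n, of x] unfolding z_def by (intro level_ancestor) (simp add: A_def)
  define h :: int where "h = 2 * 2 ^ k"
  let ?S = "{y. below y z \<and> real_of_int h / 2 \<le> real_of_int (level z - level y) \<and>
        level z - level y < 4 * h}"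
  have "1 \<le> h" using zero_less_power[of "2::int" k] unfolding h_def by linarith
  then have "CZ_set ?S" unfolding CZ_set_def by (blast intro: trapezoid_envelope.nondegenerate)
  moreover have S: "?S = band z (2 ^ k) (8 * 2 ^ k)"
  proof (intro set_eqI iffI)
    fix y assume y: "y \<in> ?S"
    have "real_of_int (2 ^ k) \<le> real_of_int (level z - level y)" using y by (simp add: h_def)
    then have "2 ^ k \<le> level z - level y" by (simp only: of_int_le_iff)
    then show "y \<in> band z (2 ^ k) (8 * 2 ^ k)"
      using y unfolding band_def h_def
      by (intro CollectI exI[of _ "nat (level z - level y)"]) (auto simp: below_iff le_nat_iff nat_less_iff)
  next
    fix y assume "y \<in> band z (2 ^ k) (8 * 2 ^ k)"
    then obtain i where i: "2 ^ k \<le> i" "i < 8 * 2 ^ k" "(parent ^^ i) y = z" by (auto simp: band_def)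
    have l: "level z - level y = int i" using level_parent_funpow[of i y] i(3) by simp
    have "int i < int (8 * 2 ^ k)" "real (2 ^ k) \<le> real i" using i(1,2) by (simp_all only: of_nat_less_iff of_nat_le_iff)
    show "y \<in> ?S"
    proof (intro CollectI conjI)
      show "below y z" using l i(3) by (simp add: below_iff)
      show "real_of_int h / 2 \<le> real_of_int (level z - level y)"
        unfolding l h_def using \<open>real (2 ^ k) \<le> real i\<close> by simp
      show "level z - level y < 4 * h"
        unfolding l h_def using \<open>int i < int (8 * 2 ^ k)\<close> by simp
    qed
  qed
  moreover have "grid n x \<subseteq> band z (2 ^ k) (8 * 2 ^ k)"
  proof -
    have "int (2 ^ k) \<le> A - base k x - 2 ^ k + 1" "A - base k x + 1 \<le> int (8 * 2 ^ k)"
      using apex_level_bounds[OF n, of x] zero_less_power[of "2::int" "floor_log n"]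
      unfolding A_def k_def of_nat_mult of_nat_power of_nat_numeral by linarith+
    then have "2 ^ k \<le> nat (A - base k x - 2 ^ k + 1)" "nat (A - base k x + 1) \<le> 8 * 2 ^ k"
      by linarith+
    then show ?thesis unfolding grid_eq_band[OF n] z_def[symmetric] A_def[symmetric] k_def[symmetric]
      by (rule band_mono)
  qed
  moreover have "mass (band z (2 ^ k) (8 * 2 ^ k)) = 7 * mass (grid n x)"
    by (simp add: mass_band mass_grid[OF n] lz k_def A_def)
  ultimately show thesis using that[of ?S] finite_band by simp
qed

lemma grid_self: "x \<in> grid n x"
  by (simp add: grid_def)

lemma grid_eq: "y \<in> grid n x \<Longrightarrow> grid n y = grid n x"
proof (cases "n = 0")
  case False
  assume "y \<in> grid n x"
  then have "base (floor_log n) y = base (floor_log n) x"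
    "ancestor (apex_level n x) y = ancestor (apex_level n x) x" using False by (auto simp: grid_def)
  then show ?thesis using apex_level_cong[of n y x] False by (simp add: grid_def)
qed (simp add: grid_def)

lemma grid_mono: "grid n x \<subseteq> grid (Suc n) x"
proof (cases "n = 0")
  case True
  then show ?thesis by (simp add: grid_def)
next
  case False
  then have n: "0 < n" by simp
  show ?thesis
  proof
    fix y assume "y \<in> grid n x"
    then have y: "base (floor_log n) y = base (floor_log n) x"
      "ancestor (apex_level n x) y = ancestor (apex_level n x) x" using n by (auto simp: grid_def)
    have "base (floor_log (Suc n)) y = base (floor_log (Suc n)) x"
      using floor_log_Suc_cases[OF n] y(1) base_Suc_cong by metis
    moreover have "ancestor (apex_level (Suc n) x) y = ancestor (apex_level (Suc n) x) x"
    proof (rule ancestor_mono[OF _ _ apex_level_Suc(1)[OF n] y(2)])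
      show "level x \<le> apex_level n x" using level_less_apex[OF n, of x] by simp
      show "level y \<le> apex_level n x"
        using level_less_apex[OF n, of y] apex_level_cong[OF y(1)] by simp
    qed
    ultimately show "y \<in> grid (Suc n) x" by (simp add: grid_def)
  qed
qed

lemma mass_grid_Suc: "mass (grid (Suc n) x) \<le> 2 * (real q)\<^sup>2 * mass (grid n x)"
proof (cases "n = 0")
  case True
  have "apex_level (Suc n) x \<le> base 0 x + 2" using True by (simp add: apex_level_def Let_def)
  then have "apex_level (Suc n) x \<le> level x + 2" by (simp add: base_def)
  then have "real q powi apex_level (Suc n) x \<le> real q powi (level x + 2)"
    using q_ge_2 by (intro power_int_increasing) auto
  also have "\<dots> = (real q)\<^sup>2 * real q powi level x" using q_pos by (simp add: power_int_add)
  also have "\<dots> \<le> 2 * ((real q)\<^sup>2 * real q powi level x)" using q_pos by simp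
  finally show ?thesis using True by (simp add: mass_grid) (simp add: grid_def mass_def mult.assoc)
next
  case False
  then have n: "0 < n" by simp
  have "real q powi apex_level (Suc n) x \<le> real q powi (apex_level n x + 2)"
    using q_ge_2 apex_level_Suc(2)[OF n] by (intro power_int_increasing) auto
  also have "\<dots> = (real q)\<^sup>2 * real q powi apex_level n x" using q_pos by (simp add: power_int_add)
  finally have a: "real q powi apex_level (Suc n) x \<le> (real q)\<^sup>2 * real q powi apex_level n x" .
  have b: "(2::real) ^ floor_log (Suc n) \<le> 2 * 2 ^ floor_log n"
    using floor_log_Suc_cases[OF n] by auto
  have "mass (grid (Suc n) x) \<le> (2 * 2 ^ floor_log n) * ((real q)\<^sup>2 * real q powi apex_level n x)"
    unfolding mass_grid[OF zero_less_Suc] using a b q_pos by (intro mult_mono) auto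
  then show ?thesis by (simp add: mass_grid[OF n] mult.commute mult.left_commute)
qed

lemma finite_grid: "finite (grid n x)"
  using finite_band by (cases "n = 0") (auto simp: grid_eq_band grid_def[of 0])

lemma mass_grid_at_top: "filterlim (\<lambda>n. mass (grid n x)) at_top sequentially"
proof (rule filterlim_at_top_mono)
  let ?c = "real q powi level x / 2"
  have c: "0 < ?c" using q_pos by simp
  show "filterlim (\<lambda>n. ?c * real n) at_top sequentially"
    by (rule filterlim_tendsto_pos_mult_at_top[OF tendsto_const c filterlim_real_sequentially])
  have "?c * real n \<le> mass (grid n x)" if n: "0 < n" for n
  proof -
    have "real n \<le> real (2 * 2 ^ floor_log n)" using floor_log_exp2_ge[of n] by (simp only: of_nat_le_iff)
    moreover have "real q powi level x \<le> real q powi apex_level n x"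
      using q_ge_2 level_less_apex[OF n, of x] by (intro power_int_increasing) auto
    ultimately have "real n * real q powi level x \<le> (2 * 2 ^ floor_log n) * real q powi apex_level n x"
      using q_pos by (intro mult_mono) auto
    then show ?thesis by (simp add: mass_grid[OF n] mult_ac)
  qed
  then show "eventually (\<lambda>n. ?c * real n \<le> mass (grid n x)) sequentially"
    by (intro eventually_mono[OF eventually_gt_at_top[of 0]])
qed

sublocale regular_filtration "\<lambda>x. real q powi level x" grid "2 * (real q)\<^sup>2"
  by unfold_locales
    (simp_all add: grid_def[of 0] grid_self grid_eq grid_mono finite_grid mass_grid_Suc mass_grid_at_top)

end

section \<open>Lebesgue spaces of a weighted counting measure\<close>

context weighted_points
begin

lemma mem_Lp_iff:
  "f \<in> Lp_space \<nu> (ereal r) \<longleftrightarrow> norm_power_integral r f < \<infinity>"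
  by (simp add: Lp_space_def integrable_iff_bounded)

lemma Lp_norm_eq:
  "Lp_norm \<nu> (ereal r) f = enn2real (norm_power_integral r f) powr (1 / r)"
  by (simp add: Lp_norm_def integral_eq_nn_integral)

lemma Lp_norm_powr:
  assumes "0 < r" "f \<in> Lp_space \<nu> (ereal r)"
  shows "ennreal (Lp_norm \<nu> (ereal r) f powr r) = norm_power_integral r f"
  using assms by (simp add: Lp_norm_eq mem_Lp_iff powr_powr)

lemma Lp_norm_le:
  assumes "0 < r" "0 \<le> B" "norm_power_integral r f \<le> ennreal (B powr r)"
  shows "f \<in> Lp_space \<nu> (ereal r)" "Lp_norm \<nu> (ereal r) f \<le> B"
proof -
  show "f \<in> Lp_space \<nu> (ereal r)"
    using assms(3) by (simp add: mem_Lp_iff) (meson ennreal_less_top le_less_trans)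
  have "enn2real (norm_power_integral r f) \<le> B powr r"
    using enn2real_mono[OF assms(3)] by simp
  then have "Lp_norm \<nu> (ereal r) f \<le> (B powr r) powr (1 / r)"
    unfolding Lp_norm_eq using assms(1) by (intro powr_mono2) auto
  then show "Lp_norm \<nu> (ereal r) f \<le> B" using assms by (simp add: powr_powr)
qed

lemma mem_Linf_iff: "f \<in> Lp_space \<nu> \<infinity> \<longleftrightarrow> (\<exists>C. \<forall>x. norm (f x) \<le> C)"
  by (simp add: Lp_space_def AE_\<nu>)

lemma esssup_le_iff: "esssup \<nu> h \<le> (c::ereal) \<longleftrightarrow> (\<forall>x. h x \<le> c)"
proof
  assume "esssup \<nu> h \<le> c"
  moreover have "\<forall>x. h x \<le> esssup \<nu> h" using esssup_AE[where M = \<nu> and f = h] by (simp add: AE_\<nu>)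
  ultimately show "\<forall>x. h x \<le> c" using order_trans by blast
qed (auto intro!: esssup_I simp: AE_\<nu>)

lemma Linf_norm:
  assumes "f \<in> Lp_space \<nu> \<infinity>"
  shows "norm (f x) \<le> Lp_norm \<nu> \<infinity> f" "(\<And>x. norm (f x) \<le> B) \<Longrightarrow> Lp_norm \<nu> \<infinity> f \<le> B"
    "0 \<le> Lp_norm \<nu> \<infinity> f"
proof -
  let ?e = "esssup \<nu> (\<lambda>x. ereal (norm (f x)))"
  obtain C where C: "\<And>x. norm (f x) \<le> C" using assms by (auto simp: mem_Linf_iff)
  have up: "?e \<le> ereal B" if "\<And>x. norm (f x) \<le> B" for B using that by (simp add: esssup_le_iff)
  have lo: "ereal (norm (f x)) \<le> ?e" for x using esssup_le_iff[of "\<lambda>x. ereal (norm (f x))" ?e] by simp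
  obtain e where e: "?e = ereal e" using up[of C] C lo by (cases ?e) auto
  have le: "norm (f x) \<le> e" for x using lo[of x] e by simp
  show "norm (f x) \<le> Lp_norm \<nu> \<infinity> f" using le e by (simp add: Lp_norm_def)
  show "(\<And>x. norm (f x) \<le> B) \<Longrightarrow> Lp_norm \<nu> \<infinity> f \<le> B" using up[of B] e by (simp add: Lp_norm_def)
  have "0 \<le> e" using le norm_ge_zero order_trans by blast
  then show "0 \<le> Lp_norm \<nu> \<infinity> f" using e by (simp add: Lp_norm_def)
qed

lemma mem_L1_iff: "f \<in> Lp_space \<nu> 1 \<longleftrightarrow> norm_integral f < \<infinity>"
  using mem_Lp_iff[of f 1] by (simp add: one_ereal_def)

lemma L1_norm_eq: "Lp_norm \<nu> 1 f = enn2real (norm_integral f)"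
  using Lp_norm_eq[of 1 f] by (simp add: one_ereal_def)

end

section \<open>Atomic decompositions\<close>

context weighted_tree
begin

lemma nn_integral_atom_le:
  assumes "atom a" shows "norm_integral a \<le> 1"
proof -
  obtain S where S: "\<And>x. x \<notin> S \<Longrightarrow> a x = 0" "a \<in> Lp_space \<nu> \<infinity>" "Lp_norm \<nu> \<infinity> a \<le> 1 / measure \<nu> S"
    using assms unfolding atom_def \<mu>_eq_\<nu> by blast
  have "norm_integral a \<le> (\<integral>\<^sup>+x. ennreal (1 / measure \<nu> S) * indicator S x \<partial>\<nu>)"
    using S(1) order_trans[OF Linf_norm(1)[OF S(2)] S(3)]
    by (intro nn_integral_mono) (auto simp: indicator_def intro!: ennreal_leI)
  also have "\<dots> = ennreal (1 / measure \<nu> S) * emeasure \<nu> S"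
    by (simp add: nn_integral_cmult_indicator)
  also have "\<dots> \<le> 1"
  proof (cases "emeasure \<nu> S = \<infinity>")
    \<comment> \<open>then \<open>measure \<nu> S\<close> and its reciprocal are \<open>0\<close> by convention, so that \<open>a\<close> vanishes\<close>
    case True
    then show ?thesis by (simp add: measure_def)
  next
    case False
    then have "emeasure \<nu> S = ennreal (measure \<nu> S)" by (simp add: emeasure_eq_ennreal_measure)
    then show ?thesis by (simp flip: ennreal_mult')
  qed
  finally show ?thesis .
qed

lemma norm_atom_le: "atom a \<Longrightarrow> norm (a x) \<le> 1 / real q powi level x"
proof -
  assume a: "atom a"
  have "ennreal (real q powi level x * norm (a x)) \<le> 1"
    using order_trans[OF le_nn_integral_\<nu> nn_integral_atom_le[OF a]] w_pos[of x]
    by (simp add: ennreal_mult' less_imp_le)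
  then have "real q powi level x * norm (a x) \<le> 1" by simp
  then show ?thesis using w_pos[of x] by (simp add: field_simps)
qed

text \<open>Every atom has integral norm at most one, so each partial sum is bounded by the sum of the
  coefficients, and the partial sums converge in \<open>L\<^sup>1\<close>.\<close>

lemma L1_norm_le_H1_norm:
  assumes h: "h \<in> H1"
  shows "norm_integral h \<le> ennreal (H1_norm h)"
proof -
  have hL: "norm_integral h < \<infinity>"
    using h unfolding H1_def \<mu>_eq_\<nu> by (simp add: mem_L1_iff)
  define I where "I = enn2real (norm_integral h)"
  have "I \<le> (\<Sum>j. norm (c j))" if ca: "atomic_decomposition h c a" for c a
  proof -
    let ?s = "\<lambda>n x. \<Sum>j<n. c j * a j x"
    have at: "\<And>j. atom (a j)" and sum: "summable (\<lambda>j. norm (c j))"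
      and lim: "(\<lambda>n. Lp_norm \<nu> 1 (\<lambda>x. h x - ?s n x)) \<longlonglongrightarrow> 0"
      using ca unfolding atomic_decomposition_def \<mu>_eq_\<nu> by auto
    have s: "norm_integral (?s n) \<le> ennreal (\<Sum>j. norm (c j))" for n
    proof -
      have "norm_integral (?s n)
         \<le> (\<integral>\<^sup>+x. (\<Sum>j<n. ennreal (norm (c j)) * ennreal (norm (a j x))) \<partial>\<nu>)"
        by (intro nn_integral_mono)
           (auto simp: norm_mult simp flip: ennreal_mult intro!: ennreal_leI sum_norm_le)
      also have "\<dots> = (\<Sum>j<n. ennreal (norm (c j)) * norm_integral (a j))"
        by (simp add: nn_integral_sum nn_integral_cmult)
      also have "\<dots> \<le> (\<Sum>j<n. ennreal (norm (c j)) * 1)"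
        by (intro sum_mono mult_left_mono nn_integral_atom_le at) auto
      also have "\<dots> = ennreal (\<Sum>j<n. norm (c j))" by simp
      also have "\<dots> \<le> ennreal (\<Sum>j. norm (c j))"
        by (intro ennreal_leI sum_le_suminf sum) auto
      finally show ?thesis .
    qed
    have fin: "(\<integral>\<^sup>+x. ennreal (norm (h x - ?s n x)) \<partial>\<nu>) < \<infinity>" for n
    proof -
      have "(\<integral>\<^sup>+x. ennreal (norm (h x - ?s n x)) \<partial>\<nu>)
         \<le> (\<integral>\<^sup>+x. ennreal (norm (h x)) + ennreal (norm (?s n x)) \<partial>\<nu>)"
        by (intro nn_integral_mono) (auto simp flip: ennreal_plus intro!: ennreal_leI norm_triangle_ineq4)
      also have "\<dots> = norm_integral h + norm_integral (?s n)"
        by (rule nn_integral_add) auto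
      also have "\<dots> < \<infinity>" using hL s[of n] by (auto simp: less_top intro: le_less_trans)
      finally show ?thesis .
    qed
    have "I \<le> Lp_norm \<nu> 1 (\<lambda>x. h x - ?s n x) + (\<Sum>j. norm (c j))" for n
    proof -
      have "ennreal I = norm_integral h" using hL by (simp add: I_def)
      also have "\<dots> \<le> (\<integral>\<^sup>+x. ennreal (norm (h x - ?s n x)) + ennreal (norm (?s n x)) \<partial>\<nu>)"
      proof (rule nn_integral_mono)
        fix x
        have "norm (h x) \<le> norm (h x - ?s n x) + norm (?s n x)" by norm
        then show "ennreal (norm (h x)) \<le> ennreal (norm (h x - ?s n x)) + ennreal (norm (?s n x))"
          by (simp flip: ennreal_plus)
      qed
      also have "\<dots> = (\<integral>\<^sup>+x. ennreal (norm (h x - ?s n x)) \<partial>\<nu>) + norm_integral (?s n)"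
        by (rule nn_integral_add) auto
      also have "\<dots> \<le> ennreal (Lp_norm \<nu> 1 (\<lambda>x. h x - ?s n x)) + ennreal (\<Sum>j. norm (c j))"
        using fin[of n] s by (intro add_mono) (auto simp: L1_norm_eq)
      also have "\<dots> = ennreal (Lp_norm \<nu> 1 (\<lambda>x. h x - ?s n x) + (\<Sum>j. norm (c j)))"
        using sum by (intro ennreal_plus[symmetric]) (auto simp: L1_norm_eq suminf_nonneg)
      finally show ?thesis
        using sum by (subst (asm) ennreal_le_iff) (auto simp: L1_norm_eq suminf_nonneg)
    qed
    moreover have "(\<lambda>n. Lp_norm \<nu> 1 (\<lambda>x. h x - ?s n x) + (\<Sum>j. norm (c j))) \<longlonglongrightarrow> 0 + (\<Sum>j. norm (c j))"
      by (intro tendsto_add lim tendsto_const)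
    ultimately show ?thesis by (intro LIMSEQ_le_const[where X = "\<lambda>n. Lp_norm \<nu> 1 (\<lambda>x. h x - ?s n x) + (\<Sum>j. norm (c j))"]) auto
  qed
  moreover have "{\<Sum>j. norm (c j) | c a. atomic_decomposition h c a} \<noteq> {}"
    using h by (auto simp: H1_def)
  ultimately have "I \<le> H1_norm h" unfolding H1_norm_def by (intro cInf_greatest) auto
  then have "ennreal I \<le> ennreal (H1_norm h)" by (rule ennreal_leI)
  then show ?thesis using hL by (simp add: I_def)
qed

lemma H1_norm_nonneg: "h \<in> H1 \<Longrightarrow> 0 \<le> H1_norm h"
  unfolding H1_norm_def
  by (intro cInf_greatest) (auto simp: H1_def atomic_decomposition_def suminf_nonneg)

text \<open>On a discrete space atoms are uniformly bounded at each point. Absolutely summable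
  coefficients therefore give pointwise convergence, and the remainder is dominated in \<open>L\<^sup>1\<close> by
  the tail of the coefficients.\<close>

lemma H1_if_pointwise_decomposition:
  fixes c :: "nat \<Rightarrow> complex"
  assumes at: "\<And>j. atom (a j)" and sum: "summable (\<lambda>j. norm (c j))"
    and h: "\<And>x. (\<lambda>j. c j * a j x) sums h x"
  shows "h \<in> H1" "H1_norm h \<le> (\<Sum>j. norm (c j))"
proof -
  let ?s = "\<lambda>n x. \<Sum>j<n. c j * a j x"
  have tail: "(\<integral>\<^sup>+x. ennreal (norm (h x - ?s n x)) \<partial>\<nu>) \<le> ennreal (\<Sum>j. norm (c (j + n)))" for n
  proof -
    have sn: "summable (\<lambda>j. norm (c (j + n)))" using sum by (rule summable_ignore_initial_segment)
    have "(\<integral>\<^sup>+x. ennreal (norm (h x - ?s n x)) \<partial>\<nu>)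
       \<le> (\<integral>\<^sup>+x. (\<Sum>j. ennreal (norm (c (j + n))) * ennreal (norm (a (j + n) x))) \<partial>\<nu>)"
    proof (rule nn_integral_mono)
      fix x
      have abs: "summable (\<lambda>j. norm (c (j + n) * a (j + n) x))"
      proof (rule summable_comparison_test'[where N = 0])
        show "summable (\<lambda>j. norm (c (j + n)) * (1 / real q powi level x))"
          using sn by (rule summable_mult2)
        show "norm (norm (c (j + n) * a (j + n) x)) \<le> norm (c (j + n)) * (1 / real q powi level x)" for j
          unfolding norm_mult real_norm_def abs_mult abs_norm_cancel
          using norm_atom_le[OF at] by (intro mult_left_mono) auto
      qed
      have "h x - ?s n x = (\<Sum>j. c (j + n) * a (j + n) x)"
        using sums_iff_shift[of "\<lambda>j. c j * a j x" n "h x - ?s n x"] h[of x] by (simp add: sums_iff)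
      then have "norm (h x - ?s n x) \<le> (\<Sum>j. norm (c (j + n) * a (j + n) x))"
        using summable_norm[OF abs] by simp
      then have "ennreal (norm (h x - ?s n x)) \<le> ennreal (\<Sum>j. norm (c (j + n) * a (j + n) x))"
        by (rule ennreal_leI)
      also have "\<dots> = (\<Sum>j. ennreal (norm (c (j + n) * a (j + n) x)))"
        using abs by (intro suminf_ennreal2[symmetric]) auto
      finally show "ennreal (norm (h x - ?s n x)) \<le> (\<Sum>j. ennreal (norm (c (j + n))) * ennreal (norm (a (j + n) x)))"
        by (simp add: norm_mult ennreal_mult)
    qed
    also have "\<dots> = (\<Sum>j. ennreal (norm (c (j + n))) * (norm_integral (a (j + n))))"
      by (subst nn_integral_suminf) (auto simp: nn_integral_cmult)
    also have "\<dots> \<le> (\<Sum>j. ennreal (norm (c (j + n))) * 1)"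
      by (intro suminf_le mult_left_mono nn_integral_atom_le at) auto
    also have "\<dots> = ennreal (\<Sum>j. norm (c (j + n)))"
      using sn by (simp add: suminf_ennreal2)
    finally show ?thesis .
  qed
  have L1: "h \<in> Lp_space \<nu> 1" using tail[of 0] by (simp add: mem_L1_iff) (meson ennreal_less_top le_less_trans)
  have "Lp_norm \<nu> 1 (\<lambda>x. h x - ?s n x) \<le> (\<Sum>j. norm (c (j + n)))" for n
  proof -
    have "0 \<le> (\<Sum>j. norm (c (j + n)))"
      using summable_ignore_initial_segment[OF sum, of n] by (intro suminf_nonneg) auto
    then show ?thesis using enn2real_mono[OF tail[of n]] by (simp add: L1_norm_eq)
  qed
  then have "\<forall>n. norm (Lp_norm \<nu> 1 (\<lambda>x. h x - ?s n x)) \<le> (\<Sum>j. norm (c (j + n)))"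
    by (simp add: L1_norm_eq)
  then have "(\<lambda>n. Lp_norm \<nu> 1 (\<lambda>x. h x - ?s n x)) \<longlonglongrightarrow> 0"
    by (rule Lim_null_comparison[OF always_eventually suminf_exist_split2[OF sum]])
  then have dec: "atomic_decomposition h c a"
    unfolding atomic_decomposition_def \<mu>_eq_\<nu> using at sum by simp
  then show "h \<in> H1" using L1 unfolding H1_def \<mu>_eq_\<nu> by blast
  show "H1_norm h \<le> (\<Sum>j. norm (c j))" unfolding H1_norm_def
    using dec by (intro cInf_lower)
      (auto intro!: bdd_belowI[of _ 0] simp: atomic_decomposition_def suminf_nonneg)
qed

abbreviation "D \<equiv> 2 * (real q)\<^sup>2"

text \<open>The constant \<open>21 * D\<close> is the product of \<open>3 * D\<close>, which bounds the layer relative to its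
  height, and of \<open>7\<close>, which compares the stopping cell with the surrounding Calderon-Zygmund
  set.\<close>

lemma atom_layer:
  assumes van: "vanishing f" and l: "0 < l" and y: "y \<in> superlevel f (l * 2 ^ m)"
  shows "atom (\<lambda>x. if x \<in> stop f (l * 2 ^ m) y
    then layer f l m x / (21 * D * (l * 2 ^ m) * mass (stop f (l * 2 ^ m) y)) else 0)"
    (is "atom ?a")
proof -
  let ?l = "l * 2 ^ m"
  let ?Q = "stop f ?l y"
  have l': "0 < ?l" using l by simp
  obtain n where n: "?Q = grid n y" unfolding stop_def by blast
  obtain S where S: "CZ_set S" "finite S" "?Q \<subseteq> S" "mass S \<le> 7 * mass ?Q"
    using CZ_set_around_grid[of n y] unfolding n by blast
  have Q: "0 < mass ?Q" unfolding n by (rule mass_cell_pos)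
  have yS: "y \<in> S" using S(3) stop_self[OF van] by blast
  have mS: "0 < mass S" using mass_pos[OF S(2) yS] .
  have D: "0 < D" using q_pos by simp
  have bd: "norm (?a x) \<le> 1 / mass S" for x
  proof (cases "x \<in> ?Q")
    case True
    have "norm (?a x) = norm (layer f l m x) / (21 * D * ?l * mass ?Q)"
      using True l D Q by (simp add: norm_divide norm_mult norm_power)
    also have "\<dots> \<le> (3 * D * ?l) / (21 * D * ?l * mass ?Q)"
      using norm_layer_le[OF van l] D l Q by (intro divide_right_mono) auto
    also have "\<dots> = 1 / (7 * mass ?Q)" using D l by (simp add: field_simps)
    also have "\<dots> \<le> 1 / mass S" using S(4) mS by (intro divide_left_mono) auto
    finally show ?thesis .
  qed (use mS in simp)
  have Li: "?a \<in> Lp_space \<nu> \<infinity>" unfolding mem_Linf_iff using bd by blast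
  have "(\<integral>x. ?a x \<partial>\<nu>) = (\<Sum>x\<in>?Q. (real q powi level x) *\<^sub>R ?a x)"
    by (rule integral_\<nu>_finite_support) (use finite_stop[OF van] in auto)
  also have "\<dots> = (\<Sum>x\<in>?Q. (real q powi level x) *\<^sub>R layer f l m x) / (21 * D * ?l * mass ?Q)"
    unfolding sum_divide_distrib by (intro sum.cong) (simp_all add: scaleR_conv_of_real)
  also have "\<dots> = 0" using sum_layer_stop[OF van l y] by simp
  finally have int: "(\<integral>x. ?a x \<partial>\<nu>) = 0" .
  show ?thesis unfolding atom_def \<mu>_eq_\<nu>
  proof (intro exI[of _ S] conjI)
    show "\<forall>x. x \<notin> S \<longrightarrow> ?a x = 0" using S(3) by auto
    show "Lp_norm \<nu> \<infinity> ?a \<le> 1 / measure \<nu> S"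
      using Linf_norm(2)[OF Li bd] by (simp add: measure_\<nu>_finite[OF S(2)])
  qed (use S(1) Li int in auto)
qed

lemma atom_zero: "atom (\<lambda>x. 0)"
proof -
  have "CZ_set {x}" for x unfolding CZ_set_def by (blast intro: trapezoid_envelope.intros)
  moreover have z: "(\<lambda>x. 0) \<in> Lp_space \<nu> \<infinity>" by (auto simp: mem_Linf_iff)
  moreover have "Lp_norm \<nu> \<infinity> (\<lambda>x. 0) \<le> 1 / measure \<nu> S" for S
    by (rule Linf_norm(2)[OF z]) simp
  ultimately show ?thesis unfolding atom_def \<mu>_eq_\<nu> by (intro exI conjI) auto
qed

text
  \<open>The atoms are indexed by a scale and a point of the superlevel set rather than by a scale and a stopping cell: each stopping cell contributes its atom once for every point, with the coefficient shared out in proportion to the weights.\<close>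

lemma bad_part_in_H1:
  assumes van: "vanishing f" and l: "0 < l"
    and fin: "(\<integral>\<^sup>+x. (if l < maximal f x then ennreal (maximal f x) else 0) \<partial>\<nu>) < \<infinity>"
  shows "(\<lambda>x. f x - good f l x) \<in> H1"
    "ennreal (H1_norm (\<lambda>x. f x - good f l x))
      \<le> ennreal (42 * D) * (\<integral>\<^sup>+x. (if l < maximal f x then ennreal (maximal f x) else 0) \<partial>\<nu>)"
proof -
  let ?O = "\<lambda>m. superlevel f (l * 2 ^ m)" and ?S = "\<lambda>m. stop f (l * 2 ^ m)"
  let ?B = "(\<integral>\<^sup>+x. (if l < maximal f x then ennreal (maximal f x) else 0) \<partial>\<nu>)"
  define C where "C m y = (if y \<in> ?O m then 21 * D * (l * 2 ^ m) * real q powi level y else 0)" for m y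
  define A where "A m y = (\<lambda>x. if y \<in> ?O m \<and> x \<in> ?S m y
     then layer f l m x / (21 * D * (l * 2 ^ m) * mass (?S m y)) else 0)" for m y
  define e where "e = from_nat_into (UNIV :: (nat \<times> 'v) set)"
  have D: "0 < D" using q_pos by simp
  have C0: "0 \<le> C m y" for m y using D l w_pos[of y] by (auto simp: C_def intro!: mult_nonneg_nonneg)
  have "countable (UNIV :: (nat \<times> 'v) set)"
    using countable_SIGMA[of "UNIV :: nat set" "\<lambda>_. UNIV :: 'v set"] countable_vertices by simp
  moreover have "infinite (UNIV :: (nat \<times> 'v) set)" by (simp add: finite_prod)
  ultimately have bij: "bij_betw e UNIV UNIV" unfolding e_def by (rule bij_betw_from_nat_into)
  have at: "atom (A m y)" for m y
  proof (cases "y \<in> ?O m")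
    case True
    then show ?thesis using atom_layer[OF van l True] by (simp add: A_def)
  qed (simp add: A_def atom_zero)
  have "(\<Sum>j. ennreal (case_prod C (e j))) = (\<integral>\<^sup>+i. ennreal (case_prod C i) \<partial>count_space UNIV)"
    unfolding nn_integral_count_space_nat[symmetric] by (rule nn_integral_bij_count_space[OF bij])
  also have "\<dots> = (\<integral>\<^sup>+m. \<integral>\<^sup>+y. ennreal (C m y) \<partial>count_space UNIV \<partial>count_space UNIV)"
    by (subst nn_integral_fst_count_space[symmetric]) simp
  also have "\<dots> = (\<Sum>m. ennreal (21 * D) * (ennreal (l * 2 ^ m) * emeasure \<nu> (?O m)))"
    unfolding nn_integral_count_space_nat
  proof (rule suminf_cong)
    fix m
    have "(\<integral>\<^sup>+y. ennreal (C m y) \<partial>count_space UNIV)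
       = (\<integral>\<^sup>+y. ennreal (21 * D * (l * 2 ^ m)) * indicator (?O m) y \<partial>\<nu>)"
      unfolding nn_integral_\<nu>
    proof (rule nn_integral_cong)
      fix y
      show "ennreal (C m y) = ennreal (real q powi level y) *
        (ennreal (21 * D * (l * 2 ^ m)) * indicator (?O m) y)"
        using D l w_pos[of y]
        by (auto simp: C_def indicator_def mult.commute simp flip: ennreal_mult')
    qed
    also have "\<dots> = ennreal (21 * D * (l * 2 ^ m)) * emeasure \<nu> (?O m)"
      by (simp add: nn_integral_cmult_indicator)
    also have "\<dots> = ennreal (21 * D) * (ennreal (l * 2 ^ m) * emeasure \<nu> (?O m))"
      using D l by (subst ennreal_mult) (auto simp: mult.assoc)
    finally show "(\<integral>\<^sup>+y. ennreal (C m y) \<partial>count_space UNIV)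
       = ennreal (21 * D) * (ennreal (l * 2 ^ m) * emeasure \<nu> (?O m))" .
  qed
  also have "\<dots> = ennreal (21 * D) * (\<Sum>m. ennreal (l * 2 ^ m) * emeasure \<nu> (?O m))"
    by simp
  also have "\<dots> \<le> ennreal (21 * D) * (2 * ?B)"
    by (intro mult_left_mono superlevels_weighted_measure_le[OF van l]) simp
  also have "\<dots> = ennreal (42 * D) * ?B"
  proof -
    have "ennreal (42 * D) = ennreal (21 * D) * 2"
      using D by (simp flip: ennreal_numeral ennreal_mult')
    then show ?thesis by (simp only: mult.assoc)
  qed
  finally have sumC: "(\<Sum>j. ennreal (case_prod C (e j))) \<le> ennreal (42 * D) * ?B" .
  let ?c = "\<lambda>j. complex_of_real (case_prod C (e j))" and ?a = "\<lambda>j. case_prod A (e j)"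
  have normc: "norm (?c j) = case_prod C (e j)" for j using C0 by (cases "e j") simp
  have "ennreal (42 * D) * ?B < \<infinity>" using fin by (simp add: ennreal_mult_less_top)
  then have ntop: "(\<Sum>j. ennreal (case_prod C (e j))) \<noteq> top" using sumC by auto
  have sum: "summable (\<lambda>j. norm (?c j))" unfolding normc
    using ntop C0 by (intro summable_suminf_not_top) (auto split: prod.split)
  have at': "atom (?a j)" for j using at by (cases "e j") simp
  have sums: "(\<lambda>j. ?c j * ?a j x) sums (f x - good f l x)" for x
  proof -
    \<comment> \<open>only finitely many pairs of a scale and a point contribute at \<open>x\<close>\<close>
    define P where "P = (SIGMA m : {m. x \<in> ?O m}. ?S m x)"
    have finP: "finite P" unfolding P_def using finite_superlevels[OF van l] finite_stop[OF van] by blast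
    have l2: "0 < l * 2 ^ m" for m using l by simp
    have sym: "y \<in> ?O m \<and> x \<in> ?S m y \<longleftrightarrow> x \<in> ?O m \<and> y \<in> ?S m x" for m y
      using stop_block[OF van l2] stop_self[OF van] by metis
    have "(\<lambda>j. ?c j * ?a j x) sums (\<Sum>j\<in>e -` P. ?c j * ?a j x)"
    proof (rule sums_finite)
      show "finite (e -` P)" using finP bij by (simp add: bij_betw_def finite_vimageI)
      fix j assume "j \<notin> e -` P"
      then show "?c j * ?a j x = 0"
        using sym by (cases "e j") (auto simp: P_def A_def)
    qed
    also have "(\<Sum>j\<in>e -` P. ?c j * ?a j x) = (\<Sum>(m, y)\<in>P. complex_of_real (C m y) * A m y x)"
    proof -
      have "bij_betw e (e -` P) P" using bij by (auto simp: bij_betw_def inj_on_def)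
      from sum.reindex_bij_betw[OF this, of "\<lambda>(m, y). complex_of_real (C m y) * A m y x"]
      show ?thesis by (simp add: case_prod_unfold)
    qed
    also have "\<dots> = (\<Sum>m | x \<in> ?O m. \<Sum>y\<in>?S m x. complex_of_real (C m y) * A m y x)"
      unfolding P_def using finite_superlevels[OF van l] finite_stop[OF van] by (subst sum.Sigma) auto
    also have "\<dots> = (\<Sum>m | x \<in> ?O m. layer f l m x)"
    proof (intro sum.cong refl)
      fix m assume m: "m \<in> {m. x \<in> ?O m}"
      have Q: "0 < mass (?S m x)" unfolding stop_def by (rule mass_cell_pos)
      have "(\<Sum>y\<in>?S m x. complex_of_real (C m y) * A m y x)
         = (\<Sum>y\<in>?S m x. complex_of_real (real q powi level y) * (layer f l m x / mass (?S m x)))"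
      proof (intro sum.cong refl)
        fix y assume y: "y \<in> ?S m x"
        then have "y \<in> ?O m" "?S m y = ?S m x" "x \<in> ?S m y"
          using stop_block[OF van l2, of x m y] m stop_self[OF van] by auto
        then show "complex_of_real (C m y) * A m y x
          = complex_of_real (real q powi level y) * (layer f l m x / mass (?S m x))"
          using D l by (simp add: C_def A_def field_simps)
      qed
      also have "\<dots> = complex_of_real (mass (?S m x)) * (layer f l m x / mass (?S m x))"
        by (simp add: mass_def sum_distrib_right sum_divide_distrib)
      also have "\<dots> = layer f l m x" using Q by simp
      finally show "(\<Sum>y\<in>?S m x. complex_of_real (C m y) * A m y x) = layer f l m x" .
    qed
    also have "\<dots> = f x - good f l x" by (rule sum_layers[OF van l])
    finally show ?thesis .
  qed
  show "(\<lambda>x. f x - good f l x) \<in> H1" by (rule H1_if_pointwise_decomposition(1)[OF at' sum sums])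
  have "H1_norm (\<lambda>x. f x - good f l x) \<le> (\<Sum>j. norm (?c j))"
    by (rule H1_if_pointwise_decomposition(2)[OF at' sum sums])
  then have "ennreal (H1_norm (\<lambda>x. f x - good f l x)) \<le> ennreal (\<Sum>j. case_prod C (e j))"
    unfolding normc by (rule ennreal_leI)
  also have "\<dots> = (\<Sum>j. ennreal (case_prod C (e j)))"
    using sum C0 unfolding normc by (intro suminf_ennreal2[symmetric]) (auto split: prod.split)
  also have "\<dots> \<le> ennreal (42 * D) * ?B" by (rule sumC)
  finally show "ennreal (H1_norm (\<lambda>x. f x - good f l x)) \<le> ennreal (42 * D) * ?B" .
qed

end

section \<open>Interpolation estimates on a weighted counting measure\<close>

lemma dyad_powr_small:
  assumes "0 < \<delta>" "0 < c"
  shows "\<exists>n::nat. \<forall>m. m \<le> - int n \<longrightarrow> B * dyad m powr \<delta> < c"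
proof -
  let ?r = "2 powr - \<delta>"
  have r: "0 < ?r" "?r < 1" using assms by (auto simp: powr_less_one)
  have "(\<lambda>n. \<bar>B\<bar> * ?r ^ n) \<longlonglongrightarrow> \<bar>B\<bar> * 0"
    using r by (intro tendsto_mult tendsto_const LIMSEQ_realpow_zero) auto
  then have "eventually (\<lambda>n. \<bar>B\<bar> * ?r ^ n < c) sequentially" using assms by (intro order_tendstoD) auto
  then obtain n where n: "\<bar>B\<bar> * ?r ^ n < c" by (auto simp: eventually_sequentially)
  have "B * dyad m powr \<delta> < c" if "m \<le> - int n" for m
  proof -
    have "dyad m powr \<delta> \<le> dyad (- int n) powr \<delta>"
      using that assms by (intro powr_mono2) auto
    also have "\<dots> = ?r ^ n" by (simp add: powr_powr mult.commute flip: powr_realpow)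
    finally have "\<bar>B\<bar> * dyad m powr \<delta> \<le> \<bar>B\<bar> * ?r ^ n" by (intro mult_left_mono) auto
    moreover have "B * dyad m powr \<delta> \<le> \<bar>B\<bar> * dyad m powr \<delta>" by (intro mult_right_mono) auto
    ultimately show ?thesis using n by linarith
  qed
  then show ?thesis by blast
qed

context weighted_points
begin

definition upper_part :: "('v \<Rightarrow> real) \<Rightarrow> int \<Rightarrow> ennreal" where
  "upper_part F m = (\<integral>\<^sup>+x. (if dyad m < F x then ennreal (F x) else 0) \<partial>\<nu>)"

lemma upper_part_le:
  assumes F: "\<And>x. 0 \<le> F x" and p: "1 < p"
  shows "upper_part F m \<le> ennreal (dyad m powr (1 - p)) * power_integral p F"
proof -
  have "upper_part F m \<le> (\<integral>\<^sup>+x. ennreal (dyad m powr (1 - p)) * ennreal (F x powr p) \<partial>\<nu>)"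
    unfolding upper_part_def
  proof (rule nn_integral_mono)
    fix x
    have "F x \<le> dyad m powr (1 - p) * F x powr p" if "dyad m < F x"
    proof -
      have Fx: "0 < F x" using that by (smt (verit) powr_gt_zero)
      have "F x = dyad m powr (1 - p) * (dyad m powr (p - 1) * F x)"
        by (simp only: mult.assoc[symmetric] powr_add[symmetric]) simp
      also have "\<dots> \<le> dyad m powr (1 - p) * (F x powr (p - 1) * F x)"
        using that p Fx by (intro mult_left_mono mult_right_mono powr_mono2) auto
      also have "F x powr (p - 1) * F x = F x powr p" using Fx by (simp add: powr_mult_base mult.commute)
      finally show ?thesis .
    qed
    then show "(if dyad m < F x then ennreal (F x) else 0) \<le> ennreal (dyad m powr (1 - p)) * ennreal (F x powr p)"
      by (auto simp flip: ennreal_mult' intro!: ennreal_leI)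
  qed
  also have "\<dots> = ennreal (dyad m powr (1 - p)) * power_integral p F"
    by (rule nn_integral_cmult) simp
  finally show ?thesis .
qed

text \<open>The quotients \<open>X m / Y m\<close> tend to infinity as \<open>m\<close> decreases, since \<open>Y m\<close> tends to zero
  while \<open>X m\<close> stays away from zero, and to zero as \<open>m\<close> increases, since \<open>X m\<close> tends to zero.\<close>

lemma interp_le_of_truncations:
  fixes F :: "'v \<Rightarrow> real" and Y :: "int \<Rightarrow> real" and K :: "real \<Rightarrow> real"
  defines "X \<equiv> \<lambda>m. enn2real (upper_part F m)"
  assumes F: "\<And>x. 0 \<le> F x" "0 < F x\<^sub>0" and fin: "power_integral p F < \<infinity>"
    and Y: "mono Y" "\<And>m. 0 < Y m" "\<And>m. Y (m + 1) \<le> 2 * Y m" "\<And>m. Y m \<le> B * dyad m powr \<delta>" "0 < \<delta>"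
    and K: "\<And>t. 0 < t \<Longrightarrow> 0 \<le> K t" "\<And>t m. 0 < t \<Longrightarrow> K t \<le> C * (X m + t * Y m)"
    and \<theta>: "0 < \<theta>" "\<theta> < 1" and p: "1 < p" and C: "0 \<le> C"
  shows "interp_power \<theta> p K
    \<le> ennreal ((4 * C) powr p / ((1 - \<theta>) * p)) *
      dyadic_sum (\<lambda>m. ennreal (X m powr ((1 - \<theta>) * p) * Y m powr (\<theta> * p)))"
proof -
  define E where "E = enn2real (power_integral p F)"
  have E: "power_integral p F = ennreal E" "0 \<le> E" using fin by (simp_all add: E_def)
  have up: "upper_part F m \<le> ennreal (dyad m powr (1 - p) * E)" for m
    using upper_part_le[of F p m, OF F(1) p] E by (simp add: ennreal_mult')
  have X: "ennreal (X m) = upper_part F m" for m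
    unfolding X_def using up[of m] by (simp add: le_less_trans)
  have X0: "0 \<le> X m" for m by (simp add: X_def)
  have Xle: "X m \<le> E * dyad m powr (1 - p)" for m
    using up[of m] E(2) unfolding X[symmetric] by (simp add: mult.commute)
  have Xanti: "antimono X"
  proof (rule antimonoI)
    fix m n :: int assume "m \<le> n"
    then have mn: "dyad m \<le> dyad n" by simp
    have "upper_part F n \<le> upper_part F m"
      unfolding upper_part_def using le_less_trans[OF mn] by (intro nn_integral_mono) auto
    then show "X n \<le> X m" unfolding X[symmetric] using X0 by simp
  qed
  show ?thesis
  proof (rule interp_le_dyadic_sum[OF Xanti X0 Y(1-3) _ _ K \<theta> p C])
    fix t :: real assume t: "0 < t"
    define m0 where "m0 = \<lfloor>log 2 (F x\<^sub>0)\<rfloor> - 1"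
    have m0: "dyad m0 < F x\<^sub>0"
    proof -
      have "real_of_int m0 < log 2 (F x\<^sub>0)" unfolding m0_def by linarith
      then show ?thesis using F(2) by (simp add: less_log_iff)
    qed
    have "ennreal (w x\<^sub>0) * ennreal (F x\<^sub>0) \<le> upper_part F m0"
      using le_nn_integral_\<nu>[of x\<^sub>0 "\<lambda>x. if dyad m0 < F x then ennreal (F x) else 0"] m0
      by (simp add: upper_part_def)
    then have "w x\<^sub>0 * F x\<^sub>0 \<le> X m0"
      unfolding X[symmetric] using F X0 w_pos[of x\<^sub>0] by (simp flip: ennreal_mult)
    then have Xm0: "0 < X m0" using F(2) w_pos[of x\<^sub>0] by (smt (verit) mult_pos_pos)
    obtain n where n: "\<And>m. m \<le> - int n \<Longrightarrow> B * dyad m powr \<delta> < X m0 / t"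
      using dyad_powr_small[OF Y(5), of "X m0 / t" B] Xm0 t by auto
    define m where "m = min m0 (- int n)"
    have "Y m < X m0 / t" using Y(4)[of m] n[of m] by (simp add: m_def)
    also have "\<dots> \<le> X m / t" using antimonoD[OF Xanti, of m m0] t by (simp add: m_def divide_right_mono)
    finally have "t < X m / Y m" using Y(2)[of m] t by (simp add: field_simps)
    then show "\<exists>m. t < X m / Y m" by blast
  next
    fix t :: real assume t: "0 < t"
    obtain n where n: "\<And>m. m \<le> - int n \<Longrightarrow> E * dyad m powr (p - 1) < t * Y 0"
      using dyad_powr_small[of "p - 1" "t * Y 0" E] p t Y(2)[of 0] by auto
    have "X (int n) \<le> E * dyad (- int n) powr (p - 1)"
      using Xle[of "int n"] by (simp add: powr_powr algebra_simps)
    also have "\<dots> \<le> t * Y 0" using n[of "- int n"] by simp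
    also have "\<dots> \<le> t * Y (int n)" using monoD[OF Y(1), of 0 "int n"] t by simp
    finally have "X (int n) / Y (int n) \<le> t" using Y(2)[of "int n"] by (simp add: field_simps)
    then show "\<exists>m. X m / Y m \<le> t" by blast
  qed
qed

lemma interp_le_of_truncations_Linf:
  fixes F :: "'v \<Rightarrow> real" and K :: "real \<Rightarrow> real"
  assumes F: "\<And>x. 0 \<le> F x" "0 < F x\<^sub>0" and fin: "power_integral p F < \<infinity>"
    and K: "\<And>t. 0 < t \<Longrightarrow> 0 \<le> K t"
      "\<And>t m. 0 < t \<Longrightarrow> K t \<le> C * (enn2real (upper_part F m) + t * dyad m)"
    and \<theta>: "0 < \<theta>" "\<theta> < 1" "1 / p = 1 - \<theta>" and p: "1 < p" and C: "0 \<le> C"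
  shows "interp_power \<theta> p K
    \<le> ennreal ((4 * C) powr p / ((1 - \<theta>) * p)) *
      (ennreal (1 / (1 - 2 powr (1 - p))) * power_integral p F)"
proof -
  have e: "(1 - \<theta>) * p = 1" "\<theta> * p = p - 1" using \<theta>(3) p by (auto simp: field_simps)
  have "interp_power \<theta> p K
    \<le> ennreal ((4 * C) powr p / ((1 - \<theta>) * p)) *
      dyadic_sum (\<lambda>m. ennreal (enn2real (upper_part F m) powr ((1 - \<theta>) * p) * dyad m powr (\<theta> * p)))"
    by (rule interp_le_of_truncations[OF F fin _ _ _ _ _ K \<theta>(1,2) p C, where B = 1 and \<delta> = 1])
       (auto simp: mono_def powr_add)
  also have "dyadic_sum (\<lambda>m. ennreal (enn2real (upper_part F m) powr ((1 - \<theta>) * p) * dyad m powr (\<theta> * p)))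
     \<le> dyadic_sum (\<lambda>m. ennreal (dyad m powr (p - 1)) * upper_part F m)"
  proof (rule nn_integral_mono)
    fix m
    have "ennreal (enn2real (upper_part F m)) \<le> upper_part F m" by (simp add: ennreal_enn2real_if)
    then have "ennreal (dyad m powr (p - 1)) * ennreal (enn2real (upper_part F m))
       \<le> ennreal (dyad m powr (p - 1)) * upper_part F m" by (rule mult_left_mono) simp
    then show "ennreal (enn2real (upper_part F m) powr ((1 - \<theta>) * p) * dyad m powr (\<theta> * p))
       \<le> ennreal (dyad m powr (p - 1)) * upper_part F m"
      unfolding e by (simp add: mult.commute flip: ennreal_mult')
  qed
  also have "\<dots> \<le> ennreal (1 / (1 - 2 powr (1 - p))) * power_integral p F"
    unfolding upper_part_def using F p by (intro dyadic_sum_superlevel_le) auto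
  finally show ?thesis by (simp add: mult_left_mono)
qed

definition truncated_norm :: "real \<Rightarrow> ('v \<Rightarrow> real) \<Rightarrow> int \<Rightarrow> real" where
  "truncated_norm r F m = enn2real (power_integral r (\<lambda>x. min (F x) (dyad m))) powr (1 / r)"

lemma truncated_norm:
  assumes F: "\<And>x. 0 \<le> F x" and p: "0 < p" "p < r"
    and E: "power_integral p F = ennreal E" "0 \<le> E"
  shows "ennreal (truncated_norm r F m powr r) = (power_integral r (\<lambda>x. min (F x) (dyad m)))"
    "truncated_norm r F m \<le> E powr (1 / r) * dyad m powr ((r - p) / r)"
proof -
  let ?I = "power_integral r (\<lambda>x. min (F x) (dyad m))"
  have "?I \<le> (\<integral>\<^sup>+x. ennreal (dyad m powr (r - p)) * ennreal (F x powr p) \<partial>\<nu>)"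
  proof (rule nn_integral_mono)
    fix x
    have "min (F x) (dyad m) powr r = min (F x) (dyad m) powr (r - p) * min (F x) (dyad m) powr p"
      by (simp flip: powr_add)
    also have "\<dots> \<le> dyad m powr (r - p) * F x powr p"
      using F[of x] p by (intro mult_mono powr_mono2) auto
    finally show "ennreal (min (F x) (dyad m) powr r) \<le> ennreal (dyad m powr (r - p)) * ennreal (F x powr p)"
      by (auto simp flip: ennreal_mult' intro!: ennreal_leI)
  qed
  also have "\<dots> = ennreal (dyad m powr (r - p)) * ennreal E"
    unfolding E(1)[symmetric] by (rule nn_integral_cmult) simp
  also have "\<dots> = ennreal (E * dyad m powr (r - p))" using E(2) by (simp add: mult.commute flip: ennreal_mult)
  finally have le: "?I \<le> ennreal (E * dyad m powr (r - p))" .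
  then have fin: "?I < top" using ennreal_less_top le_less_trans by blast
  show "ennreal (truncated_norm r F m powr r) = ?I"
    using p fin by (simp add: truncated_norm_def powr_powr)
  have "enn2real ?I \<le> E * dyad m powr (r - p)"
    using enn2real_mono[OF le] E(2) by simp
  then have "truncated_norm r F m \<le> (E * dyad m powr (r - p)) powr (1 / r)"
    unfolding truncated_norm_def using p by (intro powr_mono2) auto
  also have "\<dots> = E powr (1 / r) * (dyad m powr (r - p)) powr (1 / r)"
    by (rule powr_mult)
  also have "(dyad m powr (r - p)) powr (1 / r) = dyad m powr ((r - p) / r)"
    by (simp add: powr_powr)
  finally show "truncated_norm r F m \<le> E powr (1 / r) * dyad m powr ((r - p) / r)" .
qed

text \<open>Both exponents in \<open>X m powr ((1 - \<theta>) * p) * Y m powr (\<theta> * p)\<close> become weights of total one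
  when the second is divided by \<open>r\<close>. The weighted arithmetic-geometric mean inequality then
  separates the sums of \<open>X m\<close> and of \<open>Y m powr r\<close>; the powers of \<open>dyad m\<close> inserted for
  convergence cancel.\<close>

lemma interp_le_of_truncations_Lr:
  fixes F :: "'v \<Rightarrow> real" and K :: "real \<Rightarrow> real"
  assumes F: "\<And>x. 0 \<le> F x" "0 < F x\<^sub>0" and fin: "power_integral p F < \<infinity>"
    and K: "\<And>t. 0 < t \<Longrightarrow> 0 \<le> K t"
      "\<And>t m. 0 < t \<Longrightarrow> K t \<le> C * (enn2real (upper_part F m) + t * truncated_norm r F m)"
    and \<theta>: "0 < \<theta>" "\<theta> < 1" "1 / p = 1 - \<theta> + \<theta> / r" and p: "1 < p" "p < r" and C: "0 \<le> C"
  shows "interp_power \<theta> p K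
    \<le> ennreal ((4 * C) powr p / ((1 - \<theta>) * p)) *
      (ennreal (1 / (1 - 2 powr (1 - p)) + (1 / (1 - 2 powr - p) + 1 / (1 - 2 powr (p - r)))) *
       power_integral p F)"
proof -
  let ?X = "\<lambda>m. enn2real (upper_part F m)" and ?Y = "truncated_norm r F"
  define E where "E = enn2real (power_integral p F)"
  have E: "power_integral p F = ennreal E" "0 \<le> E" using fin by (simp_all add: E_def)
  have p0: "0 < p" "0 < r" using p by auto
  note Y = truncated_norm[OF F(1) p0(1) p(2) E]
  define a where "a = (1 - \<theta>) * p"
  define b where "b = \<theta> * p / r"
  have ab: "0 \<le> a" "0 \<le> b" "a + b = 1" "0 < b" "a \<le> 1" "b \<le> 1"
  proof -
    show "0 \<le> a" "0 \<le> b" "0 < b" using \<theta> p by (auto simp: a_def b_def)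
    have "p * (1 / p) = p * (1 - \<theta> + \<theta> / r)" using \<theta>(3) by simp
    then show "a + b = 1" using p by (simp add: a_def b_def algebra_simps)
    then show "a \<le> 1" "b \<le> 1" using \<open>0 \<le> a\<close> \<open>0 \<le> b\<close> by auto
  qed
  have Yr: "ennreal (?Y m powr r) \<le> ennreal (?Y n powr r) \<Longrightarrow> ?Y m \<le> ?Y n" for m n
    using p0 powr_mono2[of "1 / r" "?Y m powr r" "?Y n powr r"] by (simp add: powr_powr truncated_norm_def)
  have "interp_power \<theta> p K
    \<le> ennreal ((4 * C) powr p / ((1 - \<theta>) * p)) *
      dyadic_sum (\<lambda>m. ennreal (?X m powr ((1 - \<theta>) * p) * ?Y m powr (\<theta> * p)))"
  proof (rule interp_le_of_truncations[OF F fin _ _ _ _ _ K \<theta>(1,2) p(1) C])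
    show "mono ?Y"
    proof (rule monoI)
      fix m n :: int assume "m \<le> n"
      then have "min (F x) (dyad m) \<le> min (F x) (dyad n)" for x by (intro min.mono) auto
      then show "?Y m \<le> ?Y n" using F(1) p0
        by (intro Yr) (auto simp: Y(1) intro!: nn_integral_mono ennreal_leI powr_mono2)
    qed
    show "0 < ?Y m" for m
    proof -
      have "0 < ennreal (w x\<^sub>0) * ennreal (min (F x\<^sub>0) (dyad m) powr r)"
      proof -
        have "min (F x\<^sub>0) (dyad m) \<noteq> 0" using F(2) powr_gt_zero[of 2 m] unfolding min_def by auto
        then show ?thesis using w_pos by (simp add: ennreal_zero_less_mult_iff)
      qed
      also have "\<dots> \<le> ennreal (?Y m powr r)" unfolding Y(1) by (rule le_nn_integral_\<nu>)
      finally show ?thesis by (auto simp: truncated_norm_def less_le)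
    qed
    show "?Y (m + 1) \<le> 2 * ?Y m" for m
    proof -
      have "ennreal (?Y (m + 1) powr r) \<le> (\<integral>\<^sup>+x. ennreal (2 powr r) * ennreal (min (F x) (dyad m) powr r) \<partial>\<nu>)"
        unfolding Y(1)
      proof (rule nn_integral_mono)
        fix x
        have "min (F x) (dyad (m + 1)) \<le> 2 * min (F x) (dyad m)"
          using F(1)[of x] by (auto simp: min_def powr_add)
        then have "min (F x) (dyad (m + 1)) powr r \<le> (2 * min (F x) (dyad m)) powr r"
          using F(1)[of x] p0 by (intro powr_mono2) auto
        also have "\<dots> = 2 powr r * min (F x) (dyad m) powr r" by (rule powr_mult)
        finally show "ennreal (min (F x) (dyad (m + 1)) powr r) \<le> ennreal (2 powr r) * ennreal (min (F x) (dyad m) powr r)"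
          by (auto simp flip: ennreal_mult' intro!: ennreal_leI)
      qed
      also have "\<dots> = ennreal (2 powr r) * ennreal (?Y m powr r)"
        unfolding Y(1) by (rule nn_integral_cmult) simp
      also have "\<dots> = ennreal ((2 * ?Y m) powr r)"
        by (simp add: powr_mult truncated_norm_def flip: ennreal_mult')
      finally have "?Y (m + 1) powr r \<le> (2 * ?Y m) powr r" by simp
      then have "(?Y (m + 1) powr r) powr (1 / r) \<le> ((2 * ?Y m) powr r) powr (1 / r)"
        using p0 by (intro powr_mono2[where a = "1 / r"]) auto
      then show ?thesis using p0 by (simp add: powr_powr truncated_norm_def)
    qed
    show "?Y m \<le> E powr (1 / r) * dyad m powr ((r - p) / r)" for m by (rule Y(2))
    show "0 < (r - p) / r" using p p0 by simp
  qed
  also have "dyadic_sum (\<lambda>m. ennreal (?X m powr ((1 - \<theta>) * p) * ?Y m powr (\<theta> * p)))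
     \<le> dyadic_sum (\<lambda>m. ennreal (dyad m powr (p - 1)) * upper_part F m
       + ennreal (dyad m powr (p - r)) * (power_integral r (\<lambda>x. min (F x) (dyad m))))"
  proof (rule nn_integral_mono)
    fix m
    let ?U = "dyad m powr (p - 1) * ?X m" and ?V = "dyad m powr (p - r) * ?Y m powr r"
    have UV: "0 \<le> ?U" "0 \<le> ?V" by simp_all
    have eq: "?X m powr ((1 - \<theta>) * p) * ?Y m powr (\<theta> * p) = ?U powr a * ?V powr b"
    proof -
      have "(p - 1) * a + (p - r) * b = p * (a + b) - a - r * b" by (simp add: algebra_simps)
      also have "\<dots> = 0" using ab(3) p0 by (simp add: a_def b_def algebra_simps)
      finally have "(dyad m powr (p - 1)) powr a * (dyad m powr (p - r)) powr b = 1"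
        by (simp only: powr_powr[of "dyad m"] powr_add[symmetric]) simp
      moreover have "(?Y m powr r) powr b = ?Y m powr (\<theta> * p)"
        using p0 by (simp add: powr_powr b_def)
      moreover have "?U powr a * ?V powr b = ((dyad m powr (p - 1)) powr a * (dyad m powr (p - r)) powr b)
          * (?X m powr a * (?Y m powr r) powr b)"
        by (simp only: powr_mult mult_ac)
      ultimately show ?thesis unfolding a_def[symmetric] by simp
    qed
    have "?U powr a * ?V powr b \<le> ?U + ?V"
    proof (cases "?U = 0 \<or> ?V = 0")
      case False
      then have "?U powr a * ?V powr b \<le> a * ?U + b * ?V"
        using ab UV by (intro Youngs_inequality_0) (auto simp: less_le)
      also have "\<dots> \<le> ?U + ?V" using ab UV by (intro add_mono mult_left_le_one_le) auto
      finally show ?thesis .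
    qed (use UV in auto)
    then have "ennreal (?X m powr ((1 - \<theta>) * p) * ?Y m powr (\<theta> * p)) \<le> ennreal (?U + ?V)"
      unfolding eq by (rule ennreal_leI)
    also have "\<dots> = ennreal ?U + ennreal ?V" using UV by (rule ennreal_plus)
    also have "\<dots> \<le> ennreal (dyad m powr (p - 1)) * upper_part F m
       + ennreal (dyad m powr (p - r)) * (power_integral r (\<lambda>x. min (F x) (dyad m)))"
    proof (rule add_mono)
      have "ennreal (?X m) \<le> upper_part F m" by (simp add: ennreal_enn2real_if)
      then show "ennreal ?U \<le> ennreal (dyad m powr (p - 1)) * upper_part F m"
        by (simp add: ennreal_mult' mult_left_mono)
      show "ennreal ?V \<le> ennreal (dyad m powr (p - r)) * (power_integral r (\<lambda>x. min (F x) (dyad m)))"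
        unfolding Y(1)[symmetric] by (simp add: ennreal_mult')
    qed
    finally show "ennreal (?X m powr ((1 - \<theta>) * p) * ?Y m powr (\<theta> * p)) \<le>
      ennreal (dyad m powr (p - 1)) * upper_part F m
       + ennreal (dyad m powr (p - r)) * (power_integral r (\<lambda>x. min (F x) (dyad m)))" .
  qed
  also have "\<dots> = dyadic_sum (\<lambda>m. ennreal (dyad m powr (p - 1)) * upper_part F m)
       + dyadic_sum (\<lambda>m. ennreal (dyad m powr (p - r)) * (power_integral r (\<lambda>x. min (F x) (dyad m))))"
    by (rule nn_integral_add) auto
  also have "\<dots> \<le> ennreal (1 / (1 - 2 powr (1 - p))) * power_integral p F
     + ennreal (1 / (1 - 2 powr - p) + 1 / (1 - 2 powr (p - r))) * power_integral p F"
    unfolding upper_part_def using F p p0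
    by (intro add_mono dyadic_sum_superlevel_le dyadic_sum_truncation_le) auto
  also have "\<dots> = (ennreal (1 / (1 - 2 powr (1 - p)) + (1 / (1 - 2 powr - p) + 1 / (1 - 2 powr (p - r)))) *
       power_integral p F)"
    using p by (subst ennreal_plus[of "1 / (1 - 2 powr (1 - p))"])
      (auto simp: distrib_right less_imp_le powr_less_one)
  finally show ?thesis by (simp add: mult_left_mono)
qed

text \<open>The size at height \<open>dyad m\<close> of a good part, in the endpoint space with exponent \<open>p\<^sub>1\<close>,
  when \<open>F\<close> is the maximal function. At the endpoint \<open>\<infinity>\<close> the height itself is a sufficient
  bound.\<close>

definition truncation :: "ereal \<Rightarrow> ('v \<Rightarrow> real) \<Rightarrow> int \<Rightarrow> real" where
  "truncation p\<^sub>1 F m = (if p\<^sub>1 = \<infinity> then dyad m else truncated_norm (real_of_ereal p\<^sub>1) F m)"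

lemma interp_le_Lp:
  fixes p \<theta> :: real and p\<^sub>1 :: ereal
  assumes p: "1 < p" "ereal p < p\<^sub>1"
    and \<theta>: "0 < \<theta>" "\<theta> < 1" "ereal (1 / p) = 1 - ereal \<theta> + ereal \<theta> / p\<^sub>1" and C: "0 \<le> C"
  obtains C1 where "0 < C1"
    "\<And>F x\<^sub>0 K. \<lbrakk>\<And>x. 0 \<le> F x; 0 < F x\<^sub>0; power_integral p F < \<infinity>;
       \<And>t. 0 < t \<Longrightarrow> 0 \<le> K t;
       \<And>t m. 0 < t \<Longrightarrow> K t \<le> C * (enn2real (upper_part F m) + t * truncation p\<^sub>1 F m)\<rbrakk> \<Longrightarrow>
      interp_power \<theta> p K
        \<le> ennreal ((4 * C) powr p / ((1 - \<theta>) * p)) * (ennreal C1 * power_integral p F)"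
proof (cases p\<^sub>1)
  case PInf
  have e: "1 / p = 1 - \<theta>" using \<theta>(3) PInf by (simp add: one_ereal_def)
  show thesis
  proof (rule that)
    show "0 < 1 / (1 - 2 powr (1 - p))" using p by (simp add: powr_less_one)
  next
    fix F :: "'v \<Rightarrow> real" and x\<^sub>0 and K :: "real \<Rightarrow> real"
    assume F: "\<And>x. 0 \<le> F x" "0 < F x\<^sub>0" "power_integral p F < \<infinity>"
      and K: "\<And>t. 0 < t \<Longrightarrow> 0 \<le> K t"
        "\<And>t m. 0 < t \<Longrightarrow> K t \<le> C * (enn2real (upper_part F m) + t * truncation p\<^sub>1 F m)"
    have K': "K t \<le> C * (enn2real (upper_part F m) + t * dyad m)" if "0 < t" for t m
      using K(2)[OF that, of m] PInf by (simp add: truncation_def)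
    show "interp_power \<theta> p K
        \<le> ennreal ((4 * C) powr p / ((1 - \<theta>) * p)) *
          (ennreal (1 / (1 - 2 powr (1 - p))) * power_integral p F)"
      by (rule interp_le_of_truncations_Linf[OF F K(1) K' \<theta>(1,2) e p(1) C])
  qed
next
  case (real r)
  have r: "p < r" using p real by simp
  have e: "1 / p = 1 - \<theta> + \<theta> / r" using \<theta>(3) real p by (simp add: one_ereal_def)
  let ?C = "1 / (1 - 2 powr (1 - p)) + (1 / (1 - 2 powr - p) + 1 / (1 - 2 powr (p - r)))"
  show thesis
  proof (rule that)
    show "0 < ?C" using p r by (intro add_pos_pos) (auto simp: powr_less_one)
  next
    fix F :: "'v \<Rightarrow> real" and x\<^sub>0 and K :: "real \<Rightarrow> real"
    assume F: "\<And>x. 0 \<le> F x" "0 < F x\<^sub>0" "power_integral p F < \<infinity>"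
      and K: "\<And>t. 0 < t \<Longrightarrow> 0 \<le> K t"
        "\<And>t m. 0 < t \<Longrightarrow> K t \<le> C * (enn2real (upper_part F m) + t * truncation p\<^sub>1 F m)"
    have K': "K t \<le> C * (enn2real (upper_part F m) + t * truncated_norm r F m)" if "0 < t" for t m
      using K(2)[OF that, of m] real by (simp add: truncation_def)
    show "interp_power \<theta> p K
        \<le> ennreal ((4 * C) powr p / ((1 - \<theta>) * p)) * (ennreal ?C * power_integral p F)"
      by (rule interp_le_of_truncations_Lr[OF F K(1) K' \<theta>(1,2) e p(1) r C])
  qed
qed (use p in auto)

lemma markov_inequality:
  assumes "0 < c" "0 < r"
  shows "emeasure \<nu> {x. c < norm (h x)}
    \<le> ennreal (c powr - r) * norm_power_integral r h"
proof -
  have "emeasure \<nu> {x. c < norm (h x)} = (\<integral>\<^sup>+x. indicator {x. c < norm (h x)} x \<partial>\<nu>)" by simp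
  also have "\<dots> \<le> (\<integral>\<^sup>+x. ennreal (c powr - r) * ennreal (norm (h x) powr r) \<partial>\<nu>)"
  proof (rule nn_integral_mono)
    fix x
    have "1 \<le> c powr - r * norm (h x) powr r" if "c < norm (h x)"
    proof -
      have "c powr r \<le> norm (h x) powr r" using that assms by (intro powr_mono2) auto
      then show ?thesis using assms by (simp add: powr_minus field_simps)
    qed
    then have "ennreal 1 \<le> ennreal (c powr - r * norm (h x) powr r)" if "c < norm (h x)"
      using that by (intro ennreal_leI) auto
    then show "indicator {x. c < norm (h x)} x \<le> ennreal (c powr - r) * ennreal (norm (h x) powr r)"
      by (auto simp: indicator_def ennreal_mult')
  qed
  also have "\<dots> = ennreal (c powr - r) * norm_power_integral r h"
    by (rule nn_integral_cmult) simp
  finally show ?thesis .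
qed

text \<open>The sets on which \<open>norm (f x)\<close> exceeds the threshold \<open>l j\<close> have measure tending to zero as
  \<open>j\<close> decreases, so no single point belongs to all of them, while \<open>l j\<close> tends to zero as \<open>j\<close>
  increases. Every point of the support thus lies in the set of index \<open>j + 1\<close> but not in that of
  index \<open>j\<close> for some \<open>j\<close>, where \<open>norm (f x)\<close> is at most \<open>l j\<close>.\<close>

lemma Lp_le_of_superlevels:
  fixes f :: "'v \<Rightarrow> complex" and k :: "int \<Rightarrow> real" and \<sigma> :: real
  defines "l \<equiv> \<lambda>j. 4 * k j * dyad j powr - \<sigma>"
  assumes k: "\<And>j. 0 \<le> k j"
    and level: "\<And>j. emeasure \<nu> {x. l j < norm (f x)} \<le> ennreal (2 * dyad j powr \<sigma>)"
    and p: "1 < p" and \<theta>: "0 < \<theta>" "\<theta> < \<sigma>" "\<sigma> * (p - 1) = \<theta> * p"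
  shows "norm_power_integral p f
    \<le> ennreal (2 * 4 powr p * 2 powr \<sigma>) * dyadic_sum (\<lambda>j. ennreal ((dyad j powr - \<theta> * k j) powr p))"
    (is "_ \<le> ?C * ?S")
proof (cases "?S = \<infinity>")
  case True
  then show ?thesis by (simp add: ennreal_mult_top)
next
  case False
  define s where "s = enn2real ?S"
  have s: "?S = ennreal s" "0 \<le> s" using False by (simp_all add: s_def less_top)
  let ?A = "\<lambda>j. {x. l j < norm (f x)}"
  have l0: "0 \<le> l j" for j using k by (simp add: l_def)
  have kle: "k j \<le> s powr (1 / p) * dyad j powr \<theta>" for j
  proof -
    have "ennreal ((dyad j powr - \<theta> * k j) powr p)
       = (\<integral>\<^sup>+i. ennreal ((dyad i powr - \<theta> * k i) powr p) * indicator {j} i \<partial>count_space UNIV)"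
      by simp
    also have "\<dots> \<le> ?S" by (intro nn_integral_mono) (auto simp: indicator_def)
    finally have "(dyad j powr - \<theta> * k j) powr p \<le> s" using s by simp
    then have "((dyad j powr - \<theta> * k j) powr p) powr (1 / p) \<le> s powr (1 / p)"
      using p by (intro powr_mono2) auto
    then have "dyad j powr - \<theta> * k j \<le> s powr (1 / p)" using p k[of j] by (simp add: powr_powr)
    then show ?thesis by (simp add: powr_minus field_simps)
  qed
  have pt: "ennreal (norm (f x) powr p) \<le> dyadic_sum (\<lambda>j. ennreal (l j powr p) * indicator (?A (j + 1)) x)" for x
  proof (cases "f x = 0")
    case False
    obtain n where n: "2 * dyad (- int n) powr \<sigma> < w x"
      using dyad_powr_small[of \<sigma> "w x" 2] \<theta> w_pos[of x] by force
    have "x \<notin> ?A (- int n)"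
    proof
      assume x: "x \<in> ?A (- int n)"
      have "ennreal (w x) = ennreal (w x) * indicator (?A (- int n)) x" using x by simp
      also have "\<dots> \<le> emeasure \<nu> (?A (- int n))"
        using le_nn_integral_\<nu>[of x "indicator (?A (- int n))"] by simp
      also have "\<dots> \<le> ennreal (2 * dyad (- int n) powr \<sigma>)" by (rule level)
      finally show False using n by (subst (asm) ennreal_le_iff) auto
    qed
    obtain n' where n': "\<And>m. m \<le> - int n' \<Longrightarrow> 4 * s powr (1 / p) * dyad m powr (\<sigma> - \<theta>) < norm (f x)"
      using dyad_powr_small[of "\<sigma> - \<theta>" "norm (f x)" "4 * s powr (1 / p)"] \<theta> False by auto
    have "l (int n') \<le> 4 * (s powr (1 / p) * dyad (int n') powr \<theta>) * dyad (int n') powr - \<sigma>"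
      unfolding l_def by (intro mult_right_mono mult_left_mono kle) auto
    also have "\<dots> = 4 * s powr (1 / p) * (dyad (int n') powr \<theta> * dyad (int n') powr - \<sigma>)" by simp
    also have "dyad (int n') powr \<theta> * dyad (int n') powr - \<sigma> = dyad (- int n') powr (\<sigma> - \<theta>)"
      by (simp only: powr_powr powr_add[symmetric]) (simp add: algebra_simps)
    also have "4 * s powr (1 / p) * dyad (- int n') powr (\<sigma> - \<theta>) < norm (f x)" by (rule n') simp
    finally have "x \<in> ?A (int n')" by simp
    moreover have "- int n \<le> int n'" by simp
    ultimately obtain j where j: "x \<notin> ?A j" "x \<in> ?A (j + 1)"
      using int_crossing[of "\<lambda>m. x \<notin> ?A m" "- int n" "int n'"] \<open>x \<notin> ?A (- int n)\<close> by blast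
    have "ennreal (norm (f x) powr p) \<le> ennreal (l j powr p) * indicator (?A (j + 1)) x"
      using j p by (auto intro!: ennreal_leI powr_mono2)
    also have "\<dots> = (\<integral>\<^sup>+i. ennreal (l i powr p) * indicator (?A (i + 1)) x * indicator {j} i \<partial>count_space UNIV)"
      by simp
    also have "\<dots> \<le> dyadic_sum (\<lambda>j. ennreal (l j powr p) * indicator (?A (j + 1)) x)"
      by (intro nn_integral_mono) (auto simp: indicator_def)
    finally show ?thesis .
  qed simp
  have "norm_power_integral p f
     \<le> (\<integral>\<^sup>+x. dyadic_sum (\<lambda>j. ennreal (l j powr p) * indicator (?A (j + 1)) x) \<partial>\<nu>)"
    by (rule nn_integral_mono) (rule pt)
  also have "\<dots> = dyadic_sum (\<lambda>j. ennreal (l j powr p) * emeasure \<nu> (?A (j + 1)))"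
    by (subst dyadic_sum_swap[symmetric]) (auto simp: nn_integral_cmult_indicator)
  also have "\<dots> \<le> dyadic_sum (\<lambda>j. ?C * ennreal ((dyad j powr - \<theta> * k j) powr p))"
  proof (rule nn_integral_mono)
    fix j
    have "ennreal (l j powr p) * emeasure \<nu> (?A (j + 1)) \<le> ennreal (l j powr p) * ennreal (2 * dyad (j + 1) powr \<sigma>)"
      by (intro mult_left_mono level) simp
    also have "\<dots> = ennreal (l j powr p * (2 * dyad (j + 1) powr \<sigma>))" by (simp add: ennreal_mult')
    also have "l j powr p * (2 * dyad (j + 1) powr \<sigma>) = 2 * 4 powr p * 2 powr \<sigma> * (dyad j powr - \<theta> * k j) powr p"
    proof -
      have e1: "l j powr p = 4 powr p * k j powr p * (dyad j powr - \<sigma>) powr p"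
        unfolding l_def using k by (simp add: powr_mult)
      have e2: "dyad (j + 1) powr \<sigma> = 2 powr \<sigma> * dyad j powr \<sigma>"
        by (simp only: of_int_add powr_add powr_mult) simp
      have e3: "(dyad j powr - \<sigma>) powr p * dyad j powr \<sigma> = (dyad j powr - \<theta>) powr p"
      proof -
        have "- \<sigma> * p + \<sigma> = - \<theta> * p" using \<theta>(3) by (simp add: algebra_simps)
        then show ?thesis by (simp only: powr_powr[of "dyad j"] powr_add[symmetric])
      qed
      have e4: "(dyad j powr - \<theta> * k j) powr p = (dyad j powr - \<theta>) powr p * k j powr p"
        by (rule powr_mult)
      show ?thesis unfolding e1 e2 e4 e3[symmetric] by (simp only: mult_ac)
    qed
    finally show "ennreal (l j powr p) * emeasure \<nu> (?A (j + 1)) \<le> ?C * ennreal ((dyad j powr - \<theta> * k j) powr p)"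
      by (simp add: ennreal_mult')
  qed
  also have "\<dots> = ?C * ?S" by (rule nn_integral_cmult) simp
  finally show ?thesis .
qed

end

section \<open>The \<open>K\<close>-functional\<close>

definition nonneg_norm :: "'a nspace \<Rightarrow> bool" where
  "nonneg_norm A \<longleftrightarrow> (\<forall>a\<in>fst A. 0 \<le> snd A a)"

lemma K_functional_le:
  assumes "nonneg_norm A0" "nonneg_norm A1" "0 \<le> t" "a0 \<in> fst A0" "a1 \<in> fst A1" "a = a0 + a1"
  shows "K_functional A0 A1 t a \<le> snd A0 a0 + t * snd A1 a1"
  unfolding K_functional_def
  using assms by (intro cInf_lower) (auto simp: nonneg_norm_def intro!: bdd_belowI[of _ 0])

lemma K_functional_ge:
  assumes "a0 \<in> fst A0" "a1 \<in> fst A1" "a = a0 + a1"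
    and "\<And>a0 a1. \<lbrakk>a0 \<in> fst A0; a1 \<in> fst A1; a = a0 + a1\<rbrakk> \<Longrightarrow> B \<le> snd A0 a0 + t * snd A1 a1"
  shows "B \<le> K_functional A0 A1 t a"
  unfolding K_functional_def using assms by (intro cInf_greatest) auto

lemma K_functional_lessD:
  assumes "a0 \<in> fst A0" "a1 \<in> fst A1" "a = a0 + a1" "K_functional A0 A1 t a < B"
  obtains b0 b1 where "b0 \<in> fst A0" "b1 \<in> fst A1" "a = b0 + b1" "snd A0 b0 + t * snd A1 b1 < B"
proof -
  let ?S = "{snd A0 a0 + t * snd A1 a1 | a0 a1. a0 \<in> fst A0 \<and> a1 \<in> fst A1 \<and> a = a0 + a1}"
  have "?S \<noteq> {}" using assms by blast
  then obtain v where "v \<in> ?S" "v < B"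
    using cInf_lessD[of ?S B] assms(4) unfolding K_functional_def by blast
  then show thesis using that by blast
qed

section \<open>Interpolation between the Hardy space and a Lebesgue space\<close>

context weighted_tree
begin

abbreviation H1_nspace :: "('v \<Rightarrow> complex) nspace" where
  "H1_nspace \<equiv> (H1, H1_norm)"

abbreviation Lp_nspace :: "ereal \<Rightarrow> ('v \<Rightarrow> complex) nspace" where
  "Lp_nspace p\<^sub>1 \<equiv> (Lp_space \<nu> p\<^sub>1, Lp_norm \<nu> p\<^sub>1)"

lemma Lp_norm_nonneg: "f \<in> Lp_space \<nu> p\<^sub>1 \<Longrightarrow> 0 \<le> Lp_norm \<nu> p\<^sub>1 f"
  using Linf_norm(3) by (cases "p\<^sub>1 = \<infinity>") (auto simp: Lp_norm_def)

lemma nonneg_norms: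
  "nonneg_norm H1_nspace" "nonneg_norm (Lp_nspace p\<^sub>1)"
  using H1_norm_nonneg Lp_norm_nonneg by (auto simp: nonneg_norm_def)

lemma D_pos: "0 < D"
  using q_pos by simp

text \<open>Splitting \<open>f\<close> at height \<open>dyad m\<close> into \<open>f - good f\<close> and \<open>good f\<close> controls the two terms of
  the \<open>K\<close>-functional by \<open>upper_part\<close> and by \<open>truncation\<close> of the maximal function.\<close>

lemma bad_part_norm_le:
  assumes van: "vanishing f" and fin: "upper_part (maximal f) m < \<infinity>"
  shows "(\<lambda>x. f x - good f (dyad m) x) \<in> H1"
    "H1_norm (\<lambda>x. f x - good f (dyad m) x) \<le> 42 * D * enn2real (upper_part (maximal f) m)"
proof -
  have l: "0 < dyad m" by simp
  note bad = bad_part_in_H1[OF van l fin[unfolded upper_part_def], folded upper_part_def]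
  show "(\<lambda>x. f x - good f (dyad m) x) \<in> H1" by (rule bad(1))
  have "ennreal (H1_norm (\<lambda>x. f x - good f (dyad m) x)) \<le> ennreal (42 * D * enn2real (upper_part (maximal f) m))"
    using bad(2) fin D_pos by (subst ennreal_mult') auto
  then show "H1_norm (\<lambda>x. f x - good f (dyad m) x) \<le> 42 * D * enn2real (upper_part (maximal f) m)"
    by (subst (asm) ennreal_le_iff) auto
qed

lemma good_Linf:
  assumes van: "vanishing f"
  shows "good f (dyad m) \<in> Lp_space \<nu> \<infinity>" "Lp_norm \<nu> \<infinity> (good f (dyad m)) \<le> D * dyad m"
proof -
  have b: "norm (good f (dyad m) x) \<le> D * dyad m" for x
    by (rule order_trans[OF norm_good_le[OF van] mult_left_mono[OF min.cobounded2]]) simp_all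
  then show L: "good f (dyad m) \<in> Lp_space \<nu> \<infinity>" unfolding mem_Linf_iff by blast
  show "Lp_norm \<nu> \<infinity> (good f (dyad m)) \<le> D * dyad m" by (rule Linf_norm(2)[OF L b])
qed

lemma good_Lr:
  assumes van: "vanishing f" and p: "1 < p" "p < r"
    and fin: "power_integral p (maximal f) < \<infinity>"
  shows "good f (dyad m) \<in> Lp_space \<nu> (ereal r)"
    "Lp_norm \<nu> (ereal r) (good f (dyad m)) \<le> D * truncated_norm r (maximal f) m"
proof -
  define E where "E = enn2real (power_integral p (maximal f))"
  have E: "power_integral p (maximal f) = ennreal E" "0 \<le> E"
    using fin by (simp_all add: E_def)
  have r0: "0 < p" "0 < r" using p by auto
  have Y: "ennreal (truncated_norm r (maximal f) m powr r) = (\<integral>\<^sup>+x. ennreal (min (maximal f x) (dyad m) powr r) \<partial>\<nu>)"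
    by (rule truncated_norm(1)[OF maximal_nonneg[OF van] r0(1) p(2) E])
  have "(\<integral>\<^sup>+x. ennreal (norm (good f (dyad m) x) powr r) \<partial>\<nu>)
     \<le> (\<integral>\<^sup>+x. ennreal (D powr r) * ennreal (min (maximal f x) (dyad m) powr r) \<partial>\<nu>)"
  proof (rule nn_integral_mono)
    fix x
    have "norm (good f (dyad m) x) powr r \<le> (D * min (maximal f x) (dyad m)) powr r"
      using r0 norm_good_le[OF van, of "dyad m" x] by (intro powr_mono2) auto
    also have "\<dots> = D powr r * min (maximal f x) (dyad m) powr r" by (rule powr_mult)
    finally show "ennreal (norm (good f (dyad m) x) powr r)
      \<le> ennreal (D powr r) * ennreal (min (maximal f x) (dyad m) powr r)"
      by (subst ennreal_mult'[symmetric]) (auto intro: ennreal_leI)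
  qed
  also have "\<dots> = ennreal (D powr r) * ennreal (truncated_norm r (maximal f) m powr r)"
    unfolding Y by (rule nn_integral_cmult) simp
  also have "\<dots> = ennreal ((D * truncated_norm r (maximal f) m) powr r)"
    by (subst powr_mult) (simp add: ennreal_mult')
  finally have le: "(\<integral>\<^sup>+x. ennreal (norm (good f (dyad m) x) powr r) \<partial>\<nu>)
     \<le> ennreal ((D * truncated_norm r (maximal f) m) powr r)" .
  have "0 \<le> D * truncated_norm r (maximal f) m" by (simp add: truncated_norm_def)
  from Lp_norm_le[OF r0(2) this le]
  show "good f (dyad m) \<in> Lp_space \<nu> (ereal r)"
    "Lp_norm \<nu> (ereal r) (good f (dyad m)) \<le> D * truncated_norm r (maximal f) m" by auto
qed

lemma K_functional_zero:
  assumes "0 < t" "p\<^sub>1 = \<infinity> \<or> (\<exists>r>0. p\<^sub>1 = ereal r)"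
  shows "K_functional H1_nspace (Lp_nspace p\<^sub>1) t 0 = 0"
proof (rule antisym)
  have H: "(\<lambda>x. 0) \<in> H1" "H1_norm (\<lambda>x. 0) \<le> 0"
    using H1_if_pointwise_decomposition[of "\<lambda>_ _. 0" "\<lambda>_. 0" "\<lambda>_. 0"] atom_zero by auto
  have L: "(\<lambda>x. 0) \<in> Lp_space \<nu> p\<^sub>1 \<and> Lp_norm \<nu> p\<^sub>1 (\<lambda>x. 0) \<le> 0"
  proof (cases "p\<^sub>1 = \<infinity>")
    case True
    have "(\<lambda>x. 0) \<in> Lp_space \<nu> \<infinity>" by (auto simp: mem_Linf_iff)
    then show ?thesis using True Linf_norm(2)[of "\<lambda>x. 0" 0] by simp
  next
    case False
    then obtain r where "0 < r" "p\<^sub>1 = ereal r" using assms by auto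
    then show ?thesis using Lp_norm_le[of r 0 "\<lambda>x. 0"] by simp
  qed
  have "K_functional H1_nspace (Lp_nspace p\<^sub>1) t 0
     \<le> H1_norm (\<lambda>x. 0) + t * Lp_norm \<nu> p\<^sub>1 (\<lambda>x. 0)"
    using K_functional_le[OF nonneg_norms(1) nonneg_norms(2)[of p\<^sub>1], of t "\<lambda>x. 0" "\<lambda>x. 0" 0] H L assms
    by (simp add: fun_eq_iff)
  also have "\<dots> \<le> 0" using H L assms by (simp add: add_nonpos_nonpos mult_nonneg_nonpos)
  finally show "K_functional H1_nspace (Lp_nspace p\<^sub>1) t 0 \<le> 0" .
  show "0 \<le> K_functional H1_nspace (Lp_nspace p\<^sub>1) t 0"
    by (rule K_functional_ge[of "\<lambda>x. 0" _ "\<lambda>x. 0"])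
       (use H L assms nonneg_norms in \<open>auto simp: nonneg_norm_def fun_eq_iff\<close>)
qed

text \<open>The \<open>K\<close>-functional of \<open>f\<close> is bounded by truncations of the maximal function, whose norm in
  \<open>L\<^sup>p\<close> is bounded by that of \<open>f\<close>.\<close>

lemma interp_integral_le_Lp:
  fixes p \<theta> :: real and p\<^sub>1 :: ereal
  assumes p: "1 < p" "ereal p < p\<^sub>1"
    and \<theta>: "0 < \<theta>" "\<theta> < 1" "ereal (1 / p) = 1 - ereal \<theta> + ereal \<theta> / p\<^sub>1"
  shows "\<exists>C>0. \<forall>f\<in>Lp_space \<nu> p.
    (\<exists>a0\<in>H1. \<exists>a1\<in>Lp_space \<nu> p\<^sub>1. f = a0 + a1) \<and>
    interp_integral H1_nspace (Lp_nspace p\<^sub>1) \<theta> p f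
      \<le> ennreal C * norm_power_integral p f"
proof -
  let ?K = "K_functional H1_nspace (Lp_nspace p\<^sub>1)"
  let ?M = "4 powr p / (1 - 2 powr (1 - p))"
  let ?C0 = "(4 * (42 * D)) powr p / ((1 - \<theta>) * p)"
  have lt1: "2 powr - p < 1" "2 powr (1 - p) < 1" using p by (auto simp: powr_less_one)
  have M: "0 < ?M" using lt1 by simp
  have C0: "0 < ?C0" using p \<theta> D_pos by simp
  have D42: "0 \<le> 42 * D" by simp
  have p1: "p\<^sub>1 = \<infinity> \<or> (\<exists>r>0. p\<^sub>1 = ereal r)" using p by (cases p\<^sub>1) auto
  show ?thesis
  proof (rule interp_le_Lp[OF p \<theta> D42])
    fix C1 assume C1: "0 < C1" and bound: "\<And>F x\<^sub>0 K. \<lbrakk>\<And>x. 0 \<le> F x; 0 < F x\<^sub>0;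
        power_integral p F < \<infinity>; \<And>t. 0 < t \<Longrightarrow> 0 \<le> K t;
        \<And>t m. 0 < t \<Longrightarrow> K t \<le> 42 * D * (enn2real (upper_part F m) + t * truncation p\<^sub>1 F m)\<rbrakk> \<Longrightarrow>
        interp_power \<theta> p K
          \<le> ennreal ?C0 * (ennreal C1 * power_integral p F)"
    show ?thesis
    proof (intro exI[of _ "?C0 * (C1 * ?M)"] conjI ballI)
      show "0 < ?C0 * (C1 * ?M)" using C0 C1 M by (intro mult_pos_pos)
      fix f assume "f \<in> Lp_space \<nu> (ereal p)"
      then have ffin: "norm_power_integral p f < \<infinity>" by (simp add: mem_Lp_iff)
      have van: "vanishing f" by (rule vanishing_if_Lp[OF p(1) ffin])
      note strong = strong_type[OF van p(1)]
      have Ffin: "power_integral p (maximal f) < \<infinity>"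
        by (rule le_less_trans[OF strong]) (use ffin in \<open>simp add: ennreal_mult_less_top\<close>)
      have up: "upper_part (maximal f) m < \<infinity>" for m
        by (rule le_less_trans[OF upper_part_le[of "maximal f" p m, OF maximal_nonneg[OF van] p(1)]])
           (use Ffin in \<open>auto simp: ennreal_mult_less_top\<close>)
      have good: "good f (dyad m) \<in> Lp_space \<nu> p\<^sub>1 \<and> Lp_norm \<nu> p\<^sub>1 (good f (dyad m)) \<le> D * truncation p\<^sub>1 (maximal f) m" for m
      proof (cases p\<^sub>1)
        case PInf
        then show ?thesis using good_Linf[OF van, of m] by (simp add: truncation_def)
      next
        case (real r)
        then show ?thesis using good_Lr[OF van p(1) _ Ffin, of r m] p by (simp add: truncation_def)
      qed (use p in auto)
      have split: "f = (\<lambda>x. f x - good f (dyad m) x) + good f (dyad m)" for m by (simp add: fun_eq_iff)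
      show "\<exists>a0\<in>H1. \<exists>a1\<in>Lp_space \<nu> p\<^sub>1. f = a0 + a1"
        using bad_part_norm_le(1)[OF van up] good split by blast
      have K0: "0 \<le> ?K t f" if "0 < t" for t
      proof (rule K_functional_ge[OF _ _ split[of 0]])
        show "(\<lambda>x. f x - good f (dyad 0) x) \<in> fst H1_nspace"
          unfolding fst_conv by (rule bad_part_norm_le(1)[OF van up])
        show "good f (dyad 0) \<in> fst (Lp_nspace p\<^sub>1)"
          unfolding fst_conv using good by blast
        show "0 \<le> snd H1_nspace a0 + t * snd (Lp_nspace p\<^sub>1) a1"
          if "a0 \<in> fst H1_nspace" "a1 \<in> fst (Lp_nspace p\<^sub>1)" for a0 a1
          using that \<open>0 < t\<close> H1_norm_nonneg Lp_norm_nonneg by simp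
      qed
      have K: "?K t f \<le> 42 * D * (enn2real (upper_part (maximal f) m) + t * truncation p\<^sub>1 (maximal f) m)" if t: "0 < t" for t m
      proof -
        have Y0: "0 \<le> truncation p\<^sub>1 (maximal f) m" by (simp add: truncation_def truncated_norm_def)
        have "?K t f \<le> H1_norm (\<lambda>x. f x - good f (dyad m) x) + t * Lp_norm \<nu> p\<^sub>1 (good f (dyad m))"
          using K_functional_le[OF nonneg_norms(1) nonneg_norms(2)[of p\<^sub>1], of t _ _ f]
            bad_part_norm_le(1)[OF van up] good split t by force
        also have "\<dots> \<le> 42 * D * enn2real (upper_part (maximal f) m) + t * (D * truncation p\<^sub>1 (maximal f) m)"
          using bad_part_norm_le(2)[OF van up] good t by (intro add_mono mult_left_mono) auto
        also have "t * (D * truncation p\<^sub>1 (maximal f) m) \<le> 42 * D * (t * truncation p\<^sub>1 (maximal f) m)"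
          using D_pos t Y0 mult_right_mono[of D "42 * D" "t * truncation p\<^sub>1 (maximal f) m"] by (simp add: mult_ac)
        finally show ?thesis by (simp add: distrib_left)
      qed
      show "interp_integral H1_nspace (Lp_nspace p\<^sub>1) \<theta> p f
        \<le> ennreal (?C0 * (C1 * ?M)) * norm_power_integral p f"
      proof (cases "\<forall>x. f x = 0")
        case True
        then have "f = 0" by (simp add: fun_eq_iff)
        then have "interp_integral H1_nspace (Lp_nspace p\<^sub>1) \<theta> p f
           = (\<integral>\<^sup>+t\<in>{0<..}. 0 \<partial>(lborel :: real measure))"
          unfolding interp_integral_def using K_functional_zero[OF _ p1]
          by (intro nn_integral_cong) (auto simp: indicator_def)
        then show ?thesis by simp
      next
        case False
        then obtain x\<^sub>0 where "f x\<^sub>0 \<noteq> 0" by blast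
        then have x0: "0 < maximal f x\<^sub>0" using less_le_trans[OF _ norm_le_maximal[OF van, of x\<^sub>0]] by simp
        have "interp_integral H1_nspace (Lp_nspace p\<^sub>1) \<theta> p f
           \<le> ennreal ?C0 * (ennreal C1 * power_integral p (maximal f))"
          unfolding interp_integral_def
          by (rule bound[OF maximal_nonneg[OF van] x0 Ffin K0 K])
        also have "\<dots> \<le> ennreal ?C0 * (ennreal C1 * (ennreal ?M * norm_power_integral p f))"
          by (intro mult_left_mono strong) auto
        also have "\<dots> = ennreal (?C0 * (C1 * ?M)) * norm_power_integral p f"
          using C0 C1 M by (simp only: ennreal_mult[OF less_imp_le less_imp_le] mult_pos_pos mult.assoc)
        finally show ?thesis .
      qed
    qed
  qed
qed

lemma norm_le_Lp_norm:
  assumes "p\<^sub>1 = \<infinity> \<or> (\<exists>r>0. p\<^sub>1 = ereal r)"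
  shows "\<exists>c>0. \<forall>a\<in>Lp_space \<nu> p\<^sub>1. norm (a x) \<le> c * Lp_norm \<nu> p\<^sub>1 a"
proof (cases "p\<^sub>1 = \<infinity>")
  case True
  then show ?thesis using Linf_norm(1) by (intro exI[of _ 1]) auto
next
  case False
  then obtain r where r: "0 < r" "p\<^sub>1 = ereal r" using assms by auto
  let ?w = "real q powi level x"
  show ?thesis
  proof (intro exI[of _ "?w powr (- 1 / r)"] conjI ballI)
    show "0 < ?w powr (- 1 / r)" unfolding powr_gt_zero using w_pos[of x] by (metis less_irrefl)
    fix a assume a: "a \<in> Lp_space \<nu> p\<^sub>1"
    have "ennreal ?w * ennreal (norm (a x) powr r) \<le> norm_power_integral r a"
      by (rule le_nn_integral_\<nu>)
    also have "\<dots> = ennreal (Lp_norm \<nu> (ereal r) a powr r)"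
      using a r by (intro Lp_norm_powr[symmetric]) auto
    finally have "?w * norm (a x) powr r \<le> Lp_norm \<nu> (ereal r) a powr r"
      using w_pos[of x] by (simp add: less_imp_le flip: ennreal_mult)
    then have "norm (a x) powr r \<le> ?w powr - 1 * Lp_norm \<nu> (ereal r) a powr r"
      using w_pos[of x] by (simp add: powr_minus field_simps)
    then have "(norm (a x) powr r) powr (1 / r) \<le> (?w powr - 1 * Lp_norm \<nu> (ereal r) a powr r) powr (1 / r)"
      using r by (intro powr_mono2) auto
    also have "\<dots> = (?w powr - 1) powr (1 / r) * (Lp_norm \<nu> (ereal r) a powr r) powr (1 / r)"
      by (rule powr_mult)
    also have "(?w powr - 1) powr (1 / r) = ?w powr (- 1 / r)" by (subst powr_powr) simp
    finally show "norm (a x) \<le> ?w powr (- 1 / r) * Lp_norm \<nu> p\<^sub>1 a"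
      using r Lp_norm_nonneg[OF a] by (simp add: powr_powr)
  qed
qed

text \<open>The exponent \<open>\<sigma> = 1 / (1 - 1 / p\<^sub>1)\<close> balances the two Markov inequalities: with the
  threshold \<open>2 * K (dyad j) * dyad j powr - \<sigma>\<close>, the parts of a nearly optimal splitting in \<open>L\<^sup>1\<close>
  and in \<open>L\<close> with exponent \<open>p\<^sub>1\<close> both exceed it on a set of measure at most \<open>dyad j powr \<sigma>\<close>.\<close>

lemma Lp_le_interp_integral:
  fixes p \<theta> :: real and p\<^sub>1 :: ereal
  assumes p: "1 < p" "ereal p < p\<^sub>1"
    and \<theta>: "0 < \<theta>" "\<theta> < 1" "ereal (1 / p) = 1 - ereal \<theta> + ereal \<theta> / p\<^sub>1"
  shows "\<exists>C>0. \<forall>a0\<in>H1. \<forall>a1\<in>Lp_space \<nu> p\<^sub>1.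
    (\<integral>\<^sup>+x. ennreal (norm ((a0 + a1) x) powr p) \<partial>\<nu>)
      \<le> ennreal C * interp_integral H1_nspace (Lp_nspace p\<^sub>1) \<theta> p (a0 + a1)"
proof -
  let ?K = "K_functional H1_nspace (Lp_nspace p\<^sub>1)"
  have p1: "p\<^sub>1 = \<infinity> \<or> (\<exists>r>0. p\<^sub>1 = ereal r)" using p by (cases p\<^sub>1) auto
  define \<sigma> where "\<sigma> = (if p\<^sub>1 = \<infinity> then 1 else real_of_ereal p\<^sub>1 / (real_of_ereal p\<^sub>1 - 1))"
  have \<sigma>: "1 \<le> \<sigma>" "\<sigma> * (p - 1) = \<theta> * p"
  proof -
    have "1 \<le> \<sigma> \<and> \<sigma> * (p - 1) = \<theta> * p"
    proof (cases p\<^sub>1)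
      case PInf
      have "1 / p = 1 - \<theta>" using \<theta>(3) PInf by (simp add: one_ereal_def)
      then have "1 = (1 - \<theta>) * p" using p by (simp add: field_simps)
      then show ?thesis using PInf by (simp add: \<sigma>_def algebra_simps)
    next
      case (real r)
      have r: "p < r" "1 < r" using p real by auto
      have e: "1 / p = 1 - \<theta> + \<theta> / r" using \<theta>(3) real p by (simp add: one_ereal_def)
      have "p * (1 / p) = p * (1 - \<theta> + \<theta> / r)" unfolding e ..
      then have "1 = p * (1 - \<theta> + \<theta> / r)" using p by simp
      then have "r = p * (r - \<theta> * r + \<theta>)" using r by (simp add: field_simps)
      then have "r * (p - 1) = \<theta> * p * (r - 1)" by (simp add: algebra_simps)
      then have "r / (r - 1) * (p - 1) = \<theta> * p" using r by (simp add: field_simps)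
      then show ?thesis using real r by (simp add: \<sigma>_def)
    qed (use p in auto)
    then show "1 \<le> \<sigma>" "\<sigma> * (p - 1) = \<theta> * p" by auto
  qed
  let ?C1 = "2 * 4 powr p * 2 powr \<sigma>" and ?C2 = "2 powr (\<theta> * p + 1)"
  show ?thesis
  proof (intro exI[of _ "?C1 * ?C2"] conjI ballI)
    show "0 < ?C1 * ?C2" by simp
    fix a0 a1 assume a0: "a0 \<in> H1" and a1: "a1 \<in> Lp_space \<nu> p\<^sub>1"
    define f where "f = a0 + a1"
    define I where "I = interp_integral H1_nspace (Lp_nspace p\<^sub>1) \<theta> p f"
    have "norm_power_integral p f \<le> ennreal (?C1 * ?C2) * I"
    proof (cases "\<forall>x. f x = 0")
      case False
      then obtain x\<^sub>0 where x0: "f x\<^sub>0 \<noteq> 0" by blast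
      \<comment> \<open>strict positivity provides splittings within a factor two of the infimum\<close>
      have K0: "0 < ?K t f" if t: "0 < t" for t
      proof -
        obtain c where c: "0 < c" "\<And>a. a \<in> Lp_space \<nu> p\<^sub>1 \<Longrightarrow> norm (a x\<^sub>0) \<le> c * Lp_norm \<nu> p\<^sub>1 a"
          using norm_le_Lp_norm[OF p1] by blast
        let ?w = "real q powi level x\<^sub>0"
        define B where "B = max (1 / ?w) (c / t)"
        have B: "0 < B" using c t by (simp add: B_def less_max_iff_disj)
        have "norm (f x\<^sub>0) / B \<le> ?K t f"
        proof (rule K_functional_ge)
          show "a0 \<in> fst H1_nspace" "a1 \<in> fst (Lp_nspace p\<^sub>1)" "f = a0 + a1"
            using a0 a1 f_def by auto
          fix b0 b1
          assume "b0 \<in> fst H1_nspace" "b1 \<in> fst (Lp_nspace p\<^sub>1)" and f: "f = b0 + b1"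
          then have b: "b0 \<in> H1" "b1 \<in> Lp_space \<nu> p\<^sub>1" by auto
          have "ennreal ?w * ennreal (norm (b0 x\<^sub>0)) \<le> ennreal (H1_norm b0)"
            using le_nn_integral_\<nu> L1_norm_le_H1_norm[OF b(1)] by (rule order_trans)
          then have "?w * norm (b0 x\<^sub>0) \<le> H1_norm b0"
            using w_pos[of x\<^sub>0] H1_norm_nonneg[OF b(1)] by (simp add: less_imp_le flip: ennreal_mult)
          then have "norm (b0 x\<^sub>0) \<le> 1 / ?w * H1_norm b0" using w_pos[of x\<^sub>0] by (simp add: field_simps)
          also have "\<dots> \<le> B * H1_norm b0"
            using H1_norm_nonneg[OF b(1)] by (intro mult_right_mono) (auto simp: B_def)
          finally have 1: "norm (b0 x\<^sub>0) \<le> B * H1_norm b0" .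
          have "norm (b1 x\<^sub>0) \<le> c / t * (t * Lp_norm \<nu> p\<^sub>1 b1)" using c(2)[OF b(2)] t by simp
          also have "\<dots> \<le> B * (t * Lp_norm \<nu> p\<^sub>1 b1)"
            using Lp_norm_nonneg[OF b(2)] t by (intro mult_right_mono) (auto simp: B_def)
          finally have 2: "norm (b1 x\<^sub>0) \<le> B * (t * Lp_norm \<nu> p\<^sub>1 b1)" .
          have "norm (f x\<^sub>0) \<le> norm (b0 x\<^sub>0) + norm (b1 x\<^sub>0)" unfolding f by (simp add: norm_triangle_ineq)
          also have "\<dots> \<le> B * (H1_norm b0 + t * Lp_norm \<nu> p\<^sub>1 b1)" using 1 2 by (simp add: distrib_left)
          finally show "norm (f x\<^sub>0) / B \<le> snd H1_nspace b0 + t * snd (Lp_nspace p\<^sub>1) b1"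
            using B by (simp add: field_simps)
        qed
        moreover have "0 < norm (f x\<^sub>0) / B" using x0 B by simp
        ultimately show ?thesis by linarith
      qed
      have Kmono: "?K s f \<le> ?K t f" if st: "0 < s" "s \<le> t" for s t
      proof (rule K_functional_ge)
        show "a0 \<in> fst H1_nspace" "a1 \<in> fst (Lp_nspace p\<^sub>1)" "f = a0 + a1"
          using a0 a1 f_def by auto
        fix b0 b1
        assume b: "b0 \<in> fst H1_nspace" "b1 \<in> fst (Lp_nspace p\<^sub>1)" "f = b0 + b1"
        have "?K s f \<le> snd H1_nspace b0 + s * snd (Lp_nspace p\<^sub>1) b1"
          by (rule K_functional_le[OF nonneg_norms _ b]) (use st in simp)
        also have "\<dots> \<le> snd H1_nspace b0 + t * snd (Lp_nspace p\<^sub>1) b1"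
          using b st Lp_norm_nonneg by (intro add_left_mono mult_right_mono) auto
        finally show "?K s f \<le> snd H1_nspace b0 + t * snd (Lp_nspace p\<^sub>1) b1" .
      qed
      have level: "emeasure \<nu> {x. 4 * ?K (dyad j) f * dyad j powr - \<sigma> < norm (f x)}
          \<le> ennreal (2 * dyad j powr \<sigma>)" for j
      proof -
        let ?k = "?K (dyad j) f"
        define c where "c = 2 * ?k * dyad j powr - \<sigma>"
        have k: "0 < ?k" by (rule K0) simp
        then have c: "0 < c" by (simp add: c_def)
        have "?k < 2 * ?k" using k by simp
        then obtain b0 b1 where "b0 \<in> fst H1_nspace" "b1 \<in> fst (Lp_nspace p\<^sub>1)"
          and f: "f = b0 + b1" and lt: "snd H1_nspace b0 + dyad j * snd (Lp_nspace p\<^sub>1) b1 < 2 * ?k"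
          by (rule K_functional_lessD[rotated 3]) (use a0 a1 f_def in auto)
        then have b: "b0 \<in> H1" "b1 \<in> Lp_space \<nu> p\<^sub>1" by auto
        have n0: "0 \<le> H1_norm b0" "0 \<le> Lp_norm \<nu> p\<^sub>1 b1" using H1_norm_nonneg Lp_norm_nonneg b by auto
        have "H1_norm b0 + dyad j * Lp_norm \<nu> p\<^sub>1 b1 < 2 * ?k" using lt by simp
        moreover have "0 \<le> dyad j * Lp_norm \<nu> p\<^sub>1 b1" using n0(2) by (intro mult_nonneg_nonneg) auto
        ultimately have n1: "H1_norm b0 \<le> 2 * ?k" and n2: "dyad j * Lp_norm \<nu> p\<^sub>1 b1 \<le> 2 * ?k"
          using n0(1) by linarith+
        have "{x. 4 * ?k * dyad j powr - \<sigma> < norm (f x)} \<subseteq> {x. c < norm (b0 x)} \<union> {x. c < norm (b1 x)}"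
        proof
          fix x assume "x \<in> {x. 4 * ?k * dyad j powr - \<sigma> < norm (f x)}"
          moreover have "c + c = 4 * ?k * dyad j powr - \<sigma>" by (simp add: c_def)
          ultimately have "c + c < norm (f x)" by (simp only: mem_Collect_eq)
          also have "\<dots> \<le> norm (b0 x) + norm (b1 x)" unfolding f by (simp add: norm_triangle_ineq)
          finally show "x \<in> {x. c < norm (b0 x)} \<union> {x. c < norm (b1 x)}" by auto
        qed
        then have "emeasure \<nu> {x. 4 * ?k * dyad j powr - \<sigma> < norm (f x)}
           \<le> emeasure \<nu> ({x. c < norm (b0 x)} \<union> {x. c < norm (b1 x)})"
          by (rule emeasure_mono) simp
        also have "\<dots> \<le> emeasure \<nu> {x. c < norm (b0 x)} + emeasure \<nu> {x. c < norm (b1 x)}"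
          by (rule emeasure_subadditive) auto
        also have "\<dots> \<le> ennreal (dyad j powr \<sigma>) + ennreal (dyad j powr \<sigma>)"
        proof (rule add_mono)
          have "emeasure \<nu> {x. c < norm (b0 x)} \<le> ennreal (c powr - 1) * norm_integral b0"
            using markov_inequality[OF c, of 1 b0] by simp
          also have "\<dots> \<le> ennreal (c powr - 1) * ennreal (2 * ?k)"
            using L1_norm_le_H1_norm[OF b(1)] ennreal_leI[OF n1] by (intro mult_left_mono) auto
          also have "\<dots> = ennreal (c powr - 1 * (2 * ?k))" by (rule ennreal_mult'[symmetric]) simp
          also have "c powr - 1 * (2 * ?k) = dyad j powr \<sigma>"
            using k c by (simp add: powr_minus c_def field_simps)
          finally show "emeasure \<nu> {x. c < norm (b0 x)} \<le> ennreal (dyad j powr \<sigma>)" .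
        next
          show "emeasure \<nu> {x. c < norm (b1 x)} \<le> ennreal (dyad j powr \<sigma>)"
          proof (cases p\<^sub>1)
            case PInf
            have "norm (b1 x) \<le> c" for x
            proof -
              have "norm (b1 x) \<le> Lp_norm \<nu> p\<^sub>1 b1" using Linf_norm(1) b(2) PInf by simp
              also have "\<dots> \<le> c" using n2 PInf by (simp add: c_def \<sigma>_def powr_minus field_simps)
              finally show ?thesis .
            qed
            then have "{x. c < norm (b1 x)} = {}" by (auto simp: not_less)
            then show ?thesis by simp
          next
            case (real r)
            have r: "1 < r" using p real by auto
            have "emeasure \<nu> {x. c < norm (b1 x)} \<le> ennreal (c powr - r) * norm_power_integral r b1"
              using r by (intro markov_inequality c) auto
            also have "\<dots> = ennreal (c powr - r) * ennreal (Lp_norm \<nu> p\<^sub>1 b1 powr r)"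
              using Lp_norm_powr[of r b1] b(2) r real by simp
            also have "\<dots> \<le> ennreal (c powr - r) * ennreal ((2 * ?k * dyad j powr - 1) powr r)"
            proof (intro mult_left_mono ennreal_leI powr_mono2)
              show "Lp_norm \<nu> p\<^sub>1 b1 \<le> 2 * ?k * dyad j powr - 1"
                using n2 by (simp add: powr_minus field_simps)
            qed (use n0 r in auto)
            also have "\<dots> = ennreal (c powr - r * (2 * ?k * dyad j powr - 1) powr r)" by (simp add: ennreal_mult')
            also have "c powr - r * (2 * ?k * dyad j powr - 1) powr r = dyad j powr \<sigma>"
            proof -
              have s: "\<sigma> * r - r = \<sigma>" using r real by (simp add: \<sigma>_def field_simps)
              have "c powr - r * (2 * ?k * dyad j powr - 1) powr r
                 = ((2 * ?k) powr - r * (2 * ?k) powr r) * ((dyad j powr - \<sigma>) powr - r * (dyad j powr - 1) powr r)"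
                unfolding c_def by (simp only: powr_mult mult_ac)
              also have "(2 * ?k) powr - r * (2 * ?k) powr r = 1"
                using k by (simp flip: powr_add)
              also have "(dyad j powr - \<sigma>) powr - r * (dyad j powr - 1) powr r = dyad j powr (\<sigma> * r - r)"
                by (simp only: powr_powr[of "dyad j"] powr_add[symmetric]) simp
              finally show ?thesis unfolding s by simp
            qed
            finally show ?thesis .
          qed (use p in auto)
        qed
        also have "\<dots> = ennreal (2 * dyad j powr \<sigma>)" by (simp flip: ennreal_plus)
        finally show ?thesis .
      qed
      have "\<theta> < \<sigma>" using \<theta> \<sigma> by simp
      have "norm_power_integral p f
         \<le> ennreal ?C1 * dyadic_sum (\<lambda>j. ennreal ((dyad j powr - \<theta> * ?K (dyad j) f) powr p))"
        by (rule Lp_le_of_superlevels[OF _ level p(1) \<theta>(1) \<open>\<theta> < \<sigma>\<close> \<sigma>(2)]) (use K0 in \<open>simp add: less_imp_le\<close>)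
      also have "\<dots> \<le> ennreal ?C1 * (ennreal ?C2 * I)"
        unfolding I_def interp_integral_def
        by (intro mult_left_mono dyadic_sum_le_interp Kmono \<theta>(1,2) p(1)) (use K0 in \<open>auto simp: less_imp_le\<close>)
      also have "\<dots> = ennreal (?C1 * ?C2) * I" by (simp only: ennreal_mult' powr_ge_zero mult.assoc)
      finally show ?thesis .
    qed simp
    then show "(\<integral>\<^sup>+x. ennreal (norm ((a0 + a1) x) powr p) \<partial>\<nu>)
      \<le> ennreal (?C1 * ?C2) * interp_integral H1_nspace (Lp_nspace p\<^sub>1) \<theta> p (a0 + a1)"
      unfolding f_def I_def .
  qed
qed

lemma root_mono_ennreal:
  assumes "0 < p" "0 < C" "x \<le> ennreal C * y" "y < top"
  shows "enn2real x powr (1 / p) \<le> C powr (1 / p) * enn2real y powr (1 / p)"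
proof -
  have "ennreal C * y < top" using assms by (simp add: ennreal_mult_less_top)
  then have "enn2real x \<le> C * enn2real y"
    using enn2real_mono[OF assms(3)] assms(2) by (simp add: enn2real_mult)
  then have "enn2real x powr (1 / p) \<le> (C * enn2real y) powr (1 / p)"
    using assms(1) by (intro powr_mono2) auto
  also have "\<dots> = C powr (1 / p) * enn2real y powr (1 / p)" by (rule powr_mult)
  finally show ?thesis .
qed

lemma interp_Hardy_Lp:
  fixes p \<theta> :: real and p\<^sub>1 :: ereal
  assumes p: "1 < p" "ereal p < p\<^sub>1"
    and \<theta>: "0 < \<theta>" "\<theta> < 1" "ereal (1 / p) = 1 - ereal \<theta> + ereal \<theta> / p\<^sub>1"
  defines "Hardy \<equiv> H1_nspace" and "Leb \<equiv> (Lp_space \<mu> p\<^sub>1, Lp_norm \<mu> p\<^sub>1)"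
  shows "interp_space Hardy Leb \<theta> p = Lp_space \<mu> p \<and>
    (\<exists>c>0. \<exists>C>0. \<forall>f\<in>Lp_space \<mu> p.
       c * Lp_norm \<mu> p f \<le> interp_norm Hardy Leb \<theta> p f \<and>
       interp_norm Hardy Leb \<theta> p f \<le> C * Lp_norm \<mu> p f)"
proof -
  let ?I = "interp_integral Hardy Leb \<theta> p" and ?J = "\<lambda>f. norm_power_integral p f"
  have p0: "0 < p" using p by simp
  obtain A where A: "0 < A" "\<And>f. f \<in> Lp_space \<nu> p \<Longrightarrow> (\<exists>a0\<in>H1. \<exists>a1\<in>Lp_space \<nu> p\<^sub>1. f = a0 + a1)"
    "\<And>f. f \<in> Lp_space \<nu> p \<Longrightarrow> ?I f \<le> ennreal A * ?J f"
    using interp_integral_le_Lp[OF p \<theta>] unfolding Hardy_def Leb_def \<mu>_eq_\<nu> by blast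
  obtain B where B: "0 < B"
    "\<And>a0 a1. \<lbrakk>a0 \<in> H1; a1 \<in> Lp_space \<nu> p\<^sub>1\<rbrakk> \<Longrightarrow> ?J (a0 + a1) \<le> ennreal B * ?I (a0 + a1)"
    using Lp_le_interp_integral[OF p \<theta>] unfolding Hardy_def Leb_def \<mu>_eq_\<nu> by blast
  have J: "?J f < top" if "f \<in> Lp_space \<nu> p" for f using that by (simp add: mem_Lp_iff)
  have I: "?I f < top" if "f \<in> Lp_space \<nu> p" for f
    by (rule le_less_trans[OF A(3)[OF that]]) (use J[OF that] in \<open>simp add: ennreal_mult_less_top\<close>)
  have "interp_space Hardy Leb \<theta> p = Lp_space \<nu> p"
  proof (intro set_eqI iffI)
    fix f assume "f \<in> interp_space Hardy Leb \<theta> p"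
    then obtain a0 a1 where f: "a0 \<in> H1" "a1 \<in> Lp_space \<nu> p\<^sub>1" "f = a0 + a1" and fin: "?I f < top"
      by (auto simp: interp_space_def Hardy_def Leb_def \<mu>_eq_\<nu>)
    have "?J f \<le> ennreal B * ?I f" using B(2)[OF f(1,2)] f(3) by simp
    also have "\<dots> < top" using fin by (simp add: ennreal_mult_less_top)
    finally show "f \<in> Lp_space \<nu> p" by (simp add: mem_Lp_iff)
  next
    fix f assume "f \<in> Lp_space \<nu> (ereal p)"
    then show "f \<in> interp_space Hardy Leb \<theta> p"
      using A(2) I by (auto simp: interp_space_def Hardy_def Leb_def \<mu>_eq_\<nu>)
  qed
  moreover have "(1 / B) powr (1 / p) * Lp_norm \<nu> p f \<le> interp_norm Hardy Leb \<theta> p f \<and>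
       interp_norm Hardy Leb \<theta> p f \<le> A powr (1 / p) * Lp_norm \<nu> p f" if f: "f \<in> Lp_space \<nu> p" for f
  proof
    obtain a0 a1 where a: "a0 \<in> H1" "a1 \<in> Lp_space \<nu> p\<^sub>1" "f = a0 + a1" using A(2)[OF f] by blast
    have "?J f \<le> ennreal B * ?I f" using B(2)[OF a(1,2)] a(3) by simp
    then have "Lp_norm \<nu> p f \<le> B powr (1 / p) * interp_norm Hardy Leb \<theta> p f"
      unfolding Lp_norm_eq interp_norm_def by (rule root_mono_ennreal[OF p0 B(1) _ I[OF f]])
    then have "(1 / B) powr (1 / p) * Lp_norm \<nu> p f
       \<le> (1 / B) powr (1 / p) * (B powr (1 / p) * interp_norm Hardy Leb \<theta> p f)"
      by (rule mult_left_mono) simp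
    also have "\<dots> = interp_norm Hardy Leb \<theta> p f"
      using B(1) by (simp only: mult.assoc[symmetric] powr_mult[symmetric]) simp
    finally show "(1 / B) powr (1 / p) * Lp_norm \<nu> p f \<le> interp_norm Hardy Leb \<theta> p f" .
    show "interp_norm Hardy Leb \<theta> p f \<le> A powr (1 / p) * Lp_norm \<nu> p f"
      unfolding Lp_norm_eq interp_norm_def by (rule root_mono_ennreal[OF p0 A(1) A(3)[OF f] J[OF f]])
  qed
  moreover have "0 < (1 / B) powr (1 / p)" "0 < A powr (1 / p)" using A(1) B(1) by auto
  ultimately show ?thesis unfolding \<mu>_eq_\<nu> by blast
qed

end

theorem theorem4p6:
  fixes q :: nat and adj :: "'v \<Rightarrow> 'v \<Rightarrow> bool" and g :: "'v set" and N :: "'v \<Rightarrow> int"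
    and p \<theta> :: real and p\<^sub>1 :: ereal
  assumes tree: "weighted_tree q adj g N"
    and p: "1 < p" "ereal p < p\<^sub>1"
    and \<theta>: "0 < \<theta>" "\<theta> < 1" "ereal (1 / p) = 1 - ereal \<theta> + ereal \<theta> / p\<^sub>1"
  defines "\<mu> \<equiv> weighted_tree.\<mu> q adj g N"
  defines "Hardy \<equiv> (weighted_tree.H1 q adj g N, weighted_tree.H1_norm q adj g N)"
    and "Leb \<equiv> (Lp_space \<mu> p\<^sub>1, Lp_norm \<mu> p\<^sub>1)"
  shows "interp_space Hardy Leb \<theta> p = Lp_space \<mu> p \<and>
    (\<exists>c>0. \<exists>C>0. \<forall>f\<in>Lp_space \<mu> p.
       c * Lp_norm \<mu> p f \<le> interp_norm Hardy Leb \<theta> p f \<and>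
       interp_norm Hardy Leb \<theta> p f \<le> C * Lp_norm \<mu> p f)"
  unfolding \<mu>_def Hardy_def Leb_def by (rule weighted_tree.interp_Hardy_Lp[OF tree p \<theta>])

end
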